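(* Let $\mathbb{K}$ be a field. Every chordal graph is initially Cohen--Macaulay (over $\mathbb{K}$). In particular, for $n\ge2$, the path graph $P_n$ is initially Cohen--Macaulay and $\mathrm{depth}\,R/I(P_n)=\left\lceil \frac{n}{3}\right\rceil$, where $R=\mathbb{K}[x_1,\dots,x_n]$.
   Context: Graphs are finite and simple. A graph is chordal if it contains no induced cycle $C_k$ with $k\ge4$. The path graph $P_n$ has vertices $x_1,\dots,x_n$ and edges $\{x_i,x_{i+1}\}$ for $1\le i<n$. For a graph $G$ on $x_1,\dots,x_n$ the edge ideal is $I(G)=(x_ix_j\mid\{x_i,x_j\}\in E(G))\subset R=\mathbb{K}[x_1,\dots,x_n]$; it is the Stanley--Reisner ideal of the independence complex $\Delta_G$. The initial dimension of a module $N$ is $\mathrm{indim}\,N=\inf\{\dim R/P\mid P\in\mathrm{Ass}_R N\}$. $G$ is initially Cohen--Macaulay over $\mathbb{K}$ if $\mathrm{depth}\,R/I(G)=\mathrm{indim}\,R/I(G)$, depth being taken with respect to $(x_1,\dots,x_n)$. *)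

theory Defs
  imports
    Complex_Main
    "HOL-Library.Extended_Nat"
    "HOL-Library.Poly_Mapping"
    "HOL-Algebra.Module"
    "HOL-Algebra.QuotRing"
begin

section \<open>Graphs\<close>

definition simple_graph :: "'v set \<Rightarrow> 'v set set \<Rightarrow> bool" where
  "simple_graph V E \<longleftrightarrow>
     finite V \<and> (\<forall>e\<in>E. \<exists>u v. u \<in> V \<and> v \<in> V \<and> u \<noteq> v \<and> e = {u, v})"

definition graph_isomorphic ::
    "'a set \<Rightarrow> 'a set set \<Rightarrow> 'b set \<Rightarrow> 'b set set \<Rightarrow> bool" where
  "graph_isomorphic V E V' E' \<longleftrightarrow>
     (\<exists>f. bij_betw f V V' \<and> (\<forall>u\<in>V. \<forall>v\<in>V. {u, v} \<in> E \<longleftrightarrow> {f u, f v} \<in> E'))"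

definition induced_edges :: "'v set set \<Rightarrow> 'v set \<Rightarrow> 'v set set" where
  "induced_edges E W = {e \<in> E. e \<subseteq> W}"

text \<open>The cycle \<open>C\<^sub>k\<close> on the vertex set \<open>{..<k}\<close>, for \<open>k \<ge> 3\<close>.\<close>

definition cycle_edges :: "nat \<Rightarrow> nat set set" where
  "cycle_edges k = {{i, Suc i mod k} | i. i < k}"

definition chordal :: "'v set \<Rightarrow> 'v set set \<Rightarrow> bool" where
  "chordal V E \<longleftrightarrow>
     \<not> (\<exists>k\<ge>4. \<exists>W\<subseteq>V. graph_isomorphic {..<k} (cycle_edges k) W (induced_edges E W))"

definition path_edges :: "nat \<Rightarrow> nat set set" where
  "path_edges n = {{i, i + 1} | i. 1 \<le> i \<and> i < n}"


section \<open>Dimension, associated primes and depth\<close>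

definition krull_dim :: "('a, 'm) ring_scheme \<Rightarrow> enat" where
  "krull_dim A = Sup {enat n | n. \<exists>P. (\<forall>i\<le>n. primeideal (P i) A) \<and> (\<forall>i<n. P i \<subset> P (Suc i))}"

definition annihilator ::
    "('a, 'm) ring_scheme \<Rightarrow> ('a, 'b, 'n) module_scheme \<Rightarrow> 'b \<Rightarrow> 'a set" where
  "annihilator R N x = {r \<in> carrier R. r \<odot>\<^bsub>N\<^esub> x = \<zero>\<^bsub>N\<^esub>}"

definition Ass ::
    "('a, 'm) ring_scheme \<Rightarrow> ('a, 'b, 'n) module_scheme \<Rightarrow> 'a set set" where
  "Ass R N = {P. primeideal P R \<and> (\<exists>x\<in>carrier N. P = annihilator R N x)}"

definition indim :: "('a, 'm) ring_scheme \<Rightarrow> ('a, 'b, 'n) module_scheme \<Rightarrow> enat" where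
  "indim R N = Inf {krull_dim (R Quot P) | P. P \<in> Ass R N}"

text \<open>For a set \<open>F\<close> of ring elements, the submodule \<open>(F) N\<close> of \<open>N\<close>.\<close>

definition mult_submodule ::
    "('a, 'm) ring_scheme \<Rightarrow> ('a, 'b, 'n) module_scheme \<Rightarrow> 'a set \<Rightarrow> 'b set" where
  "mult_submodule R N F =
     \<Inter> {H. submodule H R N \<and> (\<forall>f\<in>F. \<forall>x\<in>carrier N. f \<odot>\<^bsub>N\<^esub> x \<in> H)}"

text \<open>
  The sequence \<open>f\<^sub>0, \<dots>, f\<^sub>r\<^sub>-\<^sub>1\<close> is \<open>N\<close>-regular if each \<open>f\<^sub>i\<close> is a nonzerodivisor on
  \<open>N / (f\<^sub>0, \<dots>, f\<^sub>i\<^sub>-\<^sub>1) N\<close> and \<open>N / (f\<^sub>0, \<dots>, f\<^sub>r\<^sub>-\<^sub>1) N\<close> is nonzero; both conditions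
  are expressed on representatives in \<open>N\<close>.
\<close>

definition regular_sequence ::
    "('a, 'm) ring_scheme \<Rightarrow> ('a, 'b, 'n) module_scheme \<Rightarrow> 'a list \<Rightarrow> bool" where
  "regular_sequence R N fs \<longleftrightarrow>
     set fs \<subseteq> carrier R \<and>
     (\<forall>i<length fs. \<forall>x\<in>carrier N.
        fs ! i \<odot>\<^bsub>N\<^esub> x \<in> mult_submodule R N (set (take i fs)) \<longrightarrow>
        x \<in> mult_submodule R N (set (take i fs))) \<and>
     mult_submodule R N (set fs) \<noteq> carrier N"

text \<open>
  The depth of \<open>N\<close> with respect to \<open>J\<close>, for finitely generated \<open>N\<close> over a Noetherian ring
  with \<open>J N \<noteq> N\<close> (otherwise the usual convention would be \<open>\<infinity>\<close>).
\<close>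

definition depth ::
    "('a, 'm) ring_scheme \<Rightarrow> 'a set \<Rightarrow> ('a, 'b, 'n) module_scheme \<Rightarrow> enat" where
  "depth R J N = Sup {enat (length fs) | fs. set fs \<subseteq> J \<and> regular_sequence R N fs}"

text \<open>\<open>R / I\<close> as an \<open>R\<close>-module; the underlying additive group (and ring) is \<open>R Quot I\<close>.\<close>

definition quot_module :: "('a, 'm) ring_scheme \<Rightarrow> 'a set \<Rightarrow> ('a, 'a set) module" where
  "quot_module R I = ring.extend (R Quot I)
     (module.fields (\<lambda>r X. (I +>\<^bsub>R\<^esub> r) \<otimes>\<^bsub>R Quot I\<^esub> X))"


section \<open>Polynomial rings and edge ideals\<close>

text \<open>
  Monomials are finitely supported exponent functions, polynomials are finitely supported
  coefficient functions on monomials.  The ring \<open>K[x\<^sub>v | v \<in> V]\<close> consists of the polynomials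
  in whose monomials only variables from \<open>V\<close> occur.
\<close>

type_synonym ('v, 'k) mpoly = "('v \<Rightarrow>\<^sub>0 nat) \<Rightarrow>\<^sub>0 'k"

definition mpoly_ring :: "'v set \<Rightarrow> ('v, 'k::field) mpoly ring" where
  "mpoly_ring V =
     \<lparr>carrier = {p. \<forall>m\<in>Poly_Mapping.keys p. Poly_Mapping.keys m \<subseteq> V},
      mult = (*), one = 1, zero = 0, add = (+)\<rparr>"

definition mvar :: "'v \<Rightarrow> ('v, 'k::field) mpoly" where
  "mvar v = Poly_Mapping.single (Poly_Mapping.single v 1) 1"

definition irrelevant_ideal :: "'v set \<Rightarrow> ('v, 'k::field) mpoly set" where
  "irrelevant_ideal V = genideal (mpoly_ring V) (mvar ` V)"

definition edge_ideal :: "'v set \<Rightarrow> 'v set set \<Rightarrow> ('v, 'k::field) mpoly set" where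
  "edge_ideal V E = genideal (mpoly_ring V) {mvar u * mvar v | u v. {u, v} \<in> E}"

definition edge_module ::
    "'v set \<Rightarrow> 'v set set \<Rightarrow> (('v, 'k::field) mpoly, ('v, 'k) mpoly set) module" where
  "edge_module V E = quot_module (mpoly_ring V) (edge_ideal V E)"

text \<open>The coefficient field enters through the type argument \<^typ>\<open>'k itself\<close>.\<close>

definition edge_depth :: "'k::field itself \<Rightarrow> 'v set \<Rightarrow> 'v set set \<Rightarrow> enat" where
  "edge_depth _ V E =
     depth (mpoly_ring V) (irrelevant_ideal V) (edge_module V E :: (('v, 'k) mpoly, _) module)"

definition edge_indim :: "'k::field itself \<Rightarrow> 'v set \<Rightarrow> 'v set set \<Rightarrow> enat" where
  "edge_indim _ V E = indim (mpoly_ring V) (edge_module V E :: (('v, 'k) mpoly, _) module)"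

definition initially_Cohen_Macaulay :: "'k::field itself \<Rightarrow> 'v set \<Rightarrow> 'v set set \<Rightarrow> bool" where
  "initially_Cohen_Macaulay K V E \<longleftrightarrow> edge_depth K V E = edge_indim K V E"


section \<open>Well-formedness\<close>

lemma mpoly_ring_simps:
  "carrier (mpoly_ring V) = {p. \<forall>m\<in>Poly_Mapping.keys p. Poly_Mapping.keys m \<subseteq> V}"
  "p \<otimes>\<^bsub>mpoly_ring V\<^esub> q = p * q" "p \<oplus>\<^bsub>mpoly_ring V\<^esub> q = p + q"
  "\<one>\<^bsub>mpoly_ring V\<^esub> = 1" "\<zero>\<^bsub>mpoly_ring V\<^esub> = 0"
  by (simp_all add: mpoly_ring_def)

lemma cring_mpoly_ring: "cring (mpoly_ring V :: ('v, 'k::field) mpoly ring)"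
proof (rule cringI)
  let ?R = "mpoly_ring V :: ('v, 'k) mpoly ring"
  have add: "p + q \<in> carrier ?R" if "p \<in> carrier ?R" "q \<in> carrier ?R" for p q
    using that Poly_Mapping.keys_add[of p q] unfolding mpoly_ring_simps by blast
  have mult: "p * q \<in> carrier ?R" if p: "p \<in> carrier ?R" and q: "q \<in> carrier ?R" for p q
  proof -
    have "Poly_Mapping.keys m \<subseteq> V" if m: "m \<in> Poly_Mapping.keys (p * q)" for m
    proof -
      obtain a b where "m = a + b" "a \<in> Poly_Mapping.keys p" "b \<in> Poly_Mapping.keys q"
        using keys_mult[of p q] m by blast
      with p q show ?thesis
        using Poly_Mapping.keys_add[of a b] unfolding mpoly_ring_simps by blast
    qed
    then show ?thesis unfolding mpoly_ring_simps by blast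
  qed
  have neg: "- p \<in> carrier ?R" if "p \<in> carrier ?R" for p
    using that unfolding mpoly_ring_simps by (simp add: in_keys_iff)
  have zero: "0 \<in> carrier ?R" and one: "1 \<in> carrier ?R"
    unfolding mpoly_ring_simps by simp_all
  show "abelian_group ?R"
  proof (rule abelian_groupI, unfold mpoly_ring_simps(2-5))
    fix p assume "p \<in> carrier ?R"
    then show "\<exists>q\<in>carrier ?R. q + p = 0"
      using neg[of p] by (intro bexI[of _ "- p"]) simp_all
  qed (use add zero in \<open>simp_all add: ac_simps\<close>)
  show "comm_monoid ?R"
    by (rule comm_monoidI; unfold mpoly_ring_simps(2-5))
      (use mult one in \<open>simp_all add: ac_simps\<close>)
qed (simp add: mpoly_ring_simps(2-5) distrib_right)

lemma mvar_in_mpoly_ring: "v \<in> V \<Longrightarrow> mvar v \<in> carrier (mpoly_ring V)"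
  by (simp add: mvar_def mpoly_ring_simps)

lemma ideal_edge_ideal:
  assumes "simple_graph V E"
  shows "ideal (edge_ideal V E) (mpoly_ring V :: ('v, 'k::field) mpoly ring)"
proof -
  interpret R: cring "mpoly_ring V :: ('v, 'k) mpoly ring"
    by (rule cring_mpoly_ring)
  have "mvar u * mvar v \<in> carrier (mpoly_ring V :: ('v, 'k) mpoly ring)" if "{u, v} \<in> E" for u v
  proof -
    have "u \<in> V" "v \<in> V"
      using assms that unfolding simple_graph_def by (metis doubleton_eq_iff)+
    then show ?thesis
      using R.m_closed[OF mvar_in_mpoly_ring mvar_in_mpoly_ring] by (simp only: mpoly_ring_simps(2))
  qed
  then show ?thesis
    unfolding edge_ideal_def by (intro R.genideal_ideal) blast
qed

lemma module_quot_module: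
  assumes "cring R" and "ideal I R"
  shows "module R (quot_module R I)"
proof -
  interpret R: cring R by fact
  interpret I: ideal I R by fact
  interpret Q: cring "R Quot I" by (rule I.quotient_is_cring[OF assms(1)])
  have h: "(+>\<^bsub>R\<^esub>) I \<in> ring_hom R (R Quot I)" by (rule I.rcos_ring_hom)
  have sel: "carrier (quot_module R I) = carrier (R Quot I)"
    "add (quot_module R I) = add (R Quot I)" "zero (quot_module R I) = zero (R Quot I)"
    "\<And>r x. r \<odot>\<^bsub>quot_module R I\<^esub> x = (I +>\<^bsub>R\<^esub> r) \<otimes>\<^bsub>R Quot I\<^esub> x"
    by (simp_all add: quot_module_def ring.defs module.defs FactRing_def)
  show ?thesis
  proof (rule moduleI)
    show "abelian_group (quot_module R I)"
    proof (rule abelian_groupI)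
      fix x assume "x \<in> carrier (quot_module R I)"
      then show "\<exists>y\<in>carrier (quot_module R I).
          y \<oplus>\<^bsub>quot_module R I\<^esub> x = \<zero>\<^bsub>quot_module R I\<^esub>"
        unfolding sel by (intro bexI[of _ "\<ominus>\<^bsub>R Quot I\<^esub> x"]) (simp_all add: Q.l_neg)
    qed (simp_all add: sel Q.a_ac)
  qed (simp_all add: sel assms ring_hom_closed[OF h] ring_hom_add[OF h] ring_hom_mult[OF h]
      ring_hom_one[OF h] Q.l_distr Q.r_distr Q.m_assoc)
qed

end

theory Submission
  imports Defs
begin

text \<open>
  Write \<open>I\<close> for the edge ideal and \<open>i(G)\<close> for the least size of a maximal independent set.
  The associated primes of \<open>R/I\<close> are the ideals \<open>P\<^sub>W = (x\<^sub>v | v \<notin> W)\<close> with \<open>W\<close> maximal independent,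
  and \<open>R/P\<^sub>W\<close> has dimension \<open>|W|\<close>, so the initial dimension is \<open>i(G)\<close>.

  Both upper bounds (chains of primes over \<open>P\<^sub>W\<close>, regular sequences on \<open>R/I\<close>) come from one
  argument: more than \<open>|W|\<close> elements are algebraically dependent modulo \<open>P\<^sub>W\<close>, and peeling off the
  lexicographically smallest monomial of a relation collapses the chain.

  For the lower bound on the depth, with \<open>d = i(G)\<close>, the elementary symmetric polynomials
  \<open>e\<^sub>d, \<dots>, e\<^sub>1\<close> form a regular sequence on every polynomial ring \<open>R/P\<^sub>U\<close> with \<open>|U| \<ge> d\<close>.  The property
  passes from \<open>A + (f)\<close> and \<open>A : f\<close> to \<open>A\<close>; taking \<open>f = x\<^sub>w\<close> for a neighbour \<open>w\<close> of a simplicial vertex,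
  it therefore descends to \<open>I\<close> by induction on the chordal graph.
\<close>

section \<open>Ideals and weakly regular sequences in a subring\<close>

text \<open>Depth is usually compared along the exact sequence relating \<open>A\<close>, the colon
  ideal of \<open>A\<close> by \<open>f\<close>, and \<open>A + (f)\<close>. This needs homological
  algebra, because the two outer quotients may have unrelated regular sequences. The obstacle
  disappears once a single sequence serves every ideal that occurs.

  The elementary symmetric polynomials in all of \<open>V\<close> are such a sequence. They do not
  depend on the complex, and they are available over every field, whereas general linear forms may
  require an infinite one. Modulo a coordinate prime that leaves exactly d variables, the one of
  degree d becomes a single squarefree monomial. Cutting by it gives the boundary of a simplex,
  whose facets have d - 1 vertices, and there the polynomial of degree d - 1 takes over. This
  explains the descending order of degrees. Primes with more than d variables are reduced to this
  case by killing surplus variables, which is legitimate because everything is homogeneous.\<close>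

definition ideal_in :: "'a::comm_ring_1 set \<Rightarrow> 'a set \<Rightarrow> bool" where
  "ideal_in S A \<longleftrightarrow>
     A \<subseteq> S \<and> 0 \<in> A \<and> (\<forall>a\<in>A. \<forall>b\<in>A. a + b \<in> A) \<and> (\<forall>s\<in>S. \<forall>a\<in>A. s * a \<in> A)"

definition adjoin :: "'a::comm_ring_1 set \<Rightarrow> 'a set \<Rightarrow> 'a \<Rightarrow> 'a set" where
  "adjoin S A f = {a + f * s | a s. a \<in> A \<and> s \<in> S}"

definition colon :: "'a::comm_ring_1 set \<Rightarrow> 'a set \<Rightarrow> 'a \<Rightarrow> 'a set" where
  "colon S A f = {x \<in> S. f * x \<in> A}"

definition nonzerodivisor_mod :: "'a::comm_ring_1 set \<Rightarrow> 'a set \<Rightarrow> 'a \<Rightarrow> bool" where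
  "nonzerodivisor_mod S A f \<longleftrightarrow> (\<forall>x\<in>S. f * x \<in> A \<longrightarrow> x \<in> A)"

text \<open>Properness of the generated ideal is left out because colon ideals equal to the whole
  ring occur in the inductions. It is restored in
  \<open>regular_sequence_quot_module_iff\<close>.\<close>

fun weakly_regular :: "'a::comm_ring_1 set \<Rightarrow> 'a set \<Rightarrow> 'a list \<Rightarrow> bool" where
  "weakly_regular S A [] \<longleftrightarrow> True"
| "weakly_regular S A (f # fs) \<longleftrightarrow> nonzerodivisor_mod S A f \<and> weakly_regular S (adjoin S A f) fs"

lemma nonzerodivisor_modD: "nonzerodivisor_mod S A f \<Longrightarrow> f * x \<in> A \<Longrightarrow> x \<in> S \<Longrightarrow> x \<in> A"
  unfolding nonzerodivisor_mod_def by blast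

lemma weakly_regular_iff:
  "weakly_regular S A fs \<longleftrightarrow>
     (\<forall>i<length fs. nonzerodivisor_mod S (foldl (adjoin S) A (take i fs)) (fs ! i))"
proof (induction fs arbitrary: A)
  case (Cons f fs)
  show ?case
    unfolding weakly_regular.simps Cons.IH length_Cons All_less_Suc2 by simp
qed simp

text \<open>The value at \<open>gs\<close> of the monomial with exponent list \<open>es\<close>;
  polynomial relations between ring elements are linear combinations of such values.\<close>

definition power_prod :: "'a::comm_ring_1 list \<Rightarrow> nat list \<Rightarrow> 'a" where
  "power_prod gs es = prod_list (map2 (^) gs es)"

lemma power_prod_Nil [simp]: "power_prod [] es = 1"
  and power_prod_Cons [simp]: "power_prod (g # gs) (e # es) = g ^ e * power_prod gs es"
  by (simp_all add: power_prod_def)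

text \<open>A subset of a type-class ring instead of a ring record: the arithmetic of the type is
  then available without carrier conditions. \<open>ideal_mpoly_ring_iff\<close> leads back to the
  ideals of \<open>mpoly_ring V\<close>.\<close>

locale subring_carrier =
  fixes S :: "'a::comm_ring_1 set"
  assumes zero_closed [simp]: "0 \<in> S"
    and one_closed [simp]: "1 \<in> S"
    and add_closed [simp]: "x \<in> S \<Longrightarrow> y \<in> S \<Longrightarrow> x + y \<in> S"
    and uminus_closed [simp]: "x \<in> S \<Longrightarrow> - x \<in> S"
    and mult_closed [simp]: "x \<in> S \<Longrightarrow> y \<in> S \<Longrightarrow> x * y \<in> S"
begin

lemma diff_closed [simp]: "x \<in> S \<Longrightarrow> y \<in> S \<Longrightarrow> x - y \<in> S"
  using add_closed[of x "- y"] by simp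

lemma power_closed [simp]: "x \<in> S \<Longrightarrow> x ^ n \<in> S"
  by (induction n) simp_all

lemma sum_closed: "(\<And>i. i \<in> I \<Longrightarrow> f i \<in> S) \<Longrightarrow> sum f I \<in> S"
  by (induction I rule: infinite_finite_induct) simp_all

lemma prod_closed: "(\<And>i. i \<in> I \<Longrightarrow> f i \<in> S) \<Longrightarrow> prod f I \<in> S"
  by (induction I rule: infinite_finite_induct) simp_all

lemma power_prod_closed: "set gs \<subseteq> S \<Longrightarrow> power_prod gs es \<in> S"
proof (induction gs arbitrary: es)
  case (Cons g gs)
  then show ?case by (cases es) (simp_all add: power_prod_def)
qed simp

lemma ideal_in_subset: "ideal_in S A \<Longrightarrow> a \<in> A \<Longrightarrow> a \<in> S"
  and ideal_in_zero: "ideal_in S A \<Longrightarrow> 0 \<in> A"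
  and ideal_in_add: "ideal_in S A \<Longrightarrow> a \<in> A \<Longrightarrow> b \<in> A \<Longrightarrow> a + b \<in> A"
  and ideal_in_mult: "ideal_in S A \<Longrightarrow> s \<in> S \<Longrightarrow> a \<in> A \<Longrightarrow> s * a \<in> A"
  unfolding ideal_in_def by blast+

lemma ideal_in_uminus: "ideal_in S A \<Longrightarrow> a \<in> A \<Longrightarrow> - a \<in> A"
  using ideal_in_mult[of A "- 1" a] by simp

lemma ideal_in_diff: "ideal_in S A \<Longrightarrow> a \<in> A \<Longrightarrow> b \<in> A \<Longrightarrow> a - b \<in> A"
  using ideal_in_add[of A a "- b"] ideal_in_uminus[of A b] by simp

lemma ideal_in_mult_right: "ideal_in S A \<Longrightarrow> s \<in> S \<Longrightarrow> a \<in> A \<Longrightarrow> a * s \<in> A"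
  using ideal_in_mult[of A s a] by (simp add: mult.commute)

lemma ideal_in_sum: "ideal_in S A \<Longrightarrow> (\<And>i. i \<in> I \<Longrightarrow> f i \<in> A) \<Longrightarrow> sum f I \<in> A"
  by (induction I rule: infinite_finite_induct) (simp_all add: ideal_in_zero ideal_in_add)

lemma adjoinI: "a \<in> A \<Longrightarrow> s \<in> S \<Longrightarrow> a + f * s \<in> adjoin S A f"
  unfolding adjoin_def by blast

lemma adjoinE:
  assumes "x \<in> adjoin S A f"
  obtains a s where "x = a + f * s" "a \<in> A" "s \<in> S"
  using assms unfolding adjoin_def by blast

lemma subset_adjoin: "A \<subseteq> adjoin S A f"
  using adjoinI[of _ A 0 f] by fastforce

lemma multiple_in_adjoin: "ideal_in S A \<Longrightarrow> s \<in> S \<Longrightarrow> f * s \<in> adjoin S A f"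
  using adjoinI[of 0 A s f] ideal_in_zero by simp

lemma ideal_in_adjoin:
  assumes A: "ideal_in S A" and f: "f \<in> S"
  shows "ideal_in S (adjoin S A f)"
  unfolding ideal_in_def
proof (intro conjI ballI)
  show "adjoin S A f \<subseteq> S"
    using f ideal_in_subset[OF A] by (auto elim!: adjoinE)
  show "0 \<in> adjoin S A f"
    using subset_adjoin ideal_in_zero[OF A] by blast
next
  fix x y assume "x \<in> adjoin S A f" "y \<in> adjoin S A f"
  then obtain a s b t where "x = a + f * s" "y = b + f * t" "a \<in> A" "b \<in> A" "s \<in> S" "t \<in> S"
    by (metis adjoinE)
  then show "x + y \<in> adjoin S A f"
    using adjoinI[of "a + b" A "s + t" f] ideal_in_add[OF A] by (simp add: algebra_simps)
next
  fix r x assume "r \<in> S" "x \<in> adjoin S A f"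
  moreover from this obtain a s where "x = a + f * s" "a \<in> A" "s \<in> S"
    by (metis adjoinE)
  ultimately show "r * x \<in> adjoin S A f"
    using adjoinI[OF ideal_in_mult[OF A, of r a], of "r * s" f]
    by (simp add: distrib_left mult.left_commute)
qed

lemma adjoin_least:
  assumes "ideal_in S B" "A \<subseteq> B" "f \<in> B"
  shows "adjoin S A f \<subseteq> B"
  using assms by (auto elim!: adjoinE intro!: ideal_in_add[OF assms(1)] ideal_in_mult_right[OF assms(1)])

lemma generator_in_adjoin: "ideal_in S A \<Longrightarrow> f \<in> adjoin S A f"
  using multiple_in_adjoin[of A 1 f] by simp

text \<open>Serves to trade an elementary symmetric polynomial for the one monomial to which it
  reduces modulo a coordinate prime.\<close>

lemma adjoin_cong:
  assumes A: "ideal_in S A" and "f \<in> S" "g \<in> S" "f - g \<in> A"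
  shows "adjoin S A f = adjoin S A g"
proof -
  have "adjoin S A f \<subseteq> adjoin S A g" if "f \<in> S" "g \<in> S" "f - g \<in> A" for f g
  proof (rule adjoin_least[OF ideal_in_adjoin[OF A] subset_adjoin])
    show "f \<in> adjoin S A g"
      using adjoinI[OF that(3) one_closed, of g] by simp
  qed fact
  moreover have "g - f \<in> A"
    using ideal_in_uminus[OF A assms(4)] by simp
  ultimately show ?thesis using assms by blast
qed

lemma adjoin_commute: "adjoin S (adjoin S A f) g = adjoin S (adjoin S A g) f"
proof -
  have "adjoin S (adjoin S A f) g \<subseteq> adjoin S (adjoin S A g) f" for f g
  proof
    fix x assume "x \<in> adjoin S (adjoin S A f) g"
    then obtain a s t where "x = (a + f * s) + g * t" "a \<in> A" "s \<in> S" "t \<in> S"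
      by (metis adjoinE)
    then have "x = (a + g * t) + f * s" by simp
    with \<open>a \<in> A\<close> \<open>s \<in> S\<close> \<open>t \<in> S\<close> show "x \<in> adjoin S (adjoin S A g) f"
      by (metis adjoinI)
  qed
  then show ?thesis by blast
qed

lemma ideal_in_colon:
  assumes "ideal_in S A"
  shows "ideal_in S (colon S A f)"
  using assms unfolding ideal_in_def colon_def
  by (auto simp: algebra_simps mult.left_commute)

lemma foldl_adjoin_ideal:
  "ideal_in S A \<Longrightarrow> set fs \<subseteq> S \<Longrightarrow> ideal_in S (foldl (adjoin S) A fs)"
  by (induction fs arbitrary: A) (simp_all add: ideal_in_adjoin)

lemma subset_foldl_adjoin: "A \<subseteq> foldl (adjoin S) A fs"
proof (induction fs arbitrary: A)
  case (Cons f fs)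
  then show ?case using subset_adjoin[of A f] by force
qed simp

lemma foldl_adjoin_least:
  "ideal_in S B \<Longrightarrow> A \<subseteq> B \<Longrightarrow> set fs \<subseteq> B \<Longrightarrow> foldl (adjoin S) A fs \<subseteq> B"
  by (induction fs arbitrary: A) (simp_all add: adjoin_least)

lemma generators_in_foldl_adjoin:
  assumes "ideal_in S A" "set fs \<subseteq> S"
  shows "set fs \<subseteq> foldl (adjoin S) A fs"
  using assms
proof (induction fs arbitrary: A)
  case (Cons f fs)
  then have A': "ideal_in S (adjoin S A f)" by (simp add: ideal_in_adjoin)
  have "f \<in> foldl (adjoin S) (adjoin S A f) fs"
    using generator_in_adjoin[OF Cons.prems(1)] subset_foldl_adjoin by blast
  then show ?case using Cons.IH[OF A'] Cons.prems by simp
qed simp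

text \<open>This replaces the depth lemma for \<open>0 \<rightarrow> R/(A:f) \<rightarrow> R/A \<rightarrow> R/(A+(f)) \<rightarrow> 0\<close>; no homological
  algebra is needed because the same sequence is used on both ends.\<close>

lemma weakly_regular_extension:
  assumes "ideal_in S A" "f \<in> S" "set gs \<subseteq> S"
    and "weakly_regular S (adjoin S A f) gs" "weakly_regular S (colon S A f) gs"
  shows "weakly_regular S A gs"
  using assms
proof (induction gs arbitrary: A)
  case (Cons g gs)
  note A = Cons.prems(1) and f = Cons.prems(2)
  have g: "g \<in> S" using Cons.prems(3) by simp
  have B: "ideal_in S (adjoin S A f)" by (rule ideal_in_adjoin[OF A f])
  have gB: "nonzerodivisor_mod S (adjoin S A f) g" and gC: "nonzerodivisor_mod S (colon S A f) g"
    using Cons.prems(4,5) by simp_all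
  have "nonzerodivisor_mod S A g"
    unfolding nonzerodivisor_mod_def
  proof (intro ballI impI)
    fix x assume x: "x \<in> S" "g * x \<in> A"
    then have "x \<in> adjoin S A f"
      using gB subset_adjoin[of A f] unfolding nonzerodivisor_mod_def by blast
    then obtain a y where y: "x = a + f * y" "a \<in> A" "y \<in> S" by (rule adjoinE)
    have "f * (g * y) = g * x - g * a" unfolding y(1) by (simp add: algebra_simps)
    also have "\<dots> \<in> A"
      by (rule ideal_in_diff[OF A x(2) ideal_in_mult[OF A g y(2)]])
    finally have "g * y \<in> colon S A f" using y g by (simp add: colon_def)
    then have "y \<in> colon S A f" using gC y unfolding nonzerodivisor_mod_def by blast
    then show "x \<in> A" using y by (auto simp: colon_def intro: ideal_in_add[OF A])
  qed
  moreover have "weakly_regular S (adjoin S A g) gs"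
  proof (rule Cons.IH)
    \<comment> \<open>Taking the colon by \<open>f\<close> commutes with adjoining \<open>g\<close>.
      In \<open>f * y = a + g * z\<close>, regularity of \<open>g\<close> modulo
      \<open>A + (f)\<close> makes \<open>z\<close> a multiple of \<open>f\<close> modulo
      \<open>A\<close>, so \<open>f\<close> can be factored out.\<close>
    have "colon S (adjoin S A g) f \<subseteq> adjoin S (colon S A f) g"
    proof
      fix y assume "y \<in> colon S (adjoin S A g) f"
      then have y: "y \<in> S" "f * y \<in> adjoin S A g" by (simp_all add: colon_def)
      from y(2) obtain a z where z: "f * y = a + g * z" "a \<in> A" "z \<in> S" by (rule adjoinE)
      have "g * z = - a + f * y" using z(1) by simp
      also have "\<dots> \<in> adjoin S A f" using z y by (intro adjoinI ideal_in_uminus[OF A])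
      finally have "z \<in> adjoin S A f" using gB z unfolding nonzerodivisor_mod_def by blast
      then obtain a' z' where z': "z = a' + f * z'" "a' \<in> A" "z' \<in> S" by (rule adjoinE)
      have "f * (y - g * z') = a + g * a'"
        using z(1) unfolding z'(1) by (simp add: algebra_simps)
      also have "\<dots> \<in> A" using z z' g by (intro ideal_in_add[OF A] ideal_in_mult[OF A])
      finally have "y - g * z' \<in> colon S A f" using y z' g by (simp add: colon_def)
      from adjoinI[OF this z'(3), of g] show "y \<in> adjoin S (colon S A f) g" by simp
    qed
    moreover have "adjoin S (colon S A f) g \<subseteq> colon S (adjoin S A g) f"
    proof (rule adjoin_least[OF ideal_in_colon[OF ideal_in_adjoin[OF A g]]])
      show "colon S A f \<subseteq> colon S (adjoin S A g) f"
        using subset_adjoin[of A g] by (auto simp: colon_def)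
      show "g \<in> colon S (adjoin S A g) f"
        using multiple_in_adjoin[OF A f, of g] g by (simp add: colon_def mult.commute)
    qed
    ultimately have "colon S (adjoin S A g) f = adjoin S (colon S A f) g" by blast
    then show "weakly_regular S (colon S (adjoin S A g) f) gs"
      using Cons.prems(5) by simp
    show "weakly_regular S (adjoin S (adjoin S A g) f) gs"
      using Cons.prems(4) by (simp add: adjoin_commute)
  qed (use Cons.prems A g f in \<open>simp_all add: ideal_in_adjoin\<close>)
  ultimately show ?case by simp
qed simp

section \<open>Powers of weakly regular sequences\<close>

lemma nonzerodivisor_mod_power:
  assumes "nonzerodivisor_mod S A f" "f \<in> S"
  shows "nonzerodivisor_mod S A (f ^ n)"
proof (induction n)
  case (Suc n)
  show ?case
    unfolding nonzerodivisor_mod_def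
  proof (intro ballI impI)
    fix x assume x: "x \<in> S" "f ^ Suc n * x \<in> A"
    then have "f * (f ^ n * x) \<in> A" by (simp add: mult.assoc)
    then have "f ^ n * x \<in> A"
      by (rule nonzerodivisor_modD[OF assms(1)]) (simp add: x(1) assms(2))
    with x(1) show "x \<in> A" by (rule nonzerodivisor_modD[OF Suc, rotated])
  qed
qed (simp add: nonzerodivisor_mod_def)

text \<open>Induction on the exponent through \<open>weakly_regular_extension\<close>, applied to
  the ideal with the next power of \<open>f\<close> adjoined: adjoining \<open>f\<close> collapses
  it to \<open>adjoin S A f\<close>, while the colon by \<open>f\<close> lowers the exponent by one,
  since \<open>f\<close> is a nonzerodivisor modulo \<open>A\<close>.\<close>

lemma weakly_regular_adjoin_power:
  assumes "ideal_in S A" "f \<in> S" "set gs \<subseteq> S"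
    and "nonzerodivisor_mod S A f" "weakly_regular S (adjoin S A f) gs"
  shows "weakly_regular S (adjoin S A (f ^ Suc n)) gs"
proof (induction n)
  case (Suc n)
  note A = assms(1) and f = assms(2)
  let ?p = "f ^ Suc n"
  have B: "ideal_in S (adjoin S A (f * ?p))" using A f by (simp add: ideal_in_adjoin)
  have 1: "adjoin S (adjoin S A (f * ?p)) f = adjoin S A f"
  proof
    show "adjoin S (adjoin S A (f * ?p)) f \<subseteq> adjoin S A f"
      using A f multiple_in_adjoin[OF A, of ?p f]
      by (intro adjoin_least ideal_in_adjoin subset_adjoin generator_in_adjoin) simp_all
    show "adjoin S A f \<subseteq> adjoin S (adjoin S A (f * ?p)) f"
      using subset_adjoin[of A "f * ?p"] by (force simp: adjoin_def)
  qed
  have 2: "colon S (adjoin S A (f * ?p)) f = adjoin S A ?p"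
  proof
    show "adjoin S A ?p \<subseteq> colon S (adjoin S A (f * ?p)) f"
    proof (rule adjoin_least[OF ideal_in_colon[OF B]])
      show "A \<subseteq> colon S (adjoin S A (f * ?p)) f"
        using subset_adjoin[of A "f * ?p"] ideal_in_mult[OF A f] ideal_in_subset[OF A]
        by (auto simp: colon_def)
      show "?p \<in> colon S (adjoin S A (f * ?p)) f"
        using generator_in_adjoin[OF A, of "f * ?p"] f by (simp add: colon_def)
    qed
    show "colon S (adjoin S A (f * ?p)) f \<subseteq> adjoin S A ?p"
    proof
      fix x assume "x \<in> colon S (adjoin S A (f * ?p)) f"
      then have x: "x \<in> S" "f * x \<in> adjoin S A (f * ?p)" by (simp_all add: colon_def)
      from x(2) obtain a s where s: "f * x = a + f * ?p * s" "a \<in> A" "s \<in> S" by (rule adjoinE)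
      have "f * (x - ?p * s) = a" using s(1) by (simp add: algebra_simps)
      with s(2) have "f * (x - ?p * s) \<in> A" by (simp only:)
      then have "x - ?p * s \<in> A"
        by (rule nonzerodivisor_modD[OF assms(4)]) (simp add: x(1) s(3) f)
      from adjoinI[OF this s(3), of ?p] show "x \<in> adjoin S A ?p" by simp
    qed
  qed
  show ?case
    using weakly_regular_extension[OF B f assms(3)] Suc assms(5) unfolding 1 2
    by (simp only: power_Suc)
qed (use assms in simp)

text \<open>High powers push the generators into high degree without changing the length; the degree
  contradiction in the bound on depth rests on this.\<close>

lemma weakly_regular_powers:
  assumes "ideal_in S A" "set fs \<subseteq> S" "weakly_regular S A fs"
  shows "weakly_regular S A (map (\<lambda>f. f ^ Suc n) fs)"
  using assms
proof (induction fs arbitrary: A)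
  case (Cons f fs)
  have f: "f \<in> S" and fs: "set fs \<subseteq> S" using Cons.prems by simp_all
  have "weakly_regular S (adjoin S A (f ^ Suc n)) fs"
    by (rule weakly_regular_adjoin_power) (use Cons.prems in simp_all)
  moreover have "ideal_in S (adjoin S A (f ^ Suc n))"
    using Cons.prems(1) f by (simp add: ideal_in_adjoin)
  ultimately have "weakly_regular S (adjoin S A (f ^ Suc n)) (map (\<lambda>f. f ^ Suc n) fs)"
    using Cons.IH fs by blast
  moreover have "nonzerodivisor_mod S A (f ^ Suc n)"
    using Cons.prems f by (intro nonzerodivisor_mod_power) simp_all
  ultimately show ?case by simp
qed simp

text \<open>The lexicographically smallest monomial of the relation is peeled off: cancel the power of
  the first generator common to all terms, then pass from \<open>A 0\<close> to \<open>A 1\<close>, which kills every term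
  still divisible by that generator.\<close>

lemma relation_imp_one_in_last:
  assumes "finite X" "\<And>e. e \<in> X \<Longrightarrow> length e = length gs"
    and "\<exists>e\<in>X. c e \<noteq> 0"
    and "\<And>e. e \<in> X \<Longrightarrow> c e \<noteq> 0 \<Longrightarrow> c e \<in> S \<and> (\<exists>d\<in>S. d * c e = 1)"
    and "set gs \<subseteq> S"
    and "\<And>i. i \<le> length gs \<Longrightarrow> ideal_in S (A i)"
    and "\<And>i. i < length gs \<Longrightarrow> A i \<subseteq> A (Suc i)"
    and "\<And>i. i < length gs \<Longrightarrow> nonzerodivisor_mod S (A i) (gs ! i)"
    and "\<And>i s. i < length gs \<Longrightarrow> s \<in> S \<Longrightarrow> gs ! i * s \<in> A (Suc i)"
    and "(\<Sum>e\<in>X. c e * power_prod gs e) \<in> A 0"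
  shows "1 \<in> A (length gs)"
  using assms
proof (induction gs arbitrary: X c A)
  case Nil
  have X: "X = {[]}" using Nil.prems(2,3) by auto
  then have "c [] \<in> A 0" using Nil.prems(10) by simp
  moreover obtain d where "d \<in> S" "d * c [] = 1"
    using Nil.prems(3,4) X by auto
  ultimately show ?case
    using ideal_in_mult[of "A 0" d "c []"] Nil.prems(6)[of 0] by simp
next
  case (Cons g gs)
  have g: "g \<in> S" and gs: "set gs \<subseteq> S" using Cons.prems(5) by simp_all
  define Y where "Y = {e \<in> X. c e \<noteq> 0}"
  have finY: "finite Y" and neY: "Y \<noteq> {}" using Cons.prems(1,3) by (auto simp: Y_def)
  define m where "m = Min (hd ` Y)"
  have m_le: "m \<le> hd e" if "e \<in> Y" for e using finY that by (simp add: m_def)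
  have m_in: "m \<in> hd ` Y" unfolding m_def using finY neY by (intro Min_in) simp_all
  define Z where "Z = {e \<in> Y. hd e = m}"
  have Z_sub: "Z \<subseteq> Y" by (auto simp: Z_def)
  have cons: "e = hd e # tl e" "length (tl e) = length gs" if "e \<in> Y" for e
    using Cons.prems(2)[of e] that by (cases e; simp add: Y_def)+
  \<comment> \<open>After \<open>g ^ m\<close> is cancelled, the terms outside \<open>Z\<close>
    still contain \<open>g\<close>: their exponent exceeds \<open>m\<close>, so the subtraction
    \<open>hd e - Suc m\<close> is not truncated.\<close>
  define r where "r = (\<Sum>e\<in>Y - Z. c e * (g ^ (hd e - Suc m) * power_prod gs (tl e)))"
  define t where "t = (\<Sum>e\<in>Z. c e * power_prod gs (tl e))"
  have cS: "c e \<in> S" if "e \<in> Y" for e using that Cons.prems(4) by (simp add: Y_def)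
  have r: "r \<in> S"
    unfolding r_def using g cS power_prod_closed[OF gs] by (intro sum_closed) simp
  have t: "t \<in> S"
    unfolding t_def using g cS Z_sub power_prod_closed[OF gs] by (intro sum_closed) auto
  have term_eq: "c e * power_prod (g # gs) e = c e * (g ^ hd e * power_prod gs (tl e))"
    if "e \<in> Y" for e using cons(1)[OF that] by (metis power_prod_Cons)
  have "(\<Sum>e\<in>X. c e * power_prod (g # gs) e) = (\<Sum>e\<in>Y. c e * power_prod (g # gs) e)"
    using Cons.prems(1) by (intro sum.mono_neutral_right) (auto simp: Y_def)
  also have "\<dots> = (\<Sum>e\<in>Y - Z. c e * power_prod (g # gs) e) + (\<Sum>e\<in>Z. c e * power_prod (g # gs) e)"
    by (rule sum.subset_diff[OF Z_sub finY])
  also have "(\<Sum>e\<in>Z. c e * power_prod (g # gs) e) = g ^ m * t"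
    unfolding t_def sum_distrib_left using Z_sub
    by (intro sum.cong refl) (auto simp: term_eq Z_def subset_iff)
  also have "(\<Sum>e\<in>Y - Z. c e * power_prod (g # gs) e) = g ^ m * (g * r)"
    unfolding r_def sum_distrib_left
  proof (intro sum.cong refl)
    fix e assume e: "e \<in> Y - Z"
    then have "hd e = m + Suc (hd e - Suc m)" using m_le[of e] by (force simp: Z_def)
    then have "g ^ hd e = g ^ m * (g * g ^ (hd e - Suc m))"
      by (metis power_add power_Suc)
    then show "c e * power_prod (g # gs) e =
        g ^ m * (g * (c e * (g ^ (hd e - Suc m) * power_prod gs (tl e))))"
      using term_eq[of e] e by (simp add: mult_ac)
  qed
  finally have "g ^ m * (g * r + t) \<in> A 0"
    using Cons.prems(10) by (simp add: distrib_left)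
  moreover have "nonzerodivisor_mod S (A 0) (g ^ m)"
    using Cons.prems(8)[of 0] g by (intro nonzerodivisor_mod_power) simp_all
  ultimately have "g * r + t \<in> A 0"
    by (metis nonzerodivisor_modD add_closed mult_closed g r t)
  then have "g * r + t \<in> A 1" using Cons.prems(7)[of 0] by auto
  moreover have "g * r \<in> A 1" using Cons.prems(9)[of 0] r by simp
  moreover have A1: "ideal_in S (A 1)" using Cons.prems(6)[of 1] by simp
  ultimately have t1: "t \<in> A 1"
    using ideal_in_diff[OF A1, of "g * r + t" "g * r"] by simp
  have inj: "inj_on tl Z"
    using cons(1) Z_sub by (intro inj_onI) (metis (mono_tags) Z_def mem_Collect_eq subsetD)
  have cZ: "c (m # tl e) = c e" if "e \<in> Z" for e
    using that cons(1)[of e] by (auto simp: Z_def)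
  \<comment> \<open>On \<open>Z\<close> the head is constantly \<open>m\<close>, so
    \<open>tl\<close> forgets nothing. The shorter relation has coefficients
    \<open>c (m # e)\<close> and lives over the chain shifted by one.\<close>
  have "1 \<in> (\<lambda>i. A (Suc i)) (length gs)"
  proof (rule Cons.IH)
    show "finite (tl ` Z)" using finY Z_sub finite_subset by blast
    show "length e = length gs" if "e \<in> tl ` Z" for e using that cons(2) Z_sub by auto
    show "\<exists>e\<in>tl ` Z. c (m # e) \<noteq> 0"
      using m_in cZ by (auto simp: Z_def Y_def)
    show "c (m # e) \<in> S \<and> (\<exists>d\<in>S. d * c (m # e) = 1)"
      if "e \<in> tl ` Z" "c (m # e) \<noteq> 0" for e
      using that cZ Cons.prems(4) Z_sub by (auto simp: Y_def)
    show "(\<Sum>e\<in>tl ` Z. c (m # e) * power_prod gs e) \<in> A (Suc 0)"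
      using t1 unfolding t_def sum.reindex[OF inj] by (simp add: cZ)
    show "ideal_in S (A (Suc i))" if "i \<le> length gs" for i using Cons.prems(6)[of "Suc i"] that by simp
    show "A (Suc i) \<subseteq> A (Suc (Suc i))" if "i < length gs" for i
      using Cons.prems(7)[of "Suc i"] that by simp
    show "nonzerodivisor_mod S (A (Suc i)) (gs ! i)" if "i < length gs" for i
      using Cons.prems(8)[of "Suc i"] that by simp
    show "gs ! i * s \<in> A (Suc (Suc i))" if "i < length gs" "s \<in> S" for i s
      using Cons.prems(9)[of "Suc i" s] that by simp
  qed fact
  then show ?case by simp
qed

end

text \<open>Gaussian elimination, one equation at a time: a pivot \<open>f\<close> clears the
  equation \<open>m\<close> from the other unknowns, and its own coefficient \<open>- s\<close> is
  recovered from theirs at the end.\<close>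

lemma homogeneous_system_solution:
  fixes a :: "'e \<Rightarrow> 'm \<Rightarrow> 'k::field"
  assumes "finite M" "finite E" "card M < card E"
  shows "\<exists>c. (\<exists>e\<in>E. c e \<noteq> 0) \<and> (\<forall>m\<in>M. (\<Sum>e\<in>E. c e * a e m) = 0)"
  using assms
proof (induction M arbitrary: E a rule: finite_induct)
  case empty
  then have "E \<noteq> {}" by auto
  then show ?case by (intro exI[of _ "\<lambda>_. 1"]) auto
next
  case (insert m M)
  show ?case
  proof (cases "\<forall>e\<in>E. a e m = 0")
    case True
    obtain c where "\<exists>e\<in>E. c e \<noteq> 0" "\<forall>m\<in>M. (\<Sum>e\<in>E. c e * a e m) = 0"
      using insert.IH[OF insert.prems(1), of a] insert.hyps insert.prems(2) by auto
    with True show ?thesis by (intro exI[of _ c]) auto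
  next
    case False
    then obtain f where f: "f \<in> E" "a f m \<noteq> 0" by blast
    define b where "b e n = a e n - a e m / a f m * a f n" for e n
    have "card M < card (E - {f})"
      using insert.hyps insert.prems f(1) by simp
    then obtain c where c: "\<exists>e\<in>E - {f}. c e \<noteq> 0" "\<forall>n\<in>M. (\<Sum>e\<in>E - {f}. c e * b e n) = 0"
      using insert.IH[of "E - {f}" b] insert.prems(1) by auto
    define s where "s = (\<Sum>e\<in>E - {f}. c e * (a e m / a f m))"
    define c' where "c' = c(f := - s)"
    have eq: "(\<Sum>e\<in>E. c' e * a e n) = (\<Sum>e\<in>E - {f}. c e * b e n)" for n
    proof -
      have "(\<Sum>e\<in>E. c' e * a e n) = c' f * a f n + (\<Sum>e\<in>E - {f}. c' e * a e n)"
        by (rule sum.remove[OF insert.prems(1) f(1)])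
      also have "(\<Sum>e\<in>E - {f}. c' e * a e n) = (\<Sum>e\<in>E - {f}. c e * a e n)"
        by (intro sum.cong) (simp_all add: c'_def)
      also have "c' f * a f n + \<dots> = (\<Sum>e\<in>E - {f}. c e * b e n)"
        by (simp add: c'_def s_def b_def sum_distrib_right sum_subtractf right_diff_distrib mult.assoc)
      finally show ?thesis .
    qed
    have "(\<Sum>e\<in>E. c' e * a e n) = 0" if "n \<in> insert m M" for n
      using that c(2) f(2) unfolding eq by (auto simp: b_def)
    moreover have "\<exists>e\<in>E. c' e \<noteq> 0" using c(1) by (auto simp: c'_def)
    ultimately show ?thesis by blast
  qed
qed


section \<open>Monomial ideals and elementary symmetric polynomials\<close>

abbreviation keys :: "('a \<Rightarrow>\<^sub>0 'b::zero) \<Rightarrow> 'a set" where "keys \<equiv> Poly_Mapping.keys"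
abbreviation lookup :: "('a \<Rightarrow>\<^sub>0 'b::zero) \<Rightarrow> 'a \<Rightarrow> 'b" where "lookup \<equiv> Poly_Mapping.lookup"
abbreviation single :: "'a \<Rightarrow> 'b::zero \<Rightarrow> 'a \<Rightarrow>\<^sub>0 'b" where "single \<equiv> Poly_Mapping.single"

abbreviation polys :: "'v set \<Rightarrow> ('v, 'k::field) mpoly set" where
  "polys V \<equiv> carrier (mpoly_ring V)"

lemma mem_polys: "p \<in> polys V \<longleftrightarrow> (\<forall>m\<in>keys p. keys m \<subseteq> V)"
  by (simp add: mpoly_ring_simps)

section \<open>Ring structure of the polynomial ring in terms of type-class arithmetic\<close>

lemma a_inv_mpoly_ring:
  fixes p :: "('v, 'k::field) mpoly"
  assumes "p \<in> polys V"
  shows "\<ominus>\<^bsub>mpoly_ring V\<^esub> p = - p"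
proof -
  interpret R: cring "mpoly_ring V :: ('v, 'k) mpoly ring" by (rule cring_mpoly_ring)
  have "- p \<in> polys V" using assms by (simp add: mem_polys in_keys_iff)
  then show ?thesis
    using assms by (intro R.minus_equality) (simp_all add: mpoly_ring_simps(2-))
qed

lemma minus_mpoly_ring:
  "q \<in> polys V \<Longrightarrow> p \<ominus>\<^bsub>mpoly_ring V\<^esub> q = p - q"
  by (simp add: a_minus_def a_inv_mpoly_ring mpoly_ring_simps(3))

global_interpretation polys: subring_carrier "polys V" for V :: "'v set"
proof
  fix x y :: "('v, 'k::field) mpoly" and V :: "'v set"
  interpret R: cring "mpoly_ring V :: ('v, 'k) mpoly ring" by (rule cring_mpoly_ring)
  show "0 \<in> polys V" "1 \<in> polys V"
    by (simp_all add: mem_polys)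
  assume x: "x \<in> polys V"
  then show "- x \<in> polys V" by (simp add: mem_polys in_keys_iff)
  assume "y \<in> polys V"
  with x show "x + y \<in> polys V" "x * y \<in> polys V"
    using R.a_closed R.m_closed by (simp_all only: mpoly_ring_simps(2,3))
qed

lemma ideal_mpoly_ring_iff:
  "ideal A (mpoly_ring V :: ('v, 'k::field) mpoly ring) \<longleftrightarrow> ideal_in (polys V) A"
proof
  interpret R: cring "mpoly_ring V :: ('v, 'k) mpoly ring" by (rule cring_mpoly_ring)
  {
    assume "ideal A (mpoly_ring V)"
    then interpret ideal A "mpoly_ring V" .
    show "ideal_in (polys V) A"
      unfolding ideal_in_def using a_subset zero_closed a_closed I_l_closed
      by (auto simp: mpoly_ring_simps(2-))
  next
    assume A: "ideal_in (polys V) A"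
    show "ideal A (mpoly_ring V)"
    proof (rule idealI)
      show "subgroup A (add_monoid (mpoly_ring V))"
      proof (rule group.subgroupI[OF R.a_group])
        show "inv\<^bsub>add_monoid (mpoly_ring V)\<^esub> a \<in> A" if "a \<in> A" for a
          using polys.ideal_in_uminus[OF A that] a_inv_mpoly_ring[OF polys.ideal_in_subset[OF A that]]
          by (simp add: a_inv_def)
      qed (use A in \<open>auto simp: ideal_in_def mpoly_ring_simps(2-)\<close>)
    qed (use A in \<open>auto simp: mpoly_ring_simps(2-) R.ring_axioms polys.ideal_in_mult polys.ideal_in_mult_right\<close>)
  }
qed

lemma primeideal_mpoly_ring_iff:
  "primeideal P (mpoly_ring V :: ('v, 'k::field) mpoly ring) \<longleftrightarrow>
     ideal_in (polys V) P \<and> 1 \<notin> P \<and>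
     (\<forall>a\<in>polys V. \<forall>b\<in>polys V. a * b \<in> P \<longrightarrow> a \<in> P \<or> b \<in> P)" (is "?L \<longleftrightarrow> ?R")
proof
  assume ?L
  then interpret primeideal P "mpoly_ring V :: ('v, 'k) mpoly ring" .
  have "ideal P (mpoly_ring V)" ..
  moreover have "1 \<notin> P"
    using I_notcarr one_imp_carrier by (auto simp: mpoly_ring_simps(2-))
  ultimately show ?R
    using I_prime by (auto simp: ideal_mpoly_ring_iff mpoly_ring_simps(2-))
next
  assume R: ?R
  show ?L
  proof (rule primeidealI)
    show "polys V \<noteq> P" using R polys.one_closed by blast
  qed (use R in \<open>auto simp: ideal_mpoly_ring_iff cring_mpoly_ring mpoly_ring_simps(2-)\<close>)
qed

lemma lookup_single_times:
  fixes p :: "('v, 'k::field) mpoly"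
  shows "lookup (single a c * p) (a + m) = c * lookup p m"
proof -
  have "lookup (single a c * p) (a + m) =
      (\<Sum>l. lookup (single a c) l * (\<Sum>q. lookup p q when a + m = l + q))"
    by (rule lookup_mult)
  also have "\<dots> = (\<Sum>l. c * (\<Sum>q. lookup p q when a + m = l + q) when l = a)"
    by (rule Sum_any.cong) (auto simp: lookup_single when_def)
  also have "\<dots> = c * lookup p m" by simp
  finally show ?thesis .
qed

lemma keys_nat_add: "keys (a + b :: 'v \<Rightarrow>\<^sub>0 nat) = keys a \<union> keys b"
  by (auto simp: in_keys_iff lookup_add)

lemma sum_single_keys: "(\<Sum>m\<in>keys p. single m (lookup p m)) = (p :: ('v, 'k::field) mpoly)"
  by (rule poly_mapping_eqI)
    (simp add: lookup_sum lookup_single when_def in_keys_iff)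

section \<open>Squarefree monomials and monomial ideals\<close>

definition sqfree :: "'v set \<Rightarrow> 'v \<Rightarrow>\<^sub>0 nat" where
  "sqfree T = (\<Sum>v\<in>T. single v 1)"

definition mon :: "'v set \<Rightarrow> ('v, 'k::field) mpoly" where
  "mon T = single (sqfree T) 1"

lemma lookup_sqfree: "finite T \<Longrightarrow> lookup (sqfree T) v = (1 when v \<in> T)"
  by (simp add: sqfree_def lookup_sum lookup_single when_def)

lemma keys_sqfree [simp]: "finite T \<Longrightarrow> keys (sqfree T) = T"
  by (auto simp: in_keys_iff lookup_sqfree when_def split: if_splits)

lemma keys_mon [simp]: "keys (mon T :: ('v, 'k::field) mpoly) = {sqfree T}"
  by (simp add: mon_def)

lemma mvar_eq_mon: "mvar v = mon {v}"
  by (simp add: mvar_def mon_def sqfree_def)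

lemma mon_Un: "finite T \<Longrightarrow> finite U \<Longrightarrow> T \<inter> U = {} \<Longrightarrow> mon T * mon U = mon (T \<union> U)"
  by (simp add: mon_def mult_single sqfree_def sum.union_disjoint)

lemma mon_in_polys: "finite T \<Longrightarrow> T \<subseteq> V \<Longrightarrow> mon T \<in> polys V"
  by (simp add: mem_polys)

lemma single_in_polys: "keys m \<subseteq> V \<Longrightarrow> single m c \<in> polys V"
  by (simp add: mem_polys)

lemma sqfree_dvd:
  assumes "finite T" "T \<subseteq> keys m"
  obtains m' where "m = sqfree T + m'" "keys m' \<subseteq> keys m"
proof
  show "m = sqfree T + (m - sqfree T)"
    using assms by (intro poly_mapping_eqI)
      (auto simp: lookup_add lookup_minus lookup_sqfree when_def in_keys_iff subset_iff)
  then show "keys (m - sqfree T) \<subseteq> keys m"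
    by (metis keys_nat_add Un_upper2)
qed

text \<open>An ideal as soon as \<open>Q\<close> is stable under multiplication of monomials.
  Describing the ideal by a predicate on exponents instead of generators turns sums, colons and
  intersections into logical operations on \<open>Q\<close>.\<close>

definition monomial_ideal :: "'v set \<Rightarrow> (('v \<Rightarrow>\<^sub>0 nat) \<Rightarrow> bool) \<Rightarrow> ('v, 'k::field) mpoly set" where
  "monomial_ideal V Q = {p \<in> polys V. \<forall>m\<in>keys p. Q m}"

text \<open>The Stanley--Reisner ideal of \<open>\<Delta>\<close>.\<close>

abbreviation SR :: "'v set \<Rightarrow> 'v set set \<Rightarrow> ('v, 'k::field) mpoly set" where
  "SR V \<Delta> \<equiv> monomial_ideal V (\<lambda>m. keys m \<notin> \<Delta>)"

definition subset_closed :: "'v set set \<Rightarrow> bool" where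
  "subset_closed \<Delta> \<longleftrightarrow> (\<forall>Y\<in>\<Delta>. \<forall>X\<subseteq>Y. X \<in> \<Delta>)"

lemma ideal_in_monomial_ideal:
  assumes "\<And>m m'. Q m \<Longrightarrow> Q (m' + m)"
  shows "ideal_in (polys V) (monomial_ideal V Q :: ('v, 'k::field) mpoly set)"
  unfolding ideal_in_def
proof (intro conjI ballI)
  fix a b :: "('v, 'k) mpoly" assume "a \<in> monomial_ideal V Q" "b \<in> monomial_ideal V Q"
  then show "a + b \<in> monomial_ideal V Q"
    using Poly_Mapping.keys_add[of a b] by (auto simp: monomial_ideal_def)
next
  fix s a :: "('v, 'k) mpoly" assume "s \<in> polys V" "a \<in> monomial_ideal V Q"
  then show "s * a \<in> monomial_ideal V Q"
    using keys_mult[of s a] assms by (fastforce simp: monomial_ideal_def)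
qed (auto simp: monomial_ideal_def)

lemma ideal_in_SR: "subset_closed \<Delta> \<Longrightarrow> ideal_in (polys V) (SR V \<Delta>)"
  by (rule ideal_in_monomial_ideal) (auto simp: subset_closed_def keys_nat_add)

lemma monomial_ideal_subsetI:
  fixes A :: "('v, 'k::field) mpoly set"
  assumes A: "ideal_in (polys V) A"
    and "\<And>m. keys m \<subseteq> V \<Longrightarrow> Q m \<Longrightarrow> single m 1 \<in> A"
  shows "monomial_ideal V Q \<subseteq> A"
proof
  fix p :: "('v, 'k) mpoly" assume p: "p \<in> monomial_ideal V Q"
  have "(\<Sum>m\<in>keys p. single m (lookup p m)) \<in> A"
  proof (rule polys.ideal_in_sum[OF A])
    fix m assume "m \<in> keys p"
    with p have "single m 1 \<in> A" by (intro assms(2)) (auto simp: monomial_ideal_def mem_polys)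
    then have "single 0 (lookup p m) * single m 1 \<in> A"
      by (intro polys.ideal_in_mult[OF A] single_in_polys) simp_all
    then show "single m (lookup p m) \<in> A" by (simp add: mult_single)
  qed
  then show "p \<in> A" by (simp only: sum_single_keys)
qed

lemma single_sqfree_add: "single (sqfree T + m) 1 = mon T * single m 1"
  by (simp add: mon_def mult_single)

lemma mon_in_monomial_ideal:
  "finite T \<Longrightarrow> T \<subseteq> V \<Longrightarrow> Q (sqfree T) \<Longrightarrow> mon T \<in> monomial_ideal V Q"
  by (simp add: monomial_ideal_def mon_in_polys)

lemma genideal_mon:
  assumes "\<And>T. T \<in> F \<Longrightarrow> finite T \<and> T \<subseteq> V"
  shows "genideal (mpoly_ring V) (mon ` F) =
    (monomial_ideal V (\<lambda>m. \<exists>T\<in>F. T \<subseteq> keys m) :: ('v, 'k::field) mpoly set)" (is "?G = ?M")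
proof
  interpret R: cring "mpoly_ring V :: ('v, 'k) mpoly ring" by (rule cring_mpoly_ring)
  have M: "ideal_in (polys V) ?M"
    by (rule ideal_in_monomial_ideal) (auto simp: keys_nat_add)
  have sub: "mon ` F \<subseteq> polys V" using assms by (auto intro: mon_in_polys)
  show "?G \<subseteq> ?M"
    using assms by (intro R.genideal_minimal)
      (auto simp: ideal_mpoly_ring_iff M intro!: mon_in_monomial_ideal)
  have G: "ideal_in (polys V) ?G"
    using R.genideal_ideal[OF sub] by (simp add: ideal_mpoly_ring_iff)
  show "?M \<subseteq> ?G"
  proof (rule monomial_ideal_subsetI[OF G])
    fix m :: "'v \<Rightarrow>\<^sub>0 nat" assume m: "keys m \<subseteq> V" "\<exists>T\<in>F. T \<subseteq> keys m"
    then obtain T where T: "T \<in> F" "T \<subseteq> keys m" by blast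
    then obtain m' where m': "m = sqfree T + m'" "keys m' \<subseteq> keys m"
      using sqfree_dvd assms by metis
    have "mon T \<in> ?G" using R.genideal_self[OF sub] T by blast
    then have "mon T * single m' 1 \<in> ?G"
      using m m' by (intro polys.ideal_in_mult_right[OF G] single_in_polys) auto
    then show "single m 1 \<in> ?G" using m' by (simp add: single_sqfree_add)
  qed
qed

lemma adjoin_monomial_ideal:
  assumes "\<And>m m'. Q m \<Longrightarrow> Q (m' + m)" "finite T" "T \<subseteq> V"
  shows "adjoin (polys V) (monomial_ideal V Q) (mon T) =
    (monomial_ideal V (\<lambda>m. Q m \<or> T \<subseteq> keys m) :: ('v, 'k::field) mpoly set)" (is "?L = ?M")
proof
  have Q: "ideal_in (polys V) (monomial_ideal V Q :: ('v, 'k) mpoly set)"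
    by (rule ideal_in_monomial_ideal) (rule assms(1))
  have M: "ideal_in (polys V) ?M"
    by (rule ideal_in_monomial_ideal) (auto simp: keys_nat_add assms(1))
  show "?L \<subseteq> ?M"
  proof (rule polys.adjoin_least[OF M])
    show "mon T \<in> ?M" using assms by (intro mon_in_monomial_ideal) simp_all
  qed (auto simp: monomial_ideal_def)
  have L: "ideal_in (polys V) ?L"
    using Q assms by (intro polys.ideal_in_adjoin mon_in_polys)
  show "?M \<subseteq> ?L"
  proof (rule monomial_ideal_subsetI[OF L])
    fix m :: "'v \<Rightarrow>\<^sub>0 nat" assume m: "keys m \<subseteq> V" "Q m \<or> T \<subseteq> keys m"
    show "single m 1 \<in> ?L"
    proof (cases "Q m")
      case True
      then have "single m 1 \<in> (monomial_ideal V Q :: ('v, 'k) mpoly set)"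
        using m by (simp add: monomial_ideal_def single_in_polys)
      then show ?thesis using polys.subset_adjoin by blast
    next
      case False
      then obtain m' where m': "m = sqfree T + m'" "keys m' \<subseteq> keys m"
        using sqfree_dvd[OF assms(2)] m by metis
      have "mon T * single m' 1 \<in> ?L"
        using m m' by (intro polys.multiple_in_adjoin[OF Q] single_in_polys) auto
      then show ?thesis using m' by (simp add: single_sqfree_add)
    qed
  qed
qed

text \<open>The faces containing \<open>T\<close> disappear; for a single vertex this is its
  deletion from the complex.\<close>

lemma adjoin_SR:
  assumes "subset_closed \<Delta>" "finite T" "T \<subseteq> V"
  shows "adjoin (polys V) (SR V \<Delta>) (mon T) = SR V {Y \<in> \<Delta>. \<not> T \<subseteq> Y}"
proof -
  have "adjoin (polys V) (SR V \<Delta>) (mon T) =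
      monomial_ideal V (\<lambda>m. keys m \<notin> \<Delta> \<or> T \<subseteq> keys m)"
    using assms by (intro adjoin_monomial_ideal) (auto simp: subset_closed_def keys_nat_add)
  also have "(\<lambda>m. keys m \<notin> \<Delta> \<or> T \<subseteq> keys m) = (\<lambda>m. keys m \<notin> {Y \<in> \<Delta>. \<not> T \<subseteq> Y})"
    by auto
  finally show ?thesis .
qed

lemma keys_single_times:
  fixes p :: "('v, 'k::field) mpoly"
  shows "keys (single a 1 * p) = (+) a ` keys p"
proof
  show "keys (single a 1 * p) \<subseteq> (+) a ` keys p"
    using keys_mult[of "single a 1" p] by auto
  show "(+) a ` keys p \<subseteq> keys (single a 1 * p)"
    by (auto simp: in_keys_iff lookup_single_times)
qed

text \<open>The new complex is the closed star of \<open>T\<close>, since multiplication by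
  \<open>mon T\<close> merely adds \<open>T\<close> to the support of every monomial.\<close>

lemma colon_SR:
  fixes \<Delta> :: "'v set set"
  assumes "finite T" "T \<subseteq> V"
  shows "colon (polys V) (SR V \<Delta>) (mon T) = (SR V {Y. T \<union> Y \<in> \<Delta>} :: ('v, 'k::field) mpoly set)"
proof -
  have "mon T * p \<in> SR V \<Delta> \<longleftrightarrow> p \<in> SR V {Y. T \<union> Y \<in> \<Delta>}" if p: "p \<in> polys V"
    for p :: "('v, 'k) mpoly"
    using polys.mult_closed[OF mon_in_polys[OF assms] p] p assms
    by (simp add: monomial_ideal_def mon_def keys_single_times keys_nat_add)
  then show ?thesis unfolding colon_def by (auto simp: monomial_ideal_def)
qed

section \<open>The grading by total degree\<close>

definition total_degree :: "('v \<Rightarrow>\<^sub>0 nat) \<Rightarrow> nat" where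
  "total_degree m = (\<Sum>v\<in>keys m. lookup m v)"

lemma total_degree_superset:
  "finite X \<Longrightarrow> keys m \<subseteq> X \<Longrightarrow> total_degree m = (\<Sum>v\<in>X. lookup m v)"
  unfolding total_degree_def by (rule sum.mono_neutral_left) (auto simp: in_keys_iff)

lemma total_degree_add: "total_degree (a + b) = total_degree a + total_degree b"
  unfolding total_degree_superset[of "keys a \<union> keys b" "a + b", OF _ eq_refl[OF keys_nat_add], simplified]
    total_degree_superset[of "keys a \<union> keys b" a, simplified]
    total_degree_superset[of "keys a \<union> keys b" b, simplified]
  by (simp add: lookup_add sum.distrib)

lemma total_degree_zero [simp]: "total_degree 0 = 0"
  by (simp add: total_degree_def)

lemma total_degree_sqfree [simp]: "finite T \<Longrightarrow> total_degree (sqfree T) = card T"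
  by (simp add: total_degree_def lookup_sqfree)

lemma lookup_le_total_degree: "lookup m v \<le> total_degree m"
proof (cases "v \<in> keys m")
  case True
  then show ?thesis unfolding total_degree_def by (intro member_le_sum) simp_all
qed (simp add: in_keys_iff)

definition homogeneous :: "nat \<Rightarrow> ('v, 'k::field) mpoly \<Rightarrow> bool" where
  "homogeneous d p \<longleftrightarrow> (\<forall>m\<in>keys p. total_degree m = d)"

definition component :: "nat \<Rightarrow> ('v, 'k::field) mpoly \<Rightarrow> ('v, 'k) mpoly" where
  "component d p = (\<Sum>m\<in>keys p. single m (lookup p m when total_degree m = d))"

definition homogeneous_ideal :: "('v, 'k::field) mpoly set \<Rightarrow> bool" where
  "homogeneous_ideal A \<longleftrightarrow> (\<forall>p\<in>A. \<forall>d. component d p \<in> A)"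

lemma lookup_component: "lookup (component d p) m = (lookup p m when total_degree m = d)"
  by (auto simp: component_def lookup_sum lookup_single when_def in_keys_iff)

lemma keys_component: "keys (component d p) = {m \<in> keys p. total_degree m = d}"
  by (auto simp: in_keys_iff lookup_component when_def split: if_splits)

lemma homogeneous_component: "homogeneous d (component d p)"
  by (simp add: homogeneous_def keys_component)

lemma component_in_polys: "p \<in> polys V \<Longrightarrow> component d p \<in> polys V"
  by (simp add: mem_polys keys_component)

lemma component_add: "component d (p + q) = component d p + component d q"
  by (rule poly_mapping_eqI) (simp add: lookup_component lookup_add when_def)

lemma component_sum: "component d (sum f I) = (\<Sum>i\<in>I. component d (f i))"
  by (rule poly_mapping_eqI) (simp add: lookup_component lookup_sum when_def)

lemma component_homogeneous: "homogeneous e p \<Longrightarrow> component d p = (p when d = e)"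
  by (rule poly_mapping_eqI)
    (auto simp: lookup_component when_def homogeneous_def in_keys_iff)

lemma sum_components:
  assumes "finite D" "\<And>m. m \<in> keys p \<Longrightarrow> total_degree m \<in> D"
  shows "(\<Sum>d\<in>D. component d p) = p"
  using assms by (intro poly_mapping_eqI)
    (auto simp: lookup_sum lookup_component when_def in_keys_iff)

lemma homogeneous_mult:
  "homogeneous d p \<Longrightarrow> homogeneous e q \<Longrightarrow> homogeneous (d + e) (p * q)"
  using keys_mult[of p q] unfolding homogeneous_def by (fastforce simp: total_degree_add)

lemma component_mult:
  assumes "homogeneous e f"
  shows "component d (f * p) = (f * component (d - e) p when e \<le> d)"
proof -
  let ?D = "total_degree ` keys p"
  have "f * p = (\<Sum>j\<in>?D. f * component j p)"
    by (subst sum_components[symmetric, of ?D p]) (simp_all add: sum_distrib_left)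
  then have "component d (f * p) = (\<Sum>j\<in>?D. component d (f * component j p))"
    by (metis component_sum)
  also have "\<dots> = (\<Sum>j\<in>?D. if e \<le> d \<and> j = d - e then f * component j p else 0)"
    by (intro sum.cong refl, subst component_homogeneous[OF homogeneous_mult[OF assms homogeneous_component]])
      (auto simp: when_def)
  also have "\<dots> = (f * component (d - e) p when e \<le> d)"
  proof (cases "d - e \<in> ?D")
    case False
    then have "component (d - e) p = 0"
      by (intro poly_mapping_eqI) (force simp: lookup_component when_def in_keys_iff)
    with False show ?thesis by (auto intro!: sum.neutral)
  qed (auto simp: when_def)
  finally show ?thesis .
qed

lemma homogeneous_ideal_monomial_ideal: "homogeneous_ideal (monomial_ideal V Q)"
  by (auto simp: homogeneous_ideal_def monomial_ideal_def component_in_polys keys_component)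

lemma homogeneous_ideal_adjoin:
  assumes A: "ideal_in (polys V) A" "homogeneous_ideal A" and "homogeneous e f" "f \<in> polys V"
  shows "homogeneous_ideal (adjoin (polys V) A f)"
  unfolding homogeneous_ideal_def
proof (intro ballI allI)
  fix p d assume "p \<in> adjoin (polys V) A f"
  then obtain a s where "p = a + f * s" "a \<in> A" "s \<in> polys V" by (rule polys.adjoinE)
  then have "component d p = component d a + f * (component (d - e) s when e \<le> d)"
    using assms(3) by (simp add: component_add component_mult mult_when)
  also have "\<dots> \<in> adjoin (polys V) A f"
    using A(2) \<open>a \<in> A\<close> \<open>s \<in> polys V\<close>
    by (intro polys.adjoinI) (auto simp: homogeneous_ideal_def when_def component_in_polys)
  finally show "component d p \<in> adjoin (polys V) A f" .
qed

lemma homogeneous_mvar: "homogeneous 1 (mvar v)"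
  by (simp add: mvar_eq_mon homogeneous_def)

lemma homogeneous_power: "homogeneous e f \<Longrightarrow> homogeneous (n * e) (f ^ n)"
proof (induction n)
  case (Suc n)
  then show ?case using homogeneous_mult[of e f "n * e" "f ^ n"] by simp
qed (simp add: homogeneous_def)

text \<open>A graded substitute for Krull's intersection theorem: with \<open>n\<close> above every
  degree occurring in \<open>p\<close>, a multiple of \<open>mvar v ^ n\<close> contributes nothing
  to the components of \<open>p\<close>, which therefore come from \<open>A\<close> alone.\<close>

lemma homogeneous_ideal_separated:
  assumes A: "ideal_in (polys V) A" "homogeneous_ideal A"
    and "\<And>n. p \<in> adjoin (polys V) A (mvar v ^ n)"
  shows "p \<in> A"
proof -
  define n where "n = Suc (Max (total_degree ` keys p))"
  have deg: "total_degree m < n" if "m \<in> keys p" for m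
    unfolding n_def using that by (simp add: less_Suc_eq_le)
  obtain a s where p: "p = a + mvar v ^ n * s" "a \<in> A" "s \<in> polys V"
    using assms(3)[of n] by (rule polys.adjoinE)
  have hom: "homogeneous n (mvar v ^ n)"
    using homogeneous_power[OF homogeneous_mvar, of n] by simp
  have "p = (\<Sum>d\<in>{..<n}. component d p)"
    using deg by (intro sum_components[symmetric]) simp_all
  also have "\<dots> = (\<Sum>d\<in>{..<n}. component d a)"
    unfolding p(1) component_add component_mult[OF hom] by (intro sum.cong) simp_all
  also have "\<dots> \<in> A"
    using A p(2) by (intro polys.ideal_in_sum) (simp_all add: homogeneous_ideal_def)
  finally show ?thesis .
qed

text \<open>Related to the permutability of homogeneous regular sequences. If \<open>g * p\<close>
  lies in \<open>A\<close>, repeated cancellation of the variable shows that \<open>p\<close> is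
  divisible by every power of it modulo \<open>A\<close>, and
  \<open>homogeneous_ideal_separated\<close> applies.\<close>

lemma weakly_regular_lift:
  assumes "ideal_in (polys V) A" "homogeneous_ideal A" "v \<in> V"
    and "nonzerodivisor_mod (polys V) A (mvar v)"
    and "\<And>f. f \<in> set fs \<Longrightarrow> f \<in> polys V \<and> (\<exists>e. homogeneous e f)"
    and "weakly_regular (polys V) (adjoin (polys V) A (mvar v)) fs"
  shows "weakly_regular (polys V) A fs"
  using assms
proof (induction fs arbitrary: A)
  case (Cons g gs)
  let ?S = "polys V" and ?x = "mvar v"
  note A = Cons.prems(1) and x = mvar_in_mpoly_ring[OF Cons.prems(3)]
  have g: "g \<in> ?S" and "\<exists>e. homogeneous e g" using Cons.prems(5)[of g] by simp_all
  then obtain e where e: "homogeneous e g" by blast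
  have nzd_g: "nonzerodivisor_mod ?S (adjoin ?S A ?x) g" using Cons.prems(6) by simp
  have nzd_x: "nonzerodivisor_mod ?S A ?x" by fact
  have "nonzerodivisor_mod ?S A g"
    unfolding nonzerodivisor_mod_def
  proof (intro ballI impI)
    fix p assume p: "p \<in> ?S" "g * p \<in> A"
    have "p \<in> adjoin ?S A (?x ^ n)" for n
    proof (induction n)
      case 0
      show ?case
        using polys.multiple_in_adjoin[OF A p(1), of 1] by simp
    next
      case (Suc n)
      then obtain a q where q: "p = a + ?x ^ n * q" "a \<in> A" "q \<in> ?S" by (rule polys.adjoinE)
      have "?x ^ n * (g * q) = g * p - g * a" unfolding q(1) by (simp add: algebra_simps)
      also have "\<dots> \<in> A" by (rule polys.ideal_in_diff[OF A p(2) polys.ideal_in_mult[OF A g q(2)]])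
      finally have "g * q \<in> A"
        by (rule nonzerodivisor_modD[OF polys.nonzerodivisor_mod_power[OF nzd_x x]])
          (simp add: g q(3))
      then have "g * q \<in> adjoin ?S A ?x" using polys.subset_adjoin by blast
      then have "q \<in> adjoin ?S A ?x" by (rule nonzerodivisor_modD[OF nzd_g _ q(3)])
      then obtain a' q' where q': "q = a' + ?x * q'" "a' \<in> A" "q' \<in> ?S" by (rule polys.adjoinE)
      have "p = (a + ?x ^ n * a') + ?x ^ Suc n * q'"
        unfolding q(1) q'(1) by (simp add: algebra_simps)
      also have "\<dots> \<in> adjoin ?S A (?x ^ Suc n)"
        by (intro polys.adjoinI polys.ideal_in_add[OF A q(2)] polys.ideal_in_mult[OF A _ q'(2)]
            polys.power_closed x q'(3))
      finally show ?case .
    qed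
    then show "p \<in> A" by (rule homogeneous_ideal_separated[OF A Cons.prems(2)])
  qed
  moreover have "weakly_regular ?S (adjoin ?S A g) gs"
  proof (rule Cons.IH)
    \<comment> \<open>The variable has to stay regular after \<open>g\<close> is adjoined. In
      \<open>?x * y = a + g * z\<close>, regularity of \<open>g\<close> modulo the variable makes
      \<open>z\<close> a multiple of the variable modulo \<open>A\<close>, which can then be
      cancelled.\<close>
    show "nonzerodivisor_mod ?S (adjoin ?S A g) ?x"
      unfolding nonzerodivisor_mod_def
    proof (intro ballI impI)
      fix y assume y: "y \<in> ?S" "?x * y \<in> adjoin ?S A g"
      from y(2) obtain a z where z: "?x * y = a + g * z" "a \<in> A" "z \<in> ?S" by (rule polys.adjoinE)
      have "g * z = - a + ?x * y" using z(1) by simp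
      also have "\<dots> \<in> adjoin ?S A ?x" using z y by (intro polys.adjoinI polys.ideal_in_uminus[OF A])
      finally have "z \<in> adjoin ?S A ?x" by (rule nonzerodivisor_modD[OF nzd_g _ z(3)])
      then obtain a' z' where z': "z = a' + ?x * z'" "a' \<in> A" "z' \<in> ?S" by (rule polys.adjoinE)
      have "?x * (y - g * z') = a + g * a'"
        using z(1) unfolding z'(1) by (simp add: algebra_simps)
      also have "\<dots> \<in> A" by (rule polys.ideal_in_add[OF A z(2) polys.ideal_in_mult[OF A g z'(2)]])
      finally have "y - g * z' \<in> A"
        by (rule nonzerodivisor_modD[OF nzd_x]) (simp add: y(1) g z'(3))
      from polys.adjoinI[OF this z'(3), of g] show "y \<in> adjoin ?S A g" by simp
    qed
    show "weakly_regular ?S (adjoin ?S (adjoin ?S A g) ?x) gs"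
      using Cons.prems(6) by (simp add: polys.adjoin_commute)
    show "homogeneous_ideal (adjoin ?S A g)"
      by (rule homogeneous_ideal_adjoin[OF A Cons.prems(2) e g])
    show "ideal_in ?S (adjoin ?S A g)" by (rule polys.ideal_in_adjoin[OF A g])
  qed (use Cons.prems in simp_all)
  ultimately show ?case by simp
qed simp

section \<open>Elementary symmetric polynomials modulo coordinate primes\<close>

definition esym :: "'v set \<Rightarrow> nat \<Rightarrow> ('v, 'k::field) mpoly" where
  "esym V k = (\<Sum>T | T \<subseteq> V \<and> card T = k. mon T)"

text \<open>Descending degrees: the polynomial of highest degree must be cut first, while it is
  still a single monomial modulo the prime under consideration.\<close>

fun esyms :: "'v set \<Rightarrow> nat \<Rightarrow> ('v, 'k::field) mpoly list" where
  "esyms V 0 = []"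
| "esyms V (Suc k) = esym V (Suc k) # esyms V k"

lemma length_esyms [simp]: "length (esyms V d) = d"
  by (induction d) simp_all

lemma set_esyms: "f \<in> set (esyms V d) \<Longrightarrow> \<exists>k. 0 < k \<and> k \<le> d \<and> f = esym V k"
  by (induction d) (auto simp: le_Suc_eq)

lemma esym_in_polys: "finite V \<Longrightarrow> esym V k \<in> polys V"
  unfolding esym_def by (rule polys.sum_closed) (auto intro: mon_in_polys finite_subset)

lemma homogeneous_esym:
  assumes "finite V"
  shows "homogeneous k (esym V k :: ('v, 'k::field) mpoly)"
  unfolding homogeneous_def
proof
  fix m assume "m \<in> keys (esym V k :: ('v, 'k) mpoly)"
  then obtain T where "T \<subseteq> V" "card T = k" "m = sqfree T"
    using Poly_Mapping.keys_sum[of mon "{T. T \<subseteq> V \<and> card T = k}"] unfolding esym_def by auto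
  then show "total_degree m = k"
    using assms finite_subset[of T V] by simp
qed

lemma esyms_in_polys: "finite V \<Longrightarrow> set (esyms V d) \<subseteq> polys V"
  using esym_in_polys set_esyms by fastforce

lemma esym_in_SR:
  assumes "finite V" "0 < k"
  shows "esym V k \<in> SR V {{}}"
  unfolding esym_def
proof (rule polys.ideal_in_sum[OF ideal_in_SR])
  fix T assume "T \<in> {T. T \<subseteq> V \<and> card T = k}"
  then show "mon T \<in> SR V {{}}"
    using assms finite_subset by (intro mon_in_monomial_ideal) fastforce+
qed (simp add: subset_closed_def)

text \<open>Every other \<open>k\<close>-subset of \<open>V\<close> contains a vertex outside
  \<open>U\<close>, so its monomial vanishes modulo the prime.\<close>

lemma esym_minus_mon:
  assumes "finite V" "U \<subseteq> V" "card U = k"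
  shows "esym V k - mon U \<in> SR V (Pow U)"
proof -
  have fin: "finite {T. T \<subseteq> V \<and> card T = k}" using assms by simp
  have "esym V k - mon U = (\<Sum>T\<in>{T. T \<subseteq> V \<and> card T = k} - {U}. mon T)"
    unfolding esym_def using fin assms by (subst sum.remove[of _ U]) simp_all
  also have "\<dots> \<in> SR V (Pow U)"
  proof (rule polys.ideal_in_sum[OF ideal_in_SR])
    fix T assume T: "T \<in> {T. T \<subseteq> V \<and> card T = k} - {U}"
    then have "\<not> T \<subseteq> U"
      using assms card_subset_eq[of U T] finite_subset by auto
    then show "mon T \<in> SR V (Pow U)"
      using T assms finite_subset by (intro mon_in_monomial_ideal) auto
  qed (auto simp: subset_closed_def)
  finally show ?thesis .
qed

lemma subset_closed_Pow: "subset_closed (Pow U)"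
  by (auto simp: subset_closed_def)

lemma nonzerodivisor_mod_mon_Pow:
  assumes "finite T" "T \<subseteq> U" "T \<subseteq> V"
  shows "nonzerodivisor_mod (polys V) (SR V (Pow U) :: ('v, 'k::field) mpoly set) (mon T)"
  unfolding nonzerodivisor_mod_def
proof (intro ballI impI)
  fix x :: "('v, 'k) mpoly"
  assume "x \<in> polys V" "mon T * x \<in> SR V (Pow U)"
  then have "x \<in> colon (polys V) (SR V (Pow U)) (mon T)" by (simp add: colon_def)
  then have "x \<in> SR V {Y. T \<union> Y \<in> Pow U}" by (simp only: colon_SR assms(1,3))
  then show "x \<in> SR V (Pow U)"
    using assms(2) by (simp add: monomial_ideal_def)
qed

lemma adjoin_Pow:
  assumes "v \<in> V"
  shows "adjoin (polys V) (SR V (Pow U)) (mvar v) = SR V (Pow (U - {v}))"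
proof -
  have "{Y \<in> Pow U. \<not> {v} \<subseteq> Y} = Pow (U - {v})" by auto
  then show ?thesis
    unfolding mvar_eq_mon using assms by (subst adjoin_SR) (simp_all add: subset_closed_Pow)
qed

text \<open>The facets of this complex are the sets \<open>U - {t}\<close> with \<open>t\<close> in
  \<open>T\<close>. They are split off one at a time by \<open>weakly_regular_extension\<close>:
  adjoining \<open>mvar t\<close> leaves the simplex on \<open>U - {t}\<close>, and the colon
  removes \<open>t\<close> from \<open>T\<close>. At empty \<open>T\<close> the ideal is the whole
  ring, where weak regularity is trivial.\<close>

lemma weakly_regular_divisor_boundary:
  assumes "finite V" "U \<subseteq> V" "T \<subseteq> U"
    and "\<And>t. t \<in> U \<Longrightarrow> weakly_regular (polys V) (SR V (Pow (U - {t})) :: ('v, 'k::field) mpoly set) fs"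
    and "set fs \<subseteq> polys V"
  shows "weakly_regular (polys V) (SR V {Y \<in> Pow U. \<not> T \<subseteq> Y} :: ('v, 'k) mpoly set) fs"
proof -
  have "finite T" using assms finite_subset by (metis finite_subset)
  then show ?thesis using assms(3)
  proof (induction T)
    case empty
    have "nonzerodivisor_mod (polys V) (polys V) f" for f :: "('v, 'k) mpoly"
      by (simp add: nonzerodivisor_mod_def)
    moreover have "adjoin (polys V) (polys V) f = polys V" if "f \<in> polys V" for f :: "('v, 'k) mpoly"
      using that polys.subset_adjoin[of "polys V" V f] by (auto simp: adjoin_def)
    ultimately have "weakly_regular (polys V) (polys V :: ('v, 'k) mpoly set) fs"
      using assms(5) by (induction fs) simp_all
    then show ?case by (simp add: monomial_ideal_def)
  next
    case (insert t T)
    have t: "t \<in> U" "t \<in> V" using insert.prems assms(2) by auto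
    have closed: "subset_closed {Y \<in> Pow U. \<not> insert t T \<subseteq> Y}" by (auto simp: subset_closed_def)
    show ?case
    proof (rule polys.weakly_regular_extension[of _ _ "mvar t"])
      have *: "{Y \<in> {Y \<in> Pow U. \<not> insert t T \<subseteq> Y}. \<not> {t} \<subseteq> Y} = Pow (U - {t})" by auto
      show "weakly_regular (polys V)
          (adjoin (polys V) (SR V {Y \<in> Pow U. \<not> insert t T \<subseteq> Y}) (mvar t)) fs"
        unfolding mvar_eq_mon using t assms(4)[OF t(1)]
        by (subst adjoin_SR[OF closed]) (simp, simp, simp only: *)
      have "{Y. {t} \<union> Y \<in> {Y \<in> Pow U. \<not> insert t T \<subseteq> Y}} = {Y \<in> Pow U. \<not> T \<subseteq> Y}"
        using t insert.hyps by auto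
      then show "weakly_regular (polys V)
          (colon (polys V) (SR V {Y \<in> Pow U. \<not> insert t T \<subseteq> Y}) (mvar t)) fs"
        unfolding mvar_eq_mon using t insert by (simp only: colon_SR finite.intros empty_subsetI insert_subset)
    qed (fact ideal_in_SR[OF closed], fact mvar_in_mpoly_ring[OF t(2)], fact assms(5))
  qed
qed

text \<open>Modulo the prime the first element is \<open>mon U\<close>, a nonzerodivisor. Cutting by
  it leaves the boundary of the simplex on \<open>U\<close>, whose facets have one vertex less, so
  the remaining sequence falls under the induction hypothesis on each of them.\<close>

lemma weakly_regular_esyms_Pow_card:
  assumes "finite V" "U \<subseteq> V" "card U = d"
  shows "weakly_regular (polys V) (SR V (Pow U) :: ('v, 'k::field) mpoly set) (esyms V d)"
  using assms(2,3)
proof (induction d arbitrary: U)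
  case (Suc d)
  have U: "finite U" using Suc.prems assms(1) finite_subset by blast
  note I = ideal_in_SR[OF subset_closed_Pow]
  have diff: "esym V (Suc d) - mon U \<in> (SR V (Pow U) :: ('v, 'k) mpoly set)"
    using esym_minus_mon assms(1) Suc.prems by blast
  have "nonzerodivisor_mod (polys V) (SR V (Pow U) :: ('v, 'k) mpoly set) (esym V (Suc d))"
    unfolding nonzerodivisor_mod_def
  proof (intro ballI impI)
    fix x :: "('v, 'k) mpoly"
    assume x: "x \<in> polys V" "esym V (Suc d) * x \<in> SR V (Pow U)"
    have "mon U * x = esym V (Suc d) * x - (esym V (Suc d) - mon U) * x"
      by (simp add: algebra_simps)
    also have "\<dots> \<in> SR V (Pow U)"
      by (rule polys.ideal_in_diff[OF I x(2) polys.ideal_in_mult_right[OF I x(1) diff]])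
    finally show "x \<in> SR V (Pow U)"
      by (rule nonzerodivisor_modD[OF nonzerodivisor_mod_mon_Pow, rotated -2])
        (use x U Suc.prems in simp_all)
  qed
  moreover have "adjoin (polys V) (SR V (Pow U)) (esym V (Suc d)) =
      (SR V {Y \<in> Pow U. \<not> U \<subseteq> Y} :: ('v, 'k) mpoly set)"
    using assms(1) U Suc.prems
    by (simp only: polys.adjoin_cong[OF I esym_in_polys mon_in_polys diff]
        adjoin_SR[OF subset_closed_Pow])
  moreover have "weakly_regular (polys V) (SR V {Y \<in> Pow U. \<not> U \<subseteq> Y} :: ('v, 'k) mpoly set)
      (esyms V d)"
    using assms(1) Suc U
    by (intro weakly_regular_divisor_boundary Suc.IH esyms_in_polys) auto
  ultimately show ?case by simp
qed simp

text \<open>Surplus variables are removed one by one: killing a variable of \<open>U\<close> gives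
  the prime of a smaller set, and \<open>weakly_regular_lift\<close> carries the homogeneous
  sequence back.\<close>

lemma weakly_regular_esyms_Pow:
  assumes "finite V" "U \<subseteq> V" "d \<le> card U"
  shows "weakly_regular (polys V) (SR V (Pow U) :: ('v, 'k::field) mpoly set) (esyms V d)"
  using assms(2,3)
proof (induction "card U - d" arbitrary: U)
  case 0
  then show ?case using weakly_regular_esyms_Pow_card[OF assms(1)] by simp
next
  case (Suc n)
  have U: "finite U" using Suc.prems assms(1) finite_subset by blast
  obtain v where v: "v \<in> U" using Suc.hyps(2) by fastforce
  then have "U - {v} \<subseteq> V" "n = card (U - {v}) - d" "d \<le> card (U - {v})"
    using Suc.prems Suc.hyps(2) U by auto
  note IH = Suc.hyps(1)[OF this(2,1,3)]
  show ?case
  proof (rule weakly_regular_lift)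
    show "v \<in> V" using v Suc.prems by blast
    then show "weakly_regular (polys V)
        (adjoin (polys V) (SR V (Pow U) :: ('v, 'k) mpoly set) (mvar v)) (esyms V d)"
      using IH by (simp only: adjoin_Pow)
    show "nonzerodivisor_mod (polys V) (SR V (Pow U) :: ('v, 'k) mpoly set) (mvar v)"
      unfolding mvar_eq_mon using v Suc.prems by (intro nonzerodivisor_mod_mon_Pow) auto
    show "f \<in> polys V \<and> (\<exists>e. homogeneous e f)" if "f \<in> set (esyms V d)" for f :: "('v, 'k) mpoly"
      using set_esyms[OF that] esym_in_polys homogeneous_esym assms(1) by blast
  qed (simp_all only: ideal_in_SR subset_closed_Pow homogeneous_ideal_monomial_ideal)
qed


section \<open>Chordal graphs\<close>

lemma edge_vertices:
  assumes "simple_graph V E" "{u, v} \<in> E"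
  shows "u \<in> V" "v \<in> V" "u \<noteq> v"
  using assms unfolding simple_graph_def by (metis doubleton_eq_iff)+

lemma no_loop: "simple_graph V E \<Longrightarrow> {u} \<notin> E"
  using edge_vertices(3)[of V E u u] by auto

lemma cycle_edges_iff:
  "i < k \<Longrightarrow> j < k \<Longrightarrow> {i, j} \<in> cycle_edges k \<longleftrightarrow> j = Suc i mod k \<or> i = Suc j mod k"
  unfolding cycle_edges_def by (auto simp: doubleton_eq_iff)

text \<open>By symmetry only pairs \<open>i < j\<close> have to be inspected; the edge that closes
  the cycle is then the one between \<open>0\<close> and \<open>k - 1\<close>.\<close>

lemma chordal_no_hole:
  assumes "chordal V E" "4 \<le> k" "inj_on f {..<k}" "f ` {..<k} \<subseteq> V"
    and "\<And>i j. i < j \<Longrightarrow> j < k \<Longrightarrow> {f i, f j} \<in> E \<longleftrightarrow> j = Suc i \<or> (i = 0 \<and> Suc j = k)"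
    and "simple_graph V E"
  shows False
proof -
  have edge: "{f i, f j} \<in> E \<longleftrightarrow> {i, j} \<in> cycle_edges k" if "i < j" "j < k" for i j
    using assms(5)[OF that] cycle_edges_iff[of i k j] that by (auto simp: mod_if split: if_splits)
  have "{f i, f j} \<in> E \<longleftrightarrow> {i, j} \<in> cycle_edges k" if "i < k" "j < k" for i j
  proof (cases i j rule: linorder_cases)
    case equal
    then show ?thesis
      using cycle_edges_iff[of i k i] no_loop[OF assms(6), of "f i"] that assms(2)
      by (auto simp: mod_if split: if_splits)
  qed (use edge[of i j] edge[of j i] that in \<open>simp_all add: insert_commute\<close>)
  then have "graph_isomorphic {..<k} (cycle_edges k) (f ` {..<k}) (induced_edges E (f ` {..<k}))"
    unfolding graph_isomorphic_def induced_edges_def using assms(3)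
    by (intro exI[of _ f]) (auto simp: inj_on_imp_bij_betw)
  then show False using assms(1,2,4) unfolding chordal_def by blast
qed

section \<open>Shortest walks and simplicial vertices\<close>

definition walk :: "'v set set \<Rightarrow> 'v set \<Rightarrow> 'v \<Rightarrow> 'v \<Rightarrow> (nat \<Rightarrow> 'v) \<Rightarrow> nat \<Rightarrow> bool" where
  "walk E C s t x l \<longleftrightarrow> x 0 = s \<and> x l = t \<and> (\<forall>i<l. {x i, x (Suc i)} \<in> E) \<and>
     (\<forall>i. 0 < i \<and> i < l \<longrightarrow> x i \<in> C)"

text \<open>The \<open>d\<close> vertices after \<open>x i\<close> are cut out. The last two
  premises separate a walk that continues beyond the gap from one that already ends at
  \<open>x i\<close>, so the same lemma excludes chords and repeated vertices from a shortest
  walk.\<close>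

lemma walk_shortcut:
  assumes "walk E C s t x l" "i + d \<le> l"
    and "i + d < l \<Longrightarrow> {x i, x (Suc (i + d))} \<in> E" and "i + d = l \<Longrightarrow> x i = t"
  shows "walk E C s t (\<lambda>k. if k \<le> i then x k else x (k + d)) (l - d)"
  unfolding walk_def
proof (intro conjI allI impI)
  fix k assume k: "k < l - d"
  consider "k < i" | "k = i" | "i < k" by linarith
  then show "{if k \<le> i then x k else x (k + d), if Suc k \<le> i then x (Suc k) else x (Suc k + d)} \<in> E"
    using assms k by cases (auto simp: walk_def)
next
  show "(if l - d \<le> i then x (l - d) else x (l - d + d)) = t"
  proof (cases "l - d \<le> i")
    case True
    then have "l - d = i" "i + d = l" using assms(2) by linarith+
    then show ?thesis using assms(4) by simp
  qed (use assms(1) in \<open>simp add: walk_def\<close>)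
next
  fix k assume k: "0 < k \<and> k < l - d"
  then have "0 < k" "k < l" "0 < k + d" "k + d < l" by linarith+
  then show "(if k \<le> i then x k else x (k + d)) \<in> C" using assms(1) by (simp add: walk_def)
qed (use assms(1) in \<open>simp add: walk_def\<close>)

lemma shortest_walk:
  assumes "walk E C s t x0 l0"
  obtains x l where "walk E C s t x l"
    and "\<And>i j. i < j \<Longrightarrow> j \<le> l \<Longrightarrow> x i \<noteq> x j"
    and "\<And>i j. i < j \<Longrightarrow> j \<le> l \<Longrightarrow> {x i, x j} \<in> E \<Longrightarrow> j = Suc i"
proof -
  define l where "l = (LEAST l. \<exists>x. walk E C s t x l)"
  have "\<exists>x. walk E C s t x l"
    unfolding l_def using assms LeastI_ex[of "\<lambda>l. \<exists>x. walk E C s t x l"] by blast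
  then obtain x where x: "walk E C s t x l" by blast
  have short: "l \<le> l'" if "walk E C s t y l'" for y l'
    unfolding l_def using that Least_le[of "\<lambda>l. \<exists>x. walk E C s t x l" l'] by blast
  have no_shortcut: "d = 0" if "i + d \<le> l" "i + d < l \<Longrightarrow> {x i, x (Suc (i + d))} \<in> E"
    "i + d = l \<Longrightarrow> x i = t" for i d
    using short[OF walk_shortcut[OF x that]] that(1) by linarith
  show thesis
  proof (rule that[OF x])
    fix i j assume ij: "i < j" "j \<le> l"
    show "x i \<noteq> x j"
    proof
      assume "x i = x j"
      then have "j - i = 0" using x ij by (intro no_shortcut[of i]) (auto simp: walk_def)
      then show False using ij by simp
    qed
    assume "{x i, x j} \<in> E"
    then have "j - Suc i = 0" using ij by (intro no_shortcut[of i]) auto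
    then show "j = Suc i" using ij by simp
  qed
qed

definition simplicial :: "'v set \<Rightarrow> 'v set set \<Rightarrow> 'v \<Rightarrow> bool" where
  "simplicial U E w \<longleftrightarrow> w \<in> U \<and>
     (\<forall>a\<in>U. \<forall>b\<in>U. a \<noteq> b \<longrightarrow> {w, a} \<in> E \<longrightarrow> {w, b} \<in> E \<longrightarrow> {a, b} \<in> E)"

text \<open>Dirac's theorem.  Let \<open>C\<close> be the component of a vertex not adjacent to \<open>v\<close> in the graph
  without the closed neighbourhood of \<open>v\<close>.  The attachment set \<open>S\<close> of \<open>C\<close> is a clique: a shortest
  walk through \<open>C\<close> between two nonadjacent vertices of \<open>S\<close> would form a hole with \<open>v\<close>.  Induction
  applies to \<open>C \<union> S\<close>.\<close>

lemma chordal_simplicial_nonneighbour: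
  assumes G: "simple_graph V E" "chordal V E"
    and "U \<subseteq> V" "v \<in> U" "u0 \<in> U" "u0 \<noteq> v" "{v, u0} \<notin> E"
  shows "\<exists>w. simplicial U E w \<and> w \<noteq> v \<and> {v, w} \<notin> E"
  using assms(3-)
proof (induction "card U" arbitrary: U v u0 rule: less_induct)
  case less
  have finU: "finite U" using G less.prems(1) by (auto simp: simple_graph_def intro: finite_subset)
  define Z where "Z = {z \<in> U. z \<noteq> v \<and> {v, z} \<notin> E}"
  define R where "R = {(a, b). a \<in> Z \<and> b \<in> Z \<and> {a, b} \<in> E}"
  define C where "C = {y. (u0, y) \<in> R\<^sup>*}"
  define S where "S = {s \<in> U - C. \<exists>c\<in>C. {s, c} \<in> E}"
  have u0Z: "u0 \<in> Z" using less.prems by (simp add: Z_def)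
  have u0C: "u0 \<in> C" by (simp add: C_def)
  have CZ: "C \<subseteq> Z"
  proof
    fix y assume "y \<in> C"
    then have "(u0, y) \<in> R\<^sup>*" by (simp add: C_def)
    then show "y \<in> Z" using u0Z by (cases rule: rtranclE) (auto simp: R_def)
  qed
  have vS: "{v, s} \<in> E" "s \<noteq> v" if s: "s \<in> S" for s
  proof -
    obtain c where c: "c \<in> C" "{s, c} \<in> E" using s by (auto simp: S_def)
    show "s \<noteq> v" using c CZ by (auto simp: Z_def)
    have "s \<notin> Z"
    proof
      assume "s \<in> Z"
      then have "(c, s) \<in> R" using c CZ by (auto simp: R_def insert_commute)
      then have "s \<in> C" using c(1) unfolding C_def by (simp add: rtrancl.rtrancl_into_rtrancl)
      then show False using s by (simp add: S_def)
    qed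
    then show "{v, s} \<in> E" using s \<open>s \<noteq> v\<close> by (auto simp: Z_def S_def)
  qed
  have clique: "{s, t} \<in> E" if st: "s \<in> S" "t \<in> S" "s \<noteq> t" for s t
  proof (rule ccontr)
    assume nonadj: "{s, t} \<notin> E"
    obtain c d where c: "c \<in> C" "{s, c} \<in> E" and d: "d \<in> C" "{t, d} \<in> E"
      using st by (auto simp: S_def)
    have "sym (R\<^sup>*)" by (rule sym_rtrancl) (auto simp: R_def sym_def insert_commute)
    then have "(c, d) \<in> R\<^sup>*"
      using symD[of "R\<^sup>*" u0 c] rtrancl_trans[of c u0 R d] c(1) d(1) by (simp add: C_def)
    then obtain n f where f: "f 0 = c" "f n = d" "\<And>i. i < n \<Longrightarrow> (f i, f (Suc i)) \<in> R"
      unfolding rtrancl_power relpow_fun_conv by blast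
    have fC: "f i \<in> C" if "i \<le> n" for i
      using that
    proof (induction i)
      case (Suc i)
      then have "f i \<in> C" "(f i, f (Suc i)) \<in> R" using f(3) by simp_all
      then show ?case unfolding C_def by (simp add: rtrancl.rtrancl_into_rtrancl)
    qed (simp add: f c)
    \<comment> \<open>The route \<open>f\<close> inside \<open>C\<close> has \<open>n\<close> steps;
      \<open>s\<close> is put in front and \<open>t\<close> behind, hence the length
      \<open>n + 2\<close>.\<close>
    define x0 where "x0 k = (if k = 0 then s else if k \<le> Suc n then f (k - 1) else t)" for k
    have "walk E C s t x0 (n + 2)"
      unfolding walk_def
    proof (intro conjI allI impI)
      fix k assume k: "k < n + 2"
      consider "k = 0" | "k = Suc n" | "0 < k" "k \<le> n" using k by linarith
      then show "{x0 k, x0 (Suc k)} \<in> E"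
      proof cases
        case 3
        then have "(f (k - 1), f (Suc (k - 1))) \<in> R" by (intro f(3)) simp
        with 3 show ?thesis by (simp add: x0_def R_def)
      qed (use c d f in \<open>auto simp: x0_def insert_commute\<close>)
    qed (auto simp: x0_def fC)
    then obtain x l where x: "walk E C s t x l"
      and dist: "\<And>i j. i < j \<Longrightarrow> j \<le> l \<Longrightarrow> x i \<noteq> x j"
      and chordless: "\<And>i j. i < j \<Longrightarrow> j \<le> l \<Longrightarrow> {x i, x j} \<in> E \<Longrightarrow> j = Suc i"
      by (rule shortest_walk) blast
    have ends: "x 0 = s" "x l = t" and step: "\<And>i. i < l \<Longrightarrow> {x i, x (Suc i)} \<in> E"
      and inner: "\<And>i. 0 < i \<Longrightarrow> i < l \<Longrightarrow> x i \<in> C"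
      using x by (auto simp: walk_def)
    have "l \<noteq> 0" using ends st(3) by metis
    moreover have "l \<noteq> 1" using ends step[of 0] nonadj by auto
    ultimately have l: "2 \<le> l" by linarith
    \<comment> \<open>With \<open>v\<close> as vertex \<open>l + 1\<close> the walk closes to a
      cycle of length \<open>l + 2\<close>, which is at least 4. No chord ends in \<open>v\<close>,
      because the inner vertices lie in \<open>C\<close> and so are not adjacent to
      \<open>v\<close>.\<close>
    define f where "f i = (if i \<le> l then x i else v)" for i
    have xU: "x i \<in> U" "x i \<noteq> v" "{x i, v} \<in> E \<longleftrightarrow> i = 0 \<or> i = l" if il: "i \<le> l" for i
    proof -
      consider "i = 0" | "i = l" | "0 < i" "i < l" using il by linarith
      then have "x i \<in> U \<and> x i \<noteq> v \<and> ({x i, v} \<in> E \<longleftrightarrow> i = 0 \<or> i = l)"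
      proof cases
        case 3
        then have "x i \<in> Z" using inner CZ by blast
        with 3 show ?thesis by (auto simp: Z_def insert_commute[of "x i"])
      qed (use ends st vS in \<open>auto simp: S_def insert_commute[of _ v]\<close>)
      then show "x i \<in> U" "x i \<noteq> v" "{x i, v} \<in> E \<longleftrightarrow> i = 0 \<or> i = l" by simp_all
    qed
    show False
    proof (rule chordal_no_hole[OF G(2) _ _ _ _ G(1), of "l + 2" f])
      show "inj_on f {..<l + 2}"
      proof (rule linorder_inj_onI)
        fix i j assume "i < j" "i \<in> {..<l + 2}" "j \<in> {..<l + 2}"
        then show "f i \<noteq> f j" using dist[of i j] xU(2)[of i] by (auto simp: f_def)
      qed auto
      show "f ` {..<l + 2} \<subseteq> V" using xU(1) less.prems by (auto simp: f_def)
      show "{f i, f j} \<in> E \<longleftrightarrow> j = Suc i \<or> (i = 0 \<and> Suc j = l + 2)" if "i < j" "j < l + 2" for i j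
        using that chordless[of i j] step[of i] xU(3)[of i] by (auto simp: f_def)
    qed (use l in simp)
  qed
  define U' where "U' = C \<union> S"
  have U'U: "U' \<subseteq> U" using CZ by (auto simp: U'_def S_def Z_def)
  have "v \<notin> U'" using CZ vS(2) by (auto simp: U'_def Z_def)
  then have small: "card U' < card U"
    using U'U less.prems finU by (intro psubset_card_mono) auto
  have U'V: "U' \<subseteq> V" using U'U less.prems by blast
  have "\<exists>w\<in>C. simplicial U' E w"
  proof -
    \<comment> \<open>The vertex to which induction is applied is chosen so that the simplicial
      vertex avoids \<open>S\<close>. If some \<open>s\<close> in \<open>S\<close> has a
      nonneighbour, the result is nonadjacent to \<open>s\<close> and hence outside the clique
      \<open>S\<close>. Otherwise vertices of \<open>S\<close> are adjacent to everything in
      \<open>U'\<close>, so a nonneighbour of \<open>c\<close> is outside \<open>S\<close>. If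
      neither applies, \<open>U'\<close> is complete.\<close>
    consider (S) s q where "s \<in> S" "q \<in> U'" "q \<noteq> s" "{s, q} \<notin> E"
      | (C) c q where "c \<in> C" "q \<in> U'" "q \<noteq> c" "{c, q} \<notin> E"
          "\<And>s q. s \<in> S \<Longrightarrow> q \<in> U' \<Longrightarrow> q \<noteq> s \<Longrightarrow> {s, q} \<in> E"
      | (clique) "\<And>p q. p \<in> U' \<Longrightarrow> q \<in> U' \<Longrightarrow> q \<noteq> p \<Longrightarrow> {p, q} \<in> E"
      unfolding U'_def by blast
    then show ?thesis
    proof cases
      case S
      then obtain w where "simplicial U' E w" "w \<noteq> s" "{s, w} \<notin> E"
        using less.hyps[OF small U'V, of s q] by (auto simp: U'_def)
      moreover from this have "w \<notin> S" using clique[of s w] S by auto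
      ultimately show ?thesis by (auto simp: simplicial_def U'_def)
    next
      case C
      then obtain w where w: "simplicial U' E w" "w \<noteq> c" "{c, w} \<notin> E"
        using less.hyps[OF small U'V, of c q] by (auto simp: U'_def)
      moreover have "w \<notin> S" using C(5)[of w c] C(1) w by (auto simp: insert_commute U'_def)
      ultimately show ?thesis by (auto simp: simplicial_def U'_def)
    next
      case clique
      then show ?thesis using u0C by (intro bexI[of _ u0]) (auto simp: simplicial_def U'_def)
    qed
  qed
  then obtain w where w: "w \<in> C" "simplicial U' E w" by blast
  \<comment> \<open>All neighbours in \<open>U\<close> of a vertex of \<open>C\<close> lie in
    \<open>C\<close> or in its attachment set, so being simplicial in \<open>U'\<close> and in
    \<open>U\<close> is the same for \<open>w\<close>.\<close>
  have nbr: "a \<in> U'" if "a \<in> U" "{w, a} \<in> E" for a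
    using that w(1) by (auto simp: U'_def S_def insert_commute)
  have "simplicial U E w"
    using w nbr U'U unfolding simplicial_def by blast
  moreover have "w \<noteq> v" "{v, w} \<notin> E" using w(1) CZ by (auto simp: Z_def)
  ultimately show ?case by blast
qed

lemma chordal_simplicial_exists:
  assumes "simple_graph V E" "chordal V E" "U \<subseteq> V" "U \<noteq> {}"
  shows "\<exists>w. simplicial U E w"
proof (cases "\<exists>v\<in>U. \<exists>u\<in>U. u \<noteq> v \<and> {v, u} \<notin> E")
  case True
  then show ?thesis using chordal_simplicial_nonneighbour[OF assms(1-3)] by blast
next
  case False
  moreover obtain w where "w \<in> U" using assms(4) by blast
  ultimately have "simplicial U E w" unfolding simplicial_def by metis
  then show ?thesis ..
qed

section \<open>Independence complexes and shedding vertices\<close>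

definition independent :: "'v set set \<Rightarrow> 'v set \<Rightarrow> bool" where
  "independent E W \<longleftrightarrow> (\<forall>u\<in>W. \<forall>v\<in>W. {u, v} \<notin> E)"

definition maximal_independent :: "'v set \<Rightarrow> 'v set set \<Rightarrow> 'v set \<Rightarrow> bool" where
  "maximal_independent U E W \<longleftrightarrow>
     W \<subseteq> U \<and> independent E W \<and> (\<forall>u\<in>U - W. \<exists>w\<in>W. {u, w} \<in> E)"

definition independence_complex :: "'v set \<Rightarrow> 'v set set \<Rightarrow> 'v set set" where
  "independence_complex U E = {Y. Y \<subseteq> U \<and> independent E Y}"

lemma subset_closed_independence_complex: "subset_closed (independence_complex U E)"
  by (auto simp: subset_closed_def independence_complex_def independent_def)

text \<open>A neighbour \<open>w\<close> of a simplicial vertex is a shedding vertex: neither deleting \<open>w\<close> nor passing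
  to its link creates a maximal independent set smaller than those already present.\<close>

lemma weakly_regular_esyms_chordal:
  assumes G: "simple_graph V E" "chordal V E"
    and "U \<subseteq> V" "\<And>W. maximal_independent U E W \<Longrightarrow> d \<le> card W"
  shows "weakly_regular (polys V) (SR V (independence_complex U E) :: ('v, 'k::field) mpoly set)
    (esyms V d)"
  using assms(3-)
proof (induction "card U" arbitrary: U rule: less_induct)
  case less
  have finV: "finite V" using G by (simp add: simple_graph_def)
  then have finU: "finite U" using less.prems finite_subset by blast
  show ?case
  proof (cases "independent E U")
    case True
    then have "independence_complex U E = Pow U"
      by (auto simp: independence_complex_def independent_def)
    moreover have "d \<le> card U"
      using True by (intro less.prems(2)) (auto simp: maximal_independent_def)
    ultimately show ?thesis using weakly_regular_esyms_Pow[OF finV less.prems(1)] by (simp only:)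
  next
    case False
    \<comment> \<open>Isolated vertices are set aside so that the simplicial vertex has a neighbour
      \<open>w\<close> to shed.\<close>
    define U' where "U' = {u \<in> U. \<exists>x\<in>U. {u, x} \<in> E}"
    have "U' \<noteq> {}" "U' \<subseteq> V" using False less.prems(1) by (auto simp: U'_def independent_def)
    then obtain v where v: "simplicial U' E v" using chordal_simplicial_exists[OF G] by blast
    then obtain w where w: "w \<in> U" "{v, w} \<in> E" by (auto simp: simplicial_def U'_def)
    have vU: "v \<in> U" using v by (auto simp: simplicial_def U'_def)
    have wV: "w \<in> V" and vw: "v \<noteq> w" using edge_vertices[OF G(1) w(2)] by auto
    have simp_v: "{y, w} \<in> E" if "y \<in> U" "{v, y} \<in> E" "y \<noteq> w" for y
    proof -
      have "y \<in> U'" "w \<in> U'" using that w vU by (auto simp: U'_def insert_commute)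
      then show ?thesis using v that w unfolding simplicial_def by blast
    qed
    show ?thesis
    proof (rule polys.weakly_regular_extension)
      show "ideal_in (polys V) (SR V (independence_complex U E) :: ('v, 'k) mpoly set)"
        by (rule ideal_in_SR[OF subset_closed_independence_complex])
      show "mvar w \<in> polys V" by (rule mvar_in_mpoly_ring[OF wV])
      show "set (esyms V d) \<subseteq> polys V" by (rule esyms_in_polys[OF finV])
      have eq: "{Y \<in> independence_complex U E. \<not> {w} \<subseteq> Y} = independence_complex (U - {w}) E"
        by (auto simp: independence_complex_def)
      have "weakly_regular (polys V) (SR V (independence_complex (U - {w}) E) :: ('v, 'k) mpoly set)
        (esyms V d)"
      proof (rule less.hyps)
        show "card (U - {w}) < card U" using finU w(1) by (rule card_Diff1_less)
        fix W assume W: "maximal_independent (U - {w}) E W"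
        \<comment> \<open>Either \<open>v\<close> itself is in \<open>W\<close>, or it is dominated
          by some \<open>y\<close> in \<open>W\<close>; then \<open>y\<close> and \<open>w\<close>
          are both neighbours of the simplicial \<open>v\<close> and hence adjacent. So
          \<open>W\<close> stays maximal when \<open>w\<close> is put back.\<close>
        have "\<exists>y\<in>W. {w, y} \<in> E"
        proof (cases "v \<in> W")
          case False
          then obtain y where "y \<in> W" "{v, y} \<in> E"
            using W vU vw unfolding maximal_independent_def by blast
          moreover from this have "y \<in> U" "y \<noteq> w" using W by (auto simp: maximal_independent_def)
          ultimately show ?thesis using simp_v[of y] by (metis insert_commute)
        qed (use w in \<open>auto simp: insert_commute\<close>)
        then have "maximal_independent U E W" using W by (auto simp: maximal_independent_def)
        then show "d \<le> card W" by (rule less.prems(2))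
      qed (use less.prems in auto)
      then show "weakly_regular (polys V)
          (adjoin (polys V) (SR V (independence_complex U E) :: ('v, 'k) mpoly set) (mvar w)) (esyms V d)"
        unfolding mvar_eq_mon using wV
        by (subst adjoin_SR[OF subset_closed_independence_complex]) (simp, simp, simp only: eq)
      \<comment> \<open>\<open>L\<close> keeps \<open>w\<close>, which is isolated in it, and loses
        \<open>v\<close>. Every maximal independent set of \<open>L\<close> therefore contains
        \<open>w\<close>, and \<open>w\<close> dominates the vertices outside
        \<open>L\<close>.\<close>
      define L where "L = {u \<in> U. {u, w} \<notin> E}"
      have eq': "{Y. {w} \<union> Y \<in> independence_complex U E} = independence_complex L E"
        using w(1) no_loop[OF G(1), of w]
        by (auto simp: independence_complex_def independent_def L_def insert_commute)
      have "weakly_regular (polys V) (SR V (independence_complex L E) :: ('v, 'k) mpoly set)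
        (esyms V d)"
      proof (rule less.hyps)
        show "card L < card U"
          using finU vU w(2) by (intro psubset_card_mono) (auto simp: L_def)
        show "L \<subseteq> V" using less.prems(1) by (auto simp: L_def)
        fix W assume W: "maximal_independent L E W"
        have "w \<in> L" using w(1) no_loop[OF G(1), of w] by (simp add: L_def)
        then have "w \<in> W"
          using W unfolding maximal_independent_def L_def
          by (metis (mono_tags, lifting) DiffI insert_commute mem_Collect_eq subsetD)
        then have "maximal_independent U E W"
          using W unfolding maximal_independent_def L_def by blast
        then show "d \<le> card W" by (rule less.prems(2))
      qed
      then show "weakly_regular (polys V)
          (colon (polys V) (SR V (independence_complex U E) :: ('v, 'k) mpoly set) (mvar w)) (esyms V d)"
        unfolding mvar_eq_mon using wV by (subst colon_SR) (simp, simp, simp only: eq')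
    qed
  qed
qed


section \<open>Algebraic dependence and Krull dimension\<close>

lemma lookup_sum_products:
  fixes p q :: "('v, 'k::field) mpoly"
  shows "lookup (p * q) k =
    (\<Sum>m\<in>keys p. \<Sum>n\<in>keys q. lookup p m * lookup q n when m + n = k)"
proof -
  have "p * q = (\<Sum>m\<in>keys p. single m (lookup p m)) * (\<Sum>n\<in>keys q. single n (lookup q n))"
    by (simp only: sum_single_keys)
  also have "\<dots> = (\<Sum>m\<in>keys p. \<Sum>n\<in>keys q. single (m + n) (lookup p m * lookup q n))"
    by (simp add: sum_product mult_single)
  finally show ?thesis by (simp add: lookup_sum lookup_single)
qed

text \<open>Monomials in finitely many variables embed additively into \<^typ>\<open>nat \<Rightarrow>\<^sub>0 nat\<close>, which is
  linearly ordered, so the product of the leading terms survives.\<close>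

lemma SR_Pow_mult:
  fixes p q :: "('v, 'k::field) mpoly"
  assumes "finite V" "p \<in> polys V" "q \<in> polys V" "p * q \<in> SR V (Pow W)"
  shows "p \<in> SR V (Pow W) \<or> q \<in> SR V (Pow W)"
proof (rule ccontr)
  assume neg: "\<not> ?thesis"
  \<comment> \<open>The monomials that survive modulo the prime. Leading terms are taken among these
    only; any product of monomials supported in \<open>W\<close> has its factors here.\<close>
  define A where "A f = {m \<in> keys f. keys m \<subseteq> W}" for f :: "('v, 'k) mpoly"
  have ne: "A p \<noteq> {}" "A q \<noteq> {}" and fin: "finite (A f)" for f
    using neg assms by (auto simp: A_def monomial_ideal_def)
  obtain idx :: "'v \<Rightarrow> nat" where idx: "inj_on idx V"
    using finite_imp_inj_to_nat_seg[OF assms(1)] by blast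
  define \<phi> where "\<phi> m = (\<Sum>v\<in>V. single (idx v) (lookup m v))" for m :: "'v \<Rightarrow>\<^sub>0 nat"
  have \<phi>_add: "\<phi> (m + n) = \<phi> m + \<phi> n" for m n
    by (simp add: \<phi>_def lookup_add single_add sum.distrib)
  have \<phi>_lookup: "lookup (\<phi> m) (idx v) = lookup m v" if "v \<in> V" for m v
  proof -
    have "lookup (\<phi> m) (idx v) = (\<Sum>u\<in>V. if u = v then lookup m v else 0)"
      unfolding \<phi>_def lookup_sum lookup_single using idx that
      by (intro sum.cong) (auto simp: when_def inj_on_def)
    then show ?thesis using assms(1) that by simp
  qed
  have \<phi>_inj: "m = n" if "keys m \<subseteq> V" "keys n \<subseteq> V" "\<phi> m = \<phi> n" for m n
  proof (rule poly_mapping_eqI)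
    fix v show "lookup m v = lookup n v"
    proof (cases "v \<in> V")
      case True
      then show ?thesis using \<phi>_lookup[of v m] \<phi>_lookup[of v n] that(3) by simp
    next
      case False
      then have "v \<notin> keys m" "v \<notin> keys n" using that by auto
      then show ?thesis by (simp add: in_keys_iff)
    qed
  qed
  have top: "\<exists>a\<in>A f. \<forall>m\<in>A f. \<phi> m \<le> \<phi> a" if "A f \<noteq> {}" for f
  proof -
    have "Max (\<phi> ` A f) \<in> \<phi> ` A f" using that fin[of f] by (intro Max_in) auto
    moreover have "\<phi> m \<le> Max (\<phi> ` A f)" if "m \<in> A f" for m using that fin[of f] by simp
    ultimately show ?thesis by fastforce
  qed
  obtain a where a: "a \<in> A p" "\<And>m. m \<in> A p \<Longrightarrow> \<phi> m \<le> \<phi> a" using top[OF ne(1)] by blast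
  obtain b where b: "b \<in> A q" "\<And>m. m \<in> A q \<Longrightarrow> \<phi> m \<le> \<phi> b" using top[OF ne(2)] by blast
  have abW: "keys (a + b) \<subseteq> W" using a b by (simp add: A_def keys_nat_add)
  have unique: "m = a \<and> n = b" if mn: "m \<in> keys p" "n \<in> keys q" "m + n = a + b" for m n
  proof -
    have "keys m \<union> keys n \<subseteq> W" using abW mn(3) by (metis keys_nat_add)
    then have mA: "m \<in> A p" and nA: "n \<in> A q" using mn by (simp_all add: A_def)
    have le: "\<phi> m \<le> \<phi> a" "\<phi> n \<le> \<phi> b" using a(2)[OF mA] b(2)[OF nA] .
    have sum: "\<phi> m + \<phi> n = \<phi> a + \<phi> b" using mn(3) by (metis \<phi>_add)
    have "\<not> \<phi> m < \<phi> a" using add_less_le_mono[OF _ le(2), of "\<phi> m" "\<phi> a"] sum by auto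
    then have 1: "\<phi> m = \<phi> a" using le(1) by simp
    with sum have "\<phi> n = \<phi> b" by simp
    with 1 show ?thesis
      using \<phi>_inj mn(1,2) a(1) b(1) assms(2,3) unfolding A_def mem_polys by blast
  qed
  have "lookup (p * q) (a + b) =
      (\<Sum>m\<in>keys p. \<Sum>n\<in>keys q. if m = a \<and> n = b then lookup p a * lookup q b else 0)"
    unfolding lookup_sum_products using unique
    by (intro sum.cong refl) (auto simp: when_def)
  also have "\<dots> = (\<Sum>m\<in>keys p. if m = a then lookup p a * lookup q b else 0)"
    using b(1) by (intro sum.cong refl) (auto simp: A_def)
  also have "\<dots> \<noteq> 0" using a(1) b(1) by (simp add: A_def in_keys_iff)
  finally have "a + b \<in> keys (p * q)" by (simp add: in_keys_iff)
  with assms(4) abW show False by (auto simp: monomial_ideal_def)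
qed

lemma one_notin_SR: "{} \<in> \<Delta> \<Longrightarrow> 1 \<notin> SR V \<Delta>"
  by (simp add: monomial_ideal_def)

lemma primeideal_SR_Pow:
  assumes "finite V"
  shows "primeideal (SR V (Pow W)) (mpoly_ring V :: ('v, 'k::field) mpoly ring)"
  unfolding primeideal_mpoly_ring_iff
  using ideal_in_SR[OF subset_closed_Pow] one_notin_SR[of "Pow W" V] SR_Pow_mult[OF assms, of _ _ W]
  by blast

section \<open>Counting monomials\<close>

lemma total_degree_power_prod:
  fixes gs :: "('v, 'k::field) mpoly list"
  assumes "length es = length gs" "set es \<subseteq> {..D}"
    and "\<And>g m. g \<in> set gs \<Longrightarrow> m \<in> keys g \<Longrightarrow> total_degree m \<le> M"
    and "m \<in> keys (power_prod gs es)"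
  shows "total_degree m \<le> length gs * (D * M)"
proof -
  have mult_bound: "total_degree m \<le> a + b"
    if pq: "m \<in> keys (p * q)" "\<And>m. m \<in> keys p \<Longrightarrow> total_degree m \<le> a"
      "\<And>m. m \<in> keys q \<Longrightarrow> total_degree m \<le> b" for p q :: "('v, 'k) mpoly" and m a b
  proof -
    obtain x y where "m = x + y" "x \<in> keys p" "y \<in> keys q" using keys_mult[of p q] pq(1) by blast
    then show ?thesis using pq(2)[of x] pq(3)[of y] by (simp add: total_degree_add)
  qed
  have power_bound: "total_degree m \<le> n * M"
    if "m \<in> keys (g ^ n)" "\<And>m. m \<in> keys g \<Longrightarrow> total_degree m \<le> M"
    for g :: "('v, 'k) mpoly" and n m
    using that(1)
  proof (induction n arbitrary: m)
    case (Suc n)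
    then show ?case using mult_bound[of m g "g ^ n" M "n * M"] that(2) by simp
  qed simp
  show ?thesis
    using assms
  proof (induction gs arbitrary: es m)
    case (Cons g gs)
    then obtain e es' where es: "es = e # es'" "e \<le> D" "set es' \<subseteq> {..D}" "length es' = length gs"
      by (cases es) auto
    have "total_degree m \<le> D * M" if "m \<in> keys (g ^ e)" for m
      using order_trans[OF power_bound[OF that Cons.prems(3)[of g]] mult_le_mono1[OF es(2)]] by simp
    moreover have "total_degree m \<le> length gs * (D * M)" if "m \<in> keys (power_prod gs es')" for m
      using Cons.IH[OF es(4,3) _ that] Cons.prems(3) by (meson list.set_intros(2))
    moreover have "m \<in> keys (g ^ e * power_prod gs es')" using Cons.prems(4) es(1) by simp
    ultimately show ?case
      using mult_bound[of m "g ^ e" "power_prod gs es'" "D * M" "length gs * (D * M)"] by simp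
  qed simp
qed

text \<open>The exponents lie in a box with sides \<open>{..N}\<close> indexed by \<open>W\<close>.
  This crude count is enough, since only the power \<open>card W\<close> of \<open>Suc N\<close>
  matters for the comparison that follows.\<close>

lemma card_bounded_degree_monomials:
  assumes "finite W"
  shows "finite {m :: 'v \<Rightarrow>\<^sub>0 nat. keys m \<subseteq> W \<and> total_degree m \<le> N} \<and>
    card {m :: 'v \<Rightarrow>\<^sub>0 nat. keys m \<subseteq> W \<and> total_degree m \<le> N} \<le> Suc N ^ card W"
proof -
  let ?M = "{m :: 'v \<Rightarrow>\<^sub>0 nat. keys m \<subseteq> W \<and> total_degree m \<le> N}"
  let ?f = "\<lambda>m :: 'v \<Rightarrow>\<^sub>0 nat. restrict (lookup m) W"
  have inj: "inj_on ?f ?M"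
  proof (rule inj_onI, rule poly_mapping_eqI)
    fix m n v assume mn: "m \<in> ?M" "n \<in> ?M" "?f m = ?f n"
    show "lookup m v = lookup n v"
    proof (cases "v \<in> W")
      case True
      then show ?thesis using fun_cong[OF mn(3), of v] by simp
    next
      case False
      then have "v \<notin> keys m" "v \<notin> keys n" using mn by auto
      then show ?thesis by (simp add: in_keys_iff)
    qed
  qed
  have sub: "?f ` ?M \<subseteq> (\<Pi>\<^sub>E v\<in>W. {..N})"
    by (auto intro: order_trans[OF lookup_le_total_degree])
  have fin: "finite (\<Pi>\<^sub>E v\<in>W. {..N})" using assms by (intro finite_PiE) simp_all
  have "finite ?M" by (rule finite_imageD[OF finite_subset[OF sub fin] inj])
  moreover have "card ?M \<le> card (\<Pi>\<^sub>E v\<in>W. {..N})" by (rule card_inj_on_le[OF inj sub fin])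
  ultimately show ?thesis using assms by (simp add: card_PiE)
qed

text \<open>More polynomials than variables are algebraically dependent: the products of their powers up
  to exponent \<open>D\<close> outnumber, for large \<open>D\<close>, the monomials that occur in them.\<close>

lemma algebraic_dependence:
  fixes gs :: "('v, 'k::field) mpoly list"
  assumes "finite W" "card W < length gs" "set gs \<subseteq> polys V"
  obtains X c where "finite X" "\<And>e. e \<in> X \<Longrightarrow> length e = length gs" "\<exists>e\<in>X. c e \<noteq> 0"
    "(\<Sum>e\<in>X. single 0 (c e) * power_prod gs e) \<in> SR V (Pow W)"
proof -
  define r w where "r = length gs" and "w = card W"
  \<comment> \<open>The inserted 0 keeps the maximum meaningful when all elements of
    \<open>gs\<close> are zero.\<close>
  define M where "M = Max (insert 0 (total_degree ` (\<Union>g\<in>set gs. keys g)))"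
  have M: "total_degree m \<le> M" if "g \<in> set gs" "m \<in> keys g" for g m
    unfolding M_def using that by (intro Max_ge) auto
  \<comment> \<open>From \<open>Suc N \<le> Suc (r * M) * Suc D\<close> follows
    \<open>Suc N ^ w \<le> D * Suc D ^ w\<close>, with exactly this value of \<open>D\<close> as the
    constant factor, and this is below \<open>Suc D ^ Suc w\<close>, hence below the number of
    exponent lists.\<close>
  define D where "D = Suc (r * M) ^ w"
  define N where "N = r * (D * M)"
  define X where "X = {e. set e \<subseteq> {..D} \<and> length e = r}"
  define B where "B = {m :: 'v \<Rightarrow>\<^sub>0 nat. keys m \<subseteq> W \<and> total_degree m \<le> N}"
  have finX: "finite X" unfolding X_def by (rule finite_lists_length_eq) simp
  have finB: "finite B" and cardB: "card B \<le> Suc N ^ w"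
    using card_bounded_degree_monomials[OF assms(1)] unfolding B_def w_def by blast+
  have "Suc N \<le> Suc (r * M) * Suc D" by (simp add: N_def algebra_simps)
  then have "Suc N ^ w \<le> (Suc (r * M) * Suc D) ^ w" by (rule power_mono) simp
  also have "\<dots> = D * Suc D ^ w" unfolding D_def by (simp only: power_mult_distrib)
  also have "\<dots> < Suc D ^ Suc w" by simp
  also have "\<dots> \<le> Suc D ^ r" using assms(2) by (intro power_increasing) (simp_all add: r_def w_def)
  also have "\<dots> = card X" unfolding X_def by (simp add: card_lists_length_eq)
  finally have "card B < card X" using cardB by linarith
  then obtain c where c: "\<exists>e\<in>X. c e \<noteq> 0"
    and sys: "\<And>m. m \<in> B \<Longrightarrow> (\<Sum>e\<in>X. c e * lookup (power_prod gs e) m) = 0"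
    using homogeneous_system_solution[OF finB finX, of "\<lambda>e m. lookup (power_prod gs e) m"] by blast
  let ?p = "\<Sum>e\<in>X. single 0 (c e) * power_prod gs e"
  have "lookup ?p m = 0" if "keys m \<subseteq> W" for m
  proof -
    have eq: "lookup ?p m = (\<Sum>e\<in>X. c e * lookup (power_prod gs e) m)"
      unfolding lookup_sum using lookup_single_times[of 0 "c _" "power_prod gs _" m] by (intro sum.cong refl) simp
    show ?thesis
    proof (cases "total_degree m \<le> N")
      case True
      then show ?thesis using sys[of m] that unfolding eq by (simp add: B_def)
    next
      case False
      have "m \<notin> keys (power_prod gs e)" if "e \<in> X" for e
        using total_degree_power_prod[of e gs D M m] M that False by (auto simp: X_def N_def r_def)
      then show ?thesis unfolding eq by (simp add: in_keys_iff)
    qed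
  qed
  moreover have "?p \<in> polys V"
    using assms(3) by (intro polys.sum_closed polys.mult_closed polys.power_prod_closed single_in_polys) simp_all
  ultimately have "?p \<in> SR V (Pow W)"
    by (auto simp: monomial_ideal_def in_keys_iff)
  with finX c show thesis by (intro that[of X c]) (simp_all add: X_def r_def)
qed

text \<open>Covers two kinds of chains: primes, with \<open>gs ! i\<close> taken from the gap above
  \<open>A i\<close>, and colon ideals attached to a regular sequence. Only the bottom
  \<open>A 0\<close> has to be related to \<open>W\<close>.\<close>

lemma length_le_card_if_chain:
  fixes gs :: "('v, 'k::field) mpoly list"
  assumes "finite W" "set gs \<subseteq> polys V" "SR V (Pow W) \<subseteq> A 0"
    and "\<And>i. i \<le> length gs \<Longrightarrow> ideal_in (polys V) (A i)"
    and "\<And>i. i < length gs \<Longrightarrow> A i \<subseteq> A (Suc i)"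
    and "\<And>i. i < length gs \<Longrightarrow> nonzerodivisor_mod (polys V) (A i) (gs ! i)"
    and "\<And>i s. i < length gs \<Longrightarrow> s \<in> polys V \<Longrightarrow> gs ! i * s \<in> A (Suc i)"
    and "1 \<notin> A (length gs)"
  shows "length gs \<le> card W"
proof (rule ccontr)
  assume "\<not> ?thesis"
  then have "card W < length gs" by simp
  then obtain X c where X: "finite X" "\<And>e. e \<in> X \<Longrightarrow> length e = length gs" "\<exists>e\<in>X. c e \<noteq> 0"
    and rel: "(\<Sum>e\<in>X. single 0 (c e) * power_prod gs e) \<in> SR V (Pow W)"
    by (rule algebraic_dependence[OF assms(1) _ assms(2)]) blast
  have unit: "single 0 (inverse k) * single 0 k = (1 :: ('v, 'k) mpoly)" if "k \<noteq> 0" for k :: 'k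
    using that by (simp add: mult_single)
  have "1 \<in> A (length gs)"
  proof (rule polys.relation_imp_one_in_last[where X = X and c = "\<lambda>e. single 0 (c e)"])
    show "\<exists>e\<in>X. single 0 (c e) \<noteq> 0" using X(3) by (metis lookup_single_eq lookup_zero)
    show "single 0 (c e) \<in> polys V \<and> (\<exists>d\<in>polys V. d * single 0 (c e) = 1)"
      if "e \<in> X" "single 0 (c e) \<noteq> 0" for e
    proof
      have "c e \<noteq> 0" using that(2) by auto
      then show "\<exists>d\<in>polys V. d * single 0 (c e) = 1"
        using unit[of "c e"] single_in_polys[of 0 V] by (metis empty_subsetI keys_zero)
    qed (simp add: single_in_polys)
    show "(\<Sum>e\<in>X. single 0 (c e) * power_prod gs e) \<in> A 0" using rel assms(3) by blast
  qed (use X assms in simp_all)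
  with assms(8) show False by contradiction
qed

section \<open>Prime ideals of quotient rings and the dimension of coordinate primes\<close>

lemma carrier_FactRing_iff: "X \<in> carrier (R Quot I) \<longleftrightarrow> (\<exists>x\<in>carrier R. X = I +>\<^bsub>R\<^esub> x)"
  by (simp add: FactRing_def A_RCOSETS_def')

lemma (in cring) a_r_coset_in_image_iff:
  assumes "ideal I R" "ideal P R" "I \<subseteq> P" "x \<in> carrier R"
  shows "I +> x \<in> (+>) I ` P \<longleftrightarrow> x \<in> P"
proof
  interpret I: ideal I R by fact
  interpret P: ideal P R by fact
  assume "I +> x \<in> (+>) I ` P"
  then obtain s where s: "s \<in> P" "I +> x = I +> s" by blast
  then have "x \<ominus> s \<in> P"
    using quotient_eq_iff_same_a_r_cos[OF assms(1), of x s] assms P.Icarr by blast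
  then have "(x \<ominus> s) \<oplus> s \<in> P" using s by simp
  moreover have "(x \<ominus> s) \<oplus> s = x"
    using assms(4) P.Icarr[OF s(1)] by (simp add: a_minus_def a_assoc l_neg)
  ultimately show "x \<in> P" by simp
qed simp

lemma (in cring) primeideal_quotient_image:
  assumes "ideal I R" "primeideal P R" "I \<subseteq> P"
  shows "primeideal ((+>) I ` P) (R Quot I)"
proof -
  interpret I: ideal I R by fact
  interpret P: primeideal P R by fact
  interpret Q: cring "R Quot I" by (rule I.quotient_is_cring[OF is_cring])
  interpret h: ring_hom_ring R "R Quot I" "(+>) I" by (rule I.rcos_ring_hom_ring)
  have surj: "\<exists>x\<in>carrier R. X = I +> x" if "X \<in> carrier (R Quot I)" for X
    using that by (simp only: carrier_FactRing_iff)
  have mem: "I +> x \<in> (+>) I ` P \<longleftrightarrow> x \<in> P" if "x \<in> carrier R" for x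
    using a_r_coset_in_image_iff[OF assms(1) P.is_ideal assms(3) that] .
  have "ideal ((+>) I ` P) (R Quot I)"
  proof (rule idealI)
    show "subgroup ((+>) I ` P) (add_monoid (R Quot I))"
    proof (rule group.subgroupI[OF Q.a_group])
      fix X Y assume "X \<in> (+>) I ` P" "Y \<in> (+>) I ` P"
      then obtain x y where xy: "X = I +> x" "Y = I +> y" "x \<in> P" "y \<in> P" by blast
      have "X \<oplus>\<^bsub>R Quot I\<^esub> Y = I +> (x \<oplus> y)"
        using xy h.hom_add P.Icarr by simp
      then show "X \<otimes>\<^bsub>add_monoid (R Quot I)\<^esub> Y \<in> (+>) I ` P"
        using P.a_closed[OF xy(3,4)] by (simp only: monoid.simps imageI)
      have "\<ominus>\<^bsub>R Quot I\<^esub> X = I +> (\<ominus> x)"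
        using xy h.hom_a_inv P.Icarr by simp
      then show "inv\<^bsub>add_monoid (R Quot I)\<^esub> X \<in> (+>) I ` P"
        using P.a_inv_closed[OF xy(3)] unfolding a_inv_def[of "R Quot I"] by (simp only: imageI)
    next
      show "(+>) I ` P \<noteq> {}" using P.zero_closed by blast
    qed (use h.hom_closed P.Icarr in auto)
    fix X Y assume X: "X \<in> (+>) I ` P" "Y \<in> carrier (R Quot I)"
    then obtain x y where xy: "X = I +> x" "Y = I +> y" "x \<in> P" "y \<in> carrier R"
      using surj by blast
    have "Y \<otimes>\<^bsub>R Quot I\<^esub> X = I +> (y \<otimes> x)" "X \<otimes>\<^bsub>R Quot I\<^esub> Y = I +> (x \<otimes> y)"
      using xy h.hom_mult P.Icarr by simp_all
    then show "Y \<otimes>\<^bsub>R Quot I\<^esub> X \<in> (+>) I ` P" "X \<otimes>\<^bsub>R Quot I\<^esub> Y \<in> (+>) I ` P"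
      using P.I_l_closed[OF xy(3,4)] P.I_r_closed[OF xy(3,4)] by (simp_all only: imageI)
  qed (rule Q.ring_axioms)
  then show ?thesis
  proof (rule primeidealI[OF _ Q.is_cring])
    obtain z where "z \<in> carrier R" "z \<notin> P" using P.I_notcarr P.a_subset by blast
    then show "carrier (R Quot I) \<noteq> (+>) I ` P"
      using mem[of z] carrier_FactRing_iff[of "I +> z" R I] by blast
    fix X Y assume "X \<in> carrier (R Quot I)" "Y \<in> carrier (R Quot I)"
      and XY: "X \<otimes>\<^bsub>R Quot I\<^esub> Y \<in> (+>) I ` P"
    then obtain x y where xy: "X = I +> x" "Y = I +> y" "x \<in> carrier R" "y \<in> carrier R"
      using surj by blast
    then have "I +> (x \<otimes> y) \<in> (+>) I ` P" using XY h.hom_mult by simp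
    then have "x \<in> P \<or> y \<in> P" using mem[of "x \<otimes> y"] P.I_prime xy by simp
    then show "X \<in> (+>) I ` P \<or> Y \<in> (+>) I ` P" using xy by blast
  qed
qed

lemma mvar_in_SR_Pow_iff: "v \<in> V \<Longrightarrow> mvar v \<in> SR V (Pow U) \<longleftrightarrow> v \<notin> U"
  by (simp add: mvar_eq_mon monomial_ideal_def mon_in_polys)

lemma krull_dim_quot_SR_Pow:
  fixes V :: "'v set"
  assumes "finite V" "W \<subseteq> V"
  shows "krull_dim (mpoly_ring V Quot (SR V (Pow W) :: ('v, 'k::field) mpoly set)) = enat (card W)"
proof -
  let ?R = "mpoly_ring V :: ('v, 'k) mpoly ring" and ?I = "SR V (Pow W) :: ('v, 'k) mpoly set"
  interpret R: cring ?R by (rule cring_mpoly_ring)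
  interpret I: primeideal ?I ?R by (rule primeideal_SR_Pow[OF assms(1)])
  interpret Q: cring "?R Quot ?I" by (rule I.quotient_is_cring[OF R.is_cring])
  interpret h: ring_hom_ring ?R "?R Quot ?I" "\<lambda>x. ?I +>\<^bsub>?R\<^esub> x" by (rule I.rcos_ring_hom_ring)
  have finW: "finite W" using assms finite_subset by blast
  have upper: "n \<le> card W"
    if P: "\<forall>i\<le>n. primeideal (P i) (?R Quot ?I)" "\<forall>i<n. P i \<subset> P (Suc i)" for n P
  proof -
    define A where "A i = {x \<in> polys V. ?I +>\<^bsub>?R\<^esub> x \<in> P i}" for i
    have prime: "primeideal (A i) ?R" if "i \<le> n" for i
      unfolding A_def using P(1) that by (intro h.primeideal_vimage R.is_cring) simp
    \<comment> \<open>One element from every gap of the chain pulled back to the polynomial ring. It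
      is a nonzerodivisor modulo \<open>A i\<close> because \<open>A i\<close> is prime.\<close>
    have "\<exists>g. g \<in> A (Suc i) - A i" if i: "i < n" for i
    proof -
      obtain X where X: "X \<in> P (Suc i)" "X \<notin> P i" using P(2) i by blast
      have "X \<in> carrier (?R Quot ?I)"
        using ideal.Icarr[OF primeideal.axioms(1)[OF P(1)[rule_format]] X(1)] i by simp
      then obtain x where "x \<in> polys V" "X = ?I +>\<^bsub>?R\<^esub> x"
        by (auto simp only: carrier_FactRing_iff)
      then show ?thesis using X by (auto simp: A_def)
    qed
    then obtain g where g: "\<And>i. i < n \<Longrightarrow> g i \<in> A (Suc i) - A i" by metis
    let ?gs = "map g [0..<n]"
    have A_prime: "ideal_in (polys V) (A i)" "1 \<notin> A i"
      "\<And>a b. a \<in> polys V \<Longrightarrow> b \<in> polys V \<Longrightarrow> a * b \<in> A i \<Longrightarrow> a \<in> A i \<or> b \<in> A i"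
      if "i \<le> n" for i
      using prime[OF that] unfolding primeideal_mpoly_ring_iff by blast+
    have gV: "g i \<in> polys V" if "i < n" for i using g[OF that] by (simp add: A_def)
    have "length ?gs \<le> card W"
    proof (rule length_le_card_if_chain[OF finW, where A = A and V = V])
      show "set ?gs \<subseteq> polys V" using gV by auto
      show "?I \<subseteq> A 0"
      proof
        fix x assume x: "x \<in> ?I"
        have "ideal (P 0) (?R Quot ?I)" using P(1) primeideal.axioms(1) by blast
        then have "\<zero>\<^bsub>?R Quot ?I\<^esub> \<in> P 0"
          by (rule additive_subgroup.zero_closed[OF ideal.axioms(1)])
        moreover have "?I +>\<^bsub>?R\<^esub> x = \<zero>\<^bsub>?R Quot ?I\<^esub>"
          unfolding FactRing_def ring.simps by (rule I.a_rcos_const[OF x])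
        moreover have "x \<in> polys V" using x unfolding monomial_ideal_def by blast
        ultimately show "x \<in> A 0" unfolding A_def by (simp only: mem_Collect_eq)
      qed
      show "nonzerodivisor_mod (polys V) (A i) (?gs ! i)" if "i < length ?gs" for i
        using that g[of i] gV[of i] A_prime(3)[of i "g i"] by (auto simp: nonzerodivisor_mod_def)
      show "?gs ! i * s \<in> A (Suc i)" if "i < length ?gs" "s \<in> polys V" for i s
        using that g[of i] polys.ideal_in_mult_right[OF A_prime(1)[of "Suc i"]] by simp
      show "A i \<subseteq> A (Suc i)" if "i < length ?gs" for i using that P(2) by (auto simp: A_def)
    qed (simp_all add: A_prime)
    then show ?thesis by simp
  qed
  have lower: "\<exists>P. (\<forall>i\<le>card W. primeideal (P i) (?R Quot ?I)) \<and> (\<forall>i<card W. P i \<subset> P (Suc i))"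
  proof -
    obtain f where f: "bij_betw f {0..<card W} W" using ex_bij_betw_nat_finite[OF finW] by blast
    \<comment> \<open>The variables of \<open>W\<close> are killed one after the other;
      \<open>mvar (f i)\<close> separates two consecutive primes of the chain.\<close>
    define U where "U i = f ` {i..<card W}" for i
    define P where "P i = (\<lambda>x. ?I +>\<^bsub>?R\<^esub> x) ` (SR V (Pow (U i)) :: ('v, 'k) mpoly set)" for i
    have UW: "U i \<subseteq> W" for i
      using bij_betw_imp_surj_on[OF f] image_mono[of "{i..<card W}" "{0..<card W}" f]
      by (simp add: U_def)
    have sub: "?I \<subseteq> SR V (Pow (U i))" for i
      unfolding monomial_ideal_def using UW[of i] by blast
    have prime: "primeideal (SR V (Pow (U i))) ?R" for i by (rule primeideal_SR_Pow[OF assms(1)])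
    have "P i \<subset> P (Suc i)" if i: "i < card W" for i
    proof
      show "P i \<subseteq> P (Suc i)"
      proof -
        have "U (Suc i) \<subseteq> U i" unfolding U_def by (rule image_mono) simp
        then show ?thesis unfolding P_def monomial_ideal_def by (intro image_mono) blast
      qed
      have fiU: "f i \<in> U i" using i by (simp add: U_def)
      then have fi: "f i \<in> U i" "f i \<in> V" using UW[of i] assms(2) by blast+
      have "f i \<notin> U (Suc i)"
      proof
        assume "f i \<in> U (Suc i)"
        then obtain j where "f i = f j" "Suc i \<le> j" "j < card W" unfolding U_def by fastforce
        then show False using inj_onD[OF bij_betw_imp_inj_on[OF f], of i j] i by simp
      qed
      then have x: "mvar (f i) \<in> (SR V (Pow (U (Suc i))) :: ('v, 'k) mpoly set)"
        "mvar (f i) \<notin> (SR V (Pow (U i)) :: ('v, 'k) mpoly set)"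
        using fi(1) mvar_in_SR_Pow_iff[OF fi(2)] by metis+
      have "?I +>\<^bsub>?R\<^esub> mvar (f i) \<notin> P i"
        unfolding P_def
        using R.a_r_coset_in_image_iff[OF I.is_ideal primeideal.axioms(1)[OF prime] sub, of "mvar (f i)" i]
          x(2) mvar_in_mpoly_ring[OF fi(2)] by blast
      then show "P i \<noteq> P (Suc i)" using x(1) unfolding P_def by blast
    qed
    moreover have "primeideal (P i) (?R Quot ?I)" for i
      unfolding P_def by (rule R.primeideal_quotient_image[OF I.is_ideal prime sub])
    ultimately show ?thesis by blast
  qed
  show ?thesis
    unfolding krull_dim_def using upper lower
    by (intro antisym Sup_least Sup_upper) auto
qed


section \<open>Residue class modules\<close>

lemma independent_extends:
  assumes "simple_graph V E" "Y \<subseteq> V" "independent E Y"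
  obtains W where "Y \<subseteq> W" "maximal_independent V E W"
proof -
  have "finite (independence_complex V E)"
    using assms(1) by (auto simp: simple_graph_def independence_complex_def)
  moreover have "Y \<in> independence_complex V E" using assms(2,3) by (simp add: independence_complex_def)
  ultimately obtain W where W: "W \<in> independence_complex V E" "Y \<subseteq> W"
    "\<forall>X\<in>independence_complex V E. W \<subseteq> X \<longrightarrow> W = X"
    using finite_has_maximal2 by metis
  have "\<exists>w\<in>W. {u, w} \<in> E" if u: "u \<in> V - W" for u
  proof (rule ccontr)
    assume "\<not> ?thesis"
    then have "insert u W \<in> independence_complex V E"
      using W(1) u no_loop[OF assms(1), of u]
      by (auto simp: independence_complex_def independent_def insert_commute)
    then show False using W(3) u by blast
  qed
  then show thesis
    using W by (intro that[of W]) (auto simp: maximal_independent_def independence_complex_def)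
qed

lemma edge_ideal_eq_SR:
  assumes "simple_graph V E"
  shows "edge_ideal V E = (SR V (independence_complex V E) :: ('v, 'k::field) mpoly set)"
proof -
  have pair: "\<exists>u v. T = {u, v} \<and> u \<noteq> v \<and> u \<in> V \<and> v \<in> V" if "T \<in> E" for T
    using assms that unfolding simple_graph_def by blast
  have prod: "mvar u * mvar v = (mon {u, v} :: ('v, 'k) mpoly)" if "{u, v} \<in> E" for u v
    using edge_vertices(3)[OF assms that] by (simp add: mvar_eq_mon mon_Un insert_commute)
  have gens: "{mvar u * mvar v | u v. {u, v} \<in> E} = (mon ` E :: ('v, 'k) mpoly set)"
  proof (intro equalityI subsetI)
    fix p :: "('v, 'k) mpoly" assume "p \<in> mon ` E"
    then obtain T where T: "T \<in> E" "p = mon T" by blast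
    then obtain u v where "T = {u, v}" using pair by blast
    then show "p \<in> {mvar u * mvar v | u v. {u, v} \<in> E}" using T prod[of u v, symmetric] by blast
  qed (use prod in auto)
  have "edge_ideal V E = (monomial_ideal V (\<lambda>m. \<exists>T\<in>E. T \<subseteq> keys m) :: ('v, 'k) mpoly set)"
    unfolding edge_ideal_def gens
  proof (rule genideal_mon)
    fix T assume "T \<in> E"
    then show "finite T \<and> T \<subseteq> V" using pair by blast
  qed
  also have "\<dots> = SR V (independence_complex V E)"
  proof -
    have "(\<exists>T\<in>E. T \<subseteq> Y) \<longleftrightarrow> Y \<notin> independence_complex V E" if Y: "Y \<subseteq> V" for Y
    proof
      assume "\<exists>T\<in>E. T \<subseteq> Y"
      then obtain T where T: "T \<in> E" "T \<subseteq> Y" by blast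
      then obtain u v where "T = {u, v}" using pair[OF T(1)] by blast
      then have "{u, v} \<in> E" "u \<in> Y" "v \<in> Y" using T by auto
      then show "Y \<notin> independence_complex V E"
        by (auto simp: independence_complex_def independent_def)
    next
      assume "Y \<notin> independence_complex V E"
      then obtain u v where "{u, v} \<in> E" "u \<in> Y" "v \<in> Y"
        using Y unfolding independence_complex_def independent_def by blast
      then show "\<exists>T\<in>E. T \<subseteq> Y" by (intro bexI[of _ "{u, v}"]) simp_all
    qed
    then show ?thesis unfolding monomial_ideal_def mem_polys by blast
  qed
  finally show ?thesis .
qed

lemma irrelevant_ideal_eq_SR: "irrelevant_ideal V = (SR V {{}} :: ('v, 'k::field) mpoly set)"
proof -
  have "irrelevant_ideal V =
      (genideal (mpoly_ring V) (mon ` (\<lambda>v. {v}) ` V) :: ('v, 'k) mpoly set)"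
    unfolding irrelevant_ideal_def image_image mvar_eq_mon ..
  also have "\<dots> = monomial_ideal V (\<lambda>m. \<exists>T\<in>(\<lambda>v. {v}) ` V. T \<subseteq> keys m)"
    by (rule genideal_mon) auto
  also have "\<dots> = SR V {{}}"
  proof -
    have "(\<exists>T\<in>(\<lambda>v. {v}) ` V. T \<subseteq> Y) \<longleftrightarrow> Y \<notin> {{}}" if "Y \<subseteq> V" for Y
      using that by auto
    then show ?thesis unfolding monomial_ideal_def mem_polys by blast
  qed
  finally show ?thesis .
qed

section \<open>Annihilators and regular sequences of R/I expressed by ideals\<close>

context
  fixes V :: "'v set" and I :: "('v, 'k::field) mpoly set"
  assumes I: "ideal_in (polys V) I"
begin

lemma coset_eq_iff:
  assumes "x \<in> polys V" "y \<in> polys V"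
  shows "I +>\<^bsub>mpoly_ring V\<^esub> x = I +>\<^bsub>mpoly_ring V\<^esub> y \<longleftrightarrow> x - y \<in> I"
proof -
  have "ideal I (mpoly_ring V)" using I by (simp add: ideal_mpoly_ring_iff)
  from ring.quotient_eq_iff_same_a_r_cos[OF cring.axioms(1)[OF cring_mpoly_ring] this assms]
  show ?thesis using assms by (simp add: minus_mpoly_ring)
qed

lemma coset_in_image_iff:
  assumes "ideal_in (polys V) B" "I \<subseteq> B" "x \<in> polys V"
  shows "I +>\<^bsub>mpoly_ring V\<^esub> x \<in> (\<lambda>p. I +>\<^bsub>mpoly_ring V\<^esub> p) ` B \<longleftrightarrow> x \<in> B"
  using I assms
  by (intro cring.a_r_coset_in_image_iff[OF cring_mpoly_ring]) (simp_all only: ideal_mpoly_ring_iff)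

lemma quot_module_simps:
  "carrier (quot_module (mpoly_ring V) I) = (\<lambda>p. I +>\<^bsub>mpoly_ring V\<^esub> p) ` polys V"
  "\<zero>\<^bsub>quot_module (mpoly_ring V) I\<^esub> = I +>\<^bsub>mpoly_ring V\<^esub> 0"
  "x \<in> polys V \<Longrightarrow> y \<in> polys V \<Longrightarrow>
     (I +>\<^bsub>mpoly_ring V\<^esub> x) \<oplus>\<^bsub>quot_module (mpoly_ring V) I\<^esub> (I +>\<^bsub>mpoly_ring V\<^esub> y) =
     I +>\<^bsub>mpoly_ring V\<^esub> (x + y)"
  "x \<in> polys V \<Longrightarrow> y \<in> polys V \<Longrightarrow>
     x \<odot>\<^bsub>quot_module (mpoly_ring V) I\<^esub> (I +>\<^bsub>mpoly_ring V\<^esub> y) = I +>\<^bsub>mpoly_ring V\<^esub> (x * y)"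
proof -
  let ?R = "mpoly_ring V :: ('v, 'k) mpoly ring"
  have II: "ideal I ?R" using I by (simp add: ideal_mpoly_ring_iff)
  then have h: "(+>\<^bsub>?R\<^esub>) I \<in> ring_hom ?R (?R Quot I)" by (rule ideal.rcos_ring_hom)
  have sel: "carrier (quot_module ?R I) = carrier (?R Quot I)"
    "add (quot_module ?R I) = add (?R Quot I)" "zero (quot_module ?R I) = zero (?R Quot I)"
    "\<And>r X. r \<odot>\<^bsub>quot_module ?R I\<^esub> X = (I +>\<^bsub>?R\<^esub> r) \<otimes>\<^bsub>?R Quot I\<^esub> X"
    by (simp_all add: quot_module_def ring.defs module.defs FactRing_def)
  show "carrier (quot_module ?R I) = (\<lambda>p. I +>\<^bsub>?R\<^esub> p) ` polys V"
    unfolding sel using carrier_FactRing_iff[of _ ?R I] by blast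
  have "\<zero>\<^bsub>?R Quot I\<^esub> = I" by (simp add: FactRing_def)
  also have "\<dots> = I +>\<^bsub>?R\<^esub> 0"
    by (rule abelian_subgroup.a_rcos_const[OF abelian_subgroupI3, symmetric])
      (use II polys.ideal_in_zero[OF I] cring_mpoly_ring in
        \<open>auto intro: ideal.axioms(1) cring.axioms(1) ring.is_abelian_group\<close>)
  finally show "\<zero>\<^bsub>quot_module ?R I\<^esub> = I +>\<^bsub>?R\<^esub> 0" unfolding sel .
  assume "x \<in> polys V" "y \<in> polys V"
  then show "(I +>\<^bsub>?R\<^esub> x) \<oplus>\<^bsub>quot_module ?R I\<^esub> (I +>\<^bsub>?R\<^esub> y) = I +>\<^bsub>?R\<^esub> (x + y)"
    "x \<odot>\<^bsub>quot_module ?R I\<^esub> (I +>\<^bsub>?R\<^esub> y) = I +>\<^bsub>?R\<^esub> (x * y)"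
    unfolding sel using ring_hom_add[OF h, of x y] ring_hom_mult[OF h, of x y]
    by (simp_all only: mpoly_ring_simps(2,3))
qed

lemma annihilator_quot_module:
  assumes "x \<in> polys V"
  shows "annihilator (mpoly_ring V) (quot_module (mpoly_ring V) I) (I +>\<^bsub>mpoly_ring V\<^esub> x) =
    {r \<in> polys V. r * x \<in> I}"
proof -
  have "r \<odot>\<^bsub>quot_module (mpoly_ring V) I\<^esub> (I +>\<^bsub>mpoly_ring V\<^esub> x) =
      \<zero>\<^bsub>quot_module (mpoly_ring V) I\<^esub> \<longleftrightarrow> r * x \<in> I" if r: "r \<in> polys V" for r
    unfolding quot_module_simps(2) quot_module_simps(4)[OF r assms]
      coset_eq_iff[OF polys.mult_closed[OF r assms] polys.zero_closed] by simp
  then show ?thesis unfolding annihilator_def by blast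
qed

lemma mult_submodule_quot_module:
  assumes fs: "set fs \<subseteq> polys V"
  shows "mult_submodule (mpoly_ring V) (quot_module (mpoly_ring V) I) (set fs) =
    (\<lambda>p. I +>\<^bsub>mpoly_ring V\<^esub> p) ` foldl (adjoin (polys V)) I fs"
    (is "?M = ?q ` ?B")
proof
  let ?R = "mpoly_ring V :: ('v, 'k) mpoly ring"
  let ?N = "quot_module ?R I"
  have "ideal I ?R" using I by (simp add: ideal_mpoly_ring_iff)
  then interpret N: module ?R ?N by (rule module_quot_module[OF cring_mpoly_ring])
  have B: "ideal_in (polys V) ?B" by (rule polys.foldl_adjoin_ideal[OF I fs])
  have BV: "p \<in> polys V" if "p \<in> ?B" for p by (rule polys.ideal_in_subset[OF B that])
  have "submodule (?q ` ?B) ?R ?N"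
  proof (rule N.submoduleI)
    show "?q ` ?B \<subseteq> carrier ?N" using BV unfolding quot_module_simps by blast
    show "\<zero>\<^bsub>?N\<^esub> \<in> ?q ` ?B" using polys.ideal_in_zero[OF B] unfolding quot_module_simps by blast
  next
    fix X assume "X \<in> ?q ` ?B"
    then obtain x where x: "X = ?q x" "x \<in> ?B" by blast
    have xV: "x \<in> polys V" by (rule BV[OF x(2)])
    have "?q (- x) \<oplus>\<^bsub>?N\<^esub> ?q x = \<zero>\<^bsub>?N\<^esub>"
      unfolding quot_module_simps(2) quot_module_simps(3)[OF polys.uminus_closed[OF xV] xV]
      by (simp only: ab_group_add_class.ab_left_minus)
    moreover have "?q x \<in> carrier ?N" "?q (- x) \<in> carrier ?N"
      unfolding quot_module_simps(1) using xV polys.uminus_closed[OF xV] by blast+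
    ultimately have "\<ominus>\<^bsub>?N\<^esub> ?q x = ?q (- x)" by (intro N.minus_equality)
    then show "\<ominus>\<^bsub>?N\<^esub> X \<in> ?q ` ?B"
      unfolding x(1) using polys.ideal_in_uminus[OF B x(2)] by blast
  next
    fix X Y assume "X \<in> ?q ` ?B" "Y \<in> ?q ` ?B"
    then obtain x y where xy: "X = ?q x" "Y = ?q y" "x \<in> ?B" "y \<in> ?B" by blast
    show "X \<oplus>\<^bsub>?N\<^esub> Y \<in> ?q ` ?B"
      unfolding xy(1,2) quot_module_simps(3)[OF BV[OF xy(3)] BV[OF xy(4)]]
      by (rule imageI) (rule polys.ideal_in_add[OF B xy(3,4)])
  next
    fix r X assume r: "r \<in> carrier ?R" and "X \<in> ?q ` ?B"
    then obtain x where x: "X = ?q x" "x \<in> ?B" by blast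
    show "r \<odot>\<^bsub>?N\<^esub> X \<in> ?q ` ?B"
      unfolding x(1) quot_module_simps(4)[OF r BV[OF x(2)]]
      by (rule imageI) (rule polys.ideal_in_mult[OF B r x(2)])
  qed
  moreover have "f \<odot>\<^bsub>?N\<^esub> X \<in> ?q ` ?B" if f: "f \<in> set fs" and X: "X \<in> carrier ?N" for f X
  proof -
    obtain x where x: "X = ?q x" "x \<in> polys V" using X unfolding quot_module_simps by blast
    have fV: "f \<in> polys V" and fB: "f \<in> ?B"
      using f fs polys.generators_in_foldl_adjoin[OF I fs] by blast+
    show ?thesis
      unfolding x(1) quot_module_simps(4)[OF fV x(2)]
      by (rule imageI) (rule polys.ideal_in_mult_right[OF B x(2) fB])
  qed
  ultimately show "?M \<subseteq> ?q ` ?B" unfolding mult_submodule_def by blast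
  show "?q ` ?B \<subseteq> ?M"
    unfolding mult_submodule_def
  proof (intro Inter_greatest)
    fix H assume "H \<in> {H. submodule H ?R ?N \<and> (\<forall>f\<in>set fs. \<forall>x\<in>carrier ?N. f \<odot>\<^bsub>?N\<^esub> x \<in> H)}"
    then have H: "submodule H ?R ?N" and fH: "\<And>f x. f \<in> set fs \<Longrightarrow> x \<in> carrier ?N \<Longrightarrow> f \<odot>\<^bsub>?N\<^esub> x \<in> H"
      by blast+
    \<comment> \<open>The preimage of a competing submodule is an ideal containing \<open>I\<close>
      and \<open>fs\<close>, hence contains the ideal that they generate.\<close>
    define B' where "B' = {p \<in> polys V. ?q p \<in> H}"
    have B'I: "p \<in> B'" if "p \<in> polys V" "?q p \<in> H" for p using that unfolding B'_def by blast
    have B'D: "p \<in> polys V" "?q p \<in> H" if "p \<in> B'" for p using that unfolding B'_def by blast+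
    have "\<zero>\<^bsub>?N\<^esub> \<in> H"
      using subgroup.one_closed[OF submodule.axioms(1)[OF H]] by simp
    then have q0: "?q 0 \<in> H" unfolding quot_module_simps .
    have B': "ideal_in (polys V) B'"
      unfolding ideal_in_def
    proof (intro conjI ballI)
      show "B' \<subseteq> polys V" using B'D by blast
      show "0 \<in> B'" by (rule B'I[OF polys.zero_closed q0])
    next
      fix a b assume ab: "a \<in> B'" "b \<in> B'"
      note a = B'D[OF ab(1)] and b = B'D[OF ab(2)]
      show "a + b \<in> B'"
        using N.submoduleE(5)[OF H a(2) b(2)]
        unfolding quot_module_simps(3)[OF a(1) b(1)] by (rule B'I[OF polys.add_closed[OF a(1) b(1)]])
    next
      fix s a :: "('v, 'k) mpoly" assume s: "s \<in> polys V" and "a \<in> B'"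
      note a = B'D[OF \<open>a \<in> B'\<close>]
      show "s * a \<in> B'"
        using N.submoduleE(4)[OF H s a(2)]
        unfolding quot_module_simps(4)[OF s a(1)] by (rule B'I[OF polys.mult_closed[OF s a(1)]])
    qed
    have "?B \<subseteq> B'"
    proof (rule polys.foldl_adjoin_least[OF B'])
      show "I \<subseteq> B'"
      proof
        fix x assume x: "x \<in> I"
        have xV: "x \<in> polys V" by (rule polys.ideal_in_subset[OF I x])
        then have "?q x = ?q 0" using coset_eq_iff[OF xV polys.zero_closed] x by simp
        with q0 have "?q x \<in> H" by (simp only:)
        with xV show "x \<in> B'" by (rule B'I)
      qed
      show "set fs \<subseteq> B'"
      proof
        fix f assume f: "f \<in> set fs"
        have fV: "f \<in> polys V" using f fs by blast
        have "?q 1 \<in> carrier ?N" unfolding quot_module_simps(1) by (rule imageI) (rule polys.one_closed)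
        from fH[OF f this] have "?q f \<in> H"
          unfolding quot_module_simps(4)[OF fV polys.one_closed] by (simp only: mult_1_right)
        with fV show "f \<in> B'" by (rule B'I)
      qed
    qed
    then show "?q ` ?B \<subseteq> H" unfolding B'_def by blast
  qed
qed

text \<open>Every ideal involved contains \<open>I\<close>, so membership of cosets can be tested on
  representatives. The quotient module is nonzero precisely when 1 stays outside the generated
  ideal.\<close>

lemma regular_sequence_quot_module_iff:
  "regular_sequence (mpoly_ring V) (quot_module (mpoly_ring V) I) fs \<longleftrightarrow>
     set fs \<subseteq> polys V \<and> weakly_regular (polys V) I fs \<and>
     1 \<notin> foldl (adjoin (polys V)) I fs"
proof (cases "set fs \<subseteq> polys V")
  case True
  let ?R = "mpoly_ring V :: ('v, 'k) mpoly ring"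
  let ?N = "quot_module ?R I" and ?q = "\<lambda>p. I +>\<^bsub>mpoly_ring V\<^esub> p"
  have part: "set (take i fs) \<subseteq> polys V" for i by (rule subset_trans[OF set_take_subset True])
  have mem: "?q x \<in> mult_submodule ?R ?N (set (take i fs)) \<longleftrightarrow> x \<in> foldl (adjoin (polys V)) I (take i fs)"
    if "x \<in> polys V" for x i
    unfolding mult_submodule_quot_module[OF part]
    by (rule coset_in_image_iff[OF polys.foldl_adjoin_ideal[OF I part] polys.subset_foldl_adjoin that])
  have "(\<forall>x\<in>carrier ?N. fs ! i \<odot>\<^bsub>?N\<^esub> x \<in> mult_submodule ?R ?N (set (take i fs)) \<longrightarrow>
          x \<in> mult_submodule ?R ?N (set (take i fs))) \<longleftrightarrow>
        nonzerodivisor_mod (polys V) (foldl (adjoin (polys V)) I (take i fs)) (fs ! i)"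
    if i: "i < length fs" for i
  proof -
    have fi: "fs ! i \<in> polys V" using True nth_mem[OF i] by blast
    show ?thesis
      unfolding quot_module_simps(1) ball_simps nonzerodivisor_mod_def
      by (rule ball_cong[OF refl])
        (simp only: quot_module_simps(4)[OF fi] mem polys.mult_closed[OF fi])
  qed
  moreover have "mult_submodule ?R ?N (set fs) \<noteq> carrier ?N \<longleftrightarrow> 1 \<notin> foldl (adjoin (polys V)) I fs"
  proof -
    let ?B = "foldl (adjoin (polys V)) I fs"
    have B: "ideal_in (polys V) ?B" by (rule polys.foldl_adjoin_ideal[OF I True])
    have "?q ` ?B = ?q ` polys V \<longleftrightarrow> 1 \<in> ?B"
    proof
      assume "?q ` ?B = ?q ` polys V"
      then have "?q 1 \<in> ?q ` ?B" using polys.one_closed by blast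
      then show "1 \<in> ?B"
        by (rule iffD1[OF coset_in_image_iff[OF B polys.subset_foldl_adjoin polys.one_closed]])
    next
      assume "1 \<in> ?B"
      then have "x \<in> ?B" if "x \<in> polys V" for x
        using polys.ideal_in_mult[OF B that, of 1] by simp
      then have "?B = polys V" using polys.ideal_in_subset[OF B] by blast
      then show "?q ` ?B = ?q ` polys V" by (rule arg_cong)
    qed
    then show ?thesis unfolding mult_submodule_quot_module[OF True] quot_module_simps(1) by blast
  qed
  ultimately show ?thesis
    unfolding regular_sequence_def weakly_regular_iff using True by blast
qed (simp add: regular_sequence_def)

end


section \<open>Associated primes and depth of the edge ideal\<close>

lemma maximal_independent_union:
  assumes "maximal_independent V E W" "W \<union> Y \<in> independence_complex V E"
  shows "Y \<subseteq> W"
  using assms unfolding maximal_independent_def independence_complex_def independent_def by blast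

text \<open>The star of a facet is the full simplex on it. Hence \<open>mon W\<close> witnesses an
  associated prime, and the same colon later compares the edge ideal with the prime of
  \<open>W\<close> in the bound on depth.\<close>

lemma colon_SR_maximal:
  assumes "finite V" "maximal_independent V E W"
  shows "colon (polys V) (SR V (independence_complex V E)) (mon W) =
    (SR V (Pow W) :: ('v, 'k::field) mpoly set)"
proof -
  have W: "W \<subseteq> V" "W \<in> independence_complex V E"
    using assms(2) by (auto simp: maximal_independent_def independence_complex_def)
  have "{Y. W \<union> Y \<in> independence_complex V E} = Pow W"
  proof (intro equalityI subsetI)
    fix Y assume "Y \<in> Pow W"
    then have "W \<union> Y = W" by blast
    then show "Y \<in> {Y. W \<union> Y \<in> independence_complex V E}" using W(2) by simp
  qed (use maximal_independent_union[OF assms(2)] in auto)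
  then show ?thesis
    by (simp only: colon_SR[OF finite_subset[OF W(1) assms(1)] W(1)])
qed

text \<open>The facets of the complex are the maximal independent sets, and every face extends to
  one of them. This is the prime decomposition from which the associated primes are read
  off.\<close>

lemma SR_independence_complex_eq_Inter:
  assumes "simple_graph V E"
  shows "p \<in> SR V (independence_complex V E) \<longleftrightarrow>
    p \<in> polys V \<and> (\<forall>W. maximal_independent V E W \<longrightarrow> p \<in> SR V (Pow W))"
proof -
  have "Y \<in> independence_complex V E \<longleftrightarrow> (\<exists>W. maximal_independent V E W \<and> Y \<subseteq> W)" for Y
  proof
    assume "Y \<in> independence_complex V E"
    then have "Y \<subseteq> V" "independent E Y" by (simp_all add: independence_complex_def)
    then show "\<exists>W. maximal_independent V E W \<and> Y \<subseteq> W"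
      by (rule independent_extends[OF assms]) blast
  next
    assume "\<exists>W. maximal_independent V E W \<and> Y \<subseteq> W"
    then show "Y \<in> independence_complex V E"
      unfolding maximal_independent_def independence_complex_def independent_def by blast
  qed
  then show ?thesis unfolding monomial_ideal_def by blast
qed

text \<open>The edge ideal is the intersection of the primes \<open>SR V (Pow W)\<close>, so the annihilator of a
  class \<open>p\<close> is the intersection of those not containing \<open>p\<close>; being prime, it is one of them.\<close>

lemma Ass_edge_module:
  fixes V :: "'v set"
  assumes G: "simple_graph V E"
  shows "Ass (mpoly_ring V) (edge_module V E) =
    {SR V (Pow W) :: ('v, 'k::field) mpoly set | W. maximal_independent V E W}"
proof
  let ?R = "mpoly_ring V :: ('v, 'k) mpoly ring"
  let ?I = "SR V (independence_complex V E) :: ('v, 'k) mpoly set"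
  have I: "ideal_in (polys V) ?I" by (rule ideal_in_SR[OF subset_closed_independence_complex])
  have finV: "finite V" using G by (simp add: simple_graph_def)
  have N: "edge_module V E = quot_module ?R ?I"
    unfolding edge_module_def edge_ideal_eq_SR[OF G] ..
  have carrier: "carrier (quot_module ?R ?I) = (\<lambda>p. ?I +>\<^bsub>?R\<^esub> p) ` polys V"
    by (rule quot_module_simps(1)[OF I])
  show "Ass ?R (edge_module V E) \<subseteq> {SR V (Pow W) | W. maximal_independent V E W}"
  proof
    fix P assume "P \<in> Ass ?R (edge_module V E)"
    then obtain p where P: "primeideal P ?R" and p: "p \<in> polys V"
      and Pann: "P = annihilator ?R (quot_module ?R ?I) (?I +>\<^bsub>?R\<^esub> p)"
      unfolding Ass_def N carrier by blast
    have P_eq: "P = {r \<in> polys V. r * p \<in> ?I}"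
      unfolding Pann by (rule annihilator_quot_module[OF I p])
    have one: "1 \<notin> P" and P_prime: "\<And>a b. a \<in> polys V \<Longrightarrow> b \<in> polys V \<Longrightarrow> a * b \<in> P \<Longrightarrow> a \<in> P \<or> b \<in> P"
      using P unfolding primeideal_mpoly_ring_iff by blast+
    show "P \<in> {SR V (Pow W) | W. maximal_independent V E W}"
    proof (rule ccontr)
      assume neq: "P \<notin> {SR V (Pow W) | W. maximal_independent V E W}"
      define M where "M = {W. maximal_independent V E W}"
      have "M \<subseteq> Pow V" by (auto simp: M_def maximal_independent_def)
      then have finM: "finite M" using finV finite_subset by blast
      have PI: "ideal_in (polys V) (SR V (Pow W) :: ('v, 'k) mpoly set)" for W
        by (rule ideal_in_SR[OF subset_closed_Pow])
      \<comment> \<open>Each \<open>W\<close> receives a multiplier outside \<open>P\<close> that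
        moves \<open>p\<close> into the prime of \<open>W\<close>: 1 if \<open>p\<close> is already
        there, otherwise an element of that prime outside the strictly smaller \<open>P\<close>. The
        product of all multipliers annihilates the class of \<open>p\<close>, although
        \<open>P\<close> is prime and contains none of them.\<close>
      have "\<exists>r. r \<in> polys V \<and> r \<notin> P \<and> r * p \<in> SR V (Pow W)" if W: "W \<in> M" for W
      proof (cases "p \<in> SR V (Pow W)")
        case True
        with one show ?thesis by (intro exI[of _ 1] conjI polys.one_closed) simp_all
      next
        case False
        have "P \<subseteq> SR V (Pow W)"
        proof
          fix r assume "r \<in> P"
          then have r: "r \<in> polys V" "r * p \<in> ?I" unfolding P_eq by blast+
          have "r * p \<in> SR V (Pow W)"
            using r(2) W unfolding SR_independence_complex_eq_Inter[OF G] M_def by blast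
          then show "r \<in> SR V (Pow W)" using SR_Pow_mult[OF finV r(1) p] False by blast
        qed
        moreover have "P \<noteq> SR V (Pow W)" using neq W unfolding M_def by blast
        ultimately obtain r where r: "r \<in> SR V (Pow W)" "r \<notin> P" by blast
        show ?thesis
          using r polys.ideal_in_subset[OF PI r(1)] polys.ideal_in_mult_right[OF PI p r(1)] by blast
      qed
      then obtain r where r: "\<And>W. W \<in> M \<Longrightarrow> r W \<in> polys V \<and> r W \<notin> P \<and> r W * p \<in> SR V (Pow W)"
        by metis
      have rX: "prod r X \<in> polys V" if "X \<subseteq> M" for X using that r by (intro polys.prod_closed) blast
      have "prod r X \<notin> P" if "finite X" "X \<subseteq> M" for X
        using that
      proof (induction X rule: finite_induct)
        case empty
        show ?case using one by simp
      next
        case (insert W X)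
        have "r W * prod r X \<notin> P"
          using P_prime[of "r W" "prod r X"] rX[of X] r[of W] insert by blast
        then show ?case using insert.hyps by simp
      qed
      then have "prod r M \<notin> P" using finM by blast
      moreover have "prod r M \<in> P"
      proof -
        have "prod r M * p \<in> SR V (Pow W)" if W: "W \<in> M" for W
        proof -
          have "prod r M * p = prod r (M - {W}) * (r W * p)"
            using prod.remove[OF finM W, of r] by (simp add: mult_ac)
          also have "\<dots> \<in> SR V (Pow W)"
            by (rule polys.ideal_in_mult[OF PI]) (use r[OF W] rX[of "M - {W}"] in blast)+
          finally show ?thesis .
        qed
        then have "prod r M * p \<in> ?I"
          using polys.mult_closed[OF rX[OF order_refl] p]
          unfolding SR_independence_complex_eq_Inter[OF G] M_def by blast
        with rX[OF order_refl] show ?thesis unfolding P_eq by blast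
      qed
      ultimately show False by blast
    qed
  qed
  show "{SR V (Pow W) | W. maximal_independent V E W} \<subseteq> Ass ?R (edge_module V E)"
  proof
    fix P :: "('v, 'k) mpoly set"
    assume "P \<in> {SR V (Pow W) | W. maximal_independent V E W}"
    then obtain W where W: "P = SR V (Pow W)" "maximal_independent V E W" by blast
    have "W \<subseteq> V" using W(2) by (simp add: maximal_independent_def)
    then have u: "mon W \<in> polys V" using finite_subset[OF _ finV] by (intro mon_in_polys)
    have "annihilator ?R (quot_module ?R ?I) (?I +>\<^bsub>?R\<^esub> mon W) = {r \<in> polys V. r * mon W \<in> ?I}"
      by (rule annihilator_quot_module[OF I u])
    also have "\<dots> = colon (polys V) ?I (mon W)" by (simp only: colon_def mult.commute)
    also have "\<dots> = P" unfolding W(1) by (rule colon_SR_maximal[OF finV W(2)])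
    finally have ann: "P = annihilator ?R (quot_module ?R ?I) (?I +>\<^bsub>?R\<^esub> mon W)" by (rule sym)
    have P: "primeideal P ?R" unfolding W(1) by (rule primeideal_SR_Pow[OF finV])
    show "P \<in> Ass ?R (edge_module V E)"
      unfolding Ass_def N carrier
      by (intro CollectI conjI bexI[of _ "?I +>\<^bsub>?R\<^esub> mon W"]) (fact P, fact ann, fact imageI[OF u])
  qed
qed

lemma edge_indim_eq:
  fixes V :: "'v set"
  assumes "simple_graph V E"
  shows "edge_indim TYPE('k::field) V E = Inf {enat (card W) | W. maximal_independent V E W}"
proof -
  have dim: "krull_dim (mpoly_ring V Quot (SR V (Pow W) :: ('v, 'k) mpoly set)) = enat (card W)"
    if "maximal_independent V E W" for W
    using assms that by (intro krull_dim_quot_SR_Pow) (simp_all add: simple_graph_def maximal_independent_def)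
  have "{krull_dim (mpoly_ring V Quot P) | P.
        P \<in> {SR V (Pow W) :: ('v, 'k) mpoly set | W. maximal_independent V E W}} =
      {enat (card W) | W. maximal_independent V E W}" (is "?L = ?R")
  proof (intro equalityI subsetI)
    fix n assume "n \<in> ?L"
    then obtain W where "maximal_independent V E W"
      "n = krull_dim (mpoly_ring V Quot (SR V (Pow W) :: ('v, 'k) mpoly set))" by blast
    then show "n \<in> ?R" using dim by blast
  next
    fix n assume "n \<in> ?R"
    then obtain W where "maximal_independent V E W" "n = enat (card W)" by blast
    then show "n \<in> ?L" using dim[of W] by (metis (mono_tags, lifting) mem_Collect_eq)
  qed
  then show ?thesis
    unfolding edge_indim_def indim_def Ass_edge_module[OF assms] by (simp only:)
qed

section \<open>Depth bounds and their agreement for chordal graphs\<close>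

lemma total_degree_power_ge:
  fixes f :: "('v, 'k::field) mpoly"
  assumes "f \<in> SR V {{}}" "m \<in> keys (f ^ n)"
  shows "n \<le> total_degree m"
  using assms(2)
proof (induction n arbitrary: m)
  case (Suc n)
  then obtain a b where ab: "m = a + b" "a \<in> keys f" "b \<in> keys (f ^ n)"
    using keys_mult[of f "f ^ n"] by auto
  have "keys a \<noteq> {}" using assms(1) ab(2) by (auto simp: monomial_ideal_def)
  then obtain v where "v \<in> keys a" by blast
  then have "lookup a v \<noteq> 0" by (simp add: in_keys_iff)
  then have "1 \<le> total_degree a" using lookup_le_total_degree[of a v] by linarith
  then show ?case using Suc.IH[OF ab(3)] unfolding ab(1) total_degree_add by simp
qed simp

text \<open>If the sequence were longer than \<open>card W\<close>, algebraic dependence modulo the annihilator of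
  \<open>mon W\<close> would put \<open>mon W\<close> into the ideal generated by the sequence.  Applied to high powers of
  the sequence this is impossible for degree reasons.\<close>

lemma weakly_regular_length_le:
  fixes fs :: "('v, 'k::field) mpoly list"
  assumes G: "simple_graph V E" and W: "maximal_independent V E W"
    and fs: "set fs \<subseteq> SR V {{}}"
    and reg: "weakly_regular (polys V) (SR V (independence_complex V E)) fs"
  shows "length fs \<le> card W"
proof -
  let ?I = "SR V (independence_complex V E) :: ('v, 'k) mpoly set"
  have finV: "finite V" using G by (simp add: simple_graph_def)
  have WV: "W \<subseteq> V" and WI: "W \<in> independence_complex V E"
    using W by (auto simp: maximal_independent_def independence_complex_def)
  have finW: "finite W" using WV finV by (rule finite_subset)
  have I: "ideal_in (polys V) ?I" by (rule ideal_in_SR[OF subset_closed_independence_complex])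
  have fsV: "set fs \<subseteq> polys V" using fs unfolding monomial_ideal_def by blast
  have u: "mon W \<in> (polys V :: ('v, 'k) mpoly set)" by (rule mon_in_polys[OF finW WV])
  \<comment> \<open>One more than the degree of \<open>mon W\<close>, so that no element of
    \<open>gs\<close> has a monomial of that degree.\<close>
  define n where "n = Suc (card W)"
  define gs where "gs = map (\<lambda>f. f ^ n) fs"
  have gsV: "set gs \<subseteq> polys V"
    unfolding gs_def set_map using fsV polys.power_closed by blast
  have gs_reg: "weakly_regular (polys V) ?I gs"
    unfolding gs_def n_def by (rule polys.weakly_regular_powers[OF I fsV reg])
  define B where "B i = foldl (adjoin (polys V)) ?I (take i gs)" for i
  have takeV: "set (take i gs) \<subseteq> polys V" for i by (rule subset_trans[OF set_take_subset gsV])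
  have B: "ideal_in (polys V) (B i)" for i
    unfolding B_def by (rule polys.foldl_adjoin_ideal[OF I takeV])
  have B_Suc: "B (Suc i) = adjoin (polys V) (B i) (gs ! i)" if "i < length gs" for i
    unfolding B_def take_Suc_conv_app_nth[OF that] foldl_append by simp
  \<comment> \<open>The colon by \<open>mon W\<close> replaces the edge ideal at the bottom by the
    prime of \<open>W\<close>, while each \<open>gs ! i\<close> remains a nonzerodivisor. Thus
    \<open>card W\<close> limits the length although the sequence is regular on R/I only.\<close>
  define A where "A i = colon (polys V) (B i) (mon W)" for i
  have A_iff: "x \<in> A i \<longleftrightarrow> x \<in> polys V \<and> mon W * x \<in> B i" for x i
    unfolding A_def colon_def by blast
  have gV: "gs ! i \<in> polys V" if "i < length gs" for i using gsV nth_mem[OF that] by blast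
  have "length gs \<le> card W"
  proof (rule length_le_card_if_chain[OF finW gsV, where A = A])
    show "SR V (Pow W) \<subseteq> A 0"
      unfolding A_def B_def take_0 foldl_Nil colon_SR_maximal[OF finV W] by (rule order_refl)
    show "ideal_in (polys V) (A i)" for i unfolding A_def by (rule polys.ideal_in_colon[OF B])
    show "A i \<subseteq> A (Suc i)" if "i < length gs" for i
      unfolding A_def colon_def B_Suc[OF that] using polys.subset_adjoin by blast
    show "nonzerodivisor_mod (polys V) (A i) (gs ! i)" if i: "i < length gs" for i
      unfolding nonzerodivisor_mod_def
    proof (intro ballI impI)
      fix x assume x: "x \<in> polys V" "gs ! i * x \<in> A i"
      then have "gs ! i * (mon W * x) \<in> B i" unfolding A_iff by (simp only: mult.left_commute)
      moreover have "nonzerodivisor_mod (polys V) (B i) (gs ! i)"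
        using gs_reg i unfolding weakly_regular_iff B_def by blast
      ultimately have "mon W * x \<in> B i"
        using nonzerodivisor_modD polys.mult_closed[OF u x(1)] by blast
      with x(1) show "x \<in> A i" unfolding A_iff by blast
    qed
    show "gs ! i * s \<in> A (Suc i)" if "i < length gs" "s \<in> polys V" for i s
    proof -
      have "gs ! i * (mon W * s) \<in> B (Suc i)"
        unfolding B_Suc[OF that(1)]
        by (rule polys.multiple_in_adjoin[OF B polys.mult_closed[OF u that(2)]])
      then show ?thesis
        using polys.mult_closed[OF gV[OF that(1)] that(2)] unfolding A_iff by (simp only: mult.left_commute simp_thms)
    qed
    \<comment> \<open>\<open>T\<close> adds all monomials of degree at least \<open>n\<close> to the
      edge ideal. It contains \<open>gs\<close>, but not \<open>mon W\<close>, whose support is a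
      face and whose degree is \<open>n - 1\<close>.\<close>
    define T where "T = (monomial_ideal V
      (\<lambda>m. keys m \<notin> independence_complex V E \<or> n \<le> total_degree m) :: ('v, 'k) mpoly set)"
    have T: "ideal_in (polys V) T"
      unfolding T_def
    proof (rule ideal_in_monomial_ideal)
      fix m m' :: "'v \<Rightarrow>\<^sub>0 nat"
      assume "keys m \<notin> independence_complex V E \<or> n \<le> total_degree m"
      then show "keys (m' + m) \<notin> independence_complex V E \<or> n \<le> total_degree (m' + m)"
        using subset_closed_independence_complex[of V E]
        by (auto simp: keys_nat_add total_degree_add subset_closed_def)
    qed
    have "B (length gs) \<subseteq> T"
      unfolding B_def
    proof (rule polys.foldl_adjoin_least[OF T])
      show "?I \<subseteq> T" unfolding T_def monomial_ideal_def by blast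
      have "f ^ n \<in> T" if f: "f \<in> set fs" for f
      proof -
        have "f \<in> SR V {{}}" "f \<in> polys V" using f fs fsV by blast+
        then show ?thesis
          using total_degree_power_ge[of f V] polys.power_closed[of f V n]
          unfolding T_def monomial_ideal_def by blast
      qed
      then show "set (take (length gs) gs) \<subseteq> T" by (auto simp: gs_def)
    qed
    moreover have "mon W \<notin> T"
      using finW WI by (simp add: T_def monomial_ideal_def n_def)
    ultimately show "1 \<notin> A (length gs)" by (auto simp: A_iff)
  qed
  then show ?thesis by (simp add: gs_def)
qed

text \<open>The two assumptions on \<open>W\<close> have different tasks: minimality of its size
  makes the first \<open>card W\<close> elementary symmetric polynomials weakly regular, and maximal
  independence bounds the length of any regular sequence in the irrelevant ideal.\<close>

lemma chordal_depth_indim: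
  fixes V :: "'v set"
  assumes G: "simple_graph V E" "chordal V E"
    and W: "maximal_independent V E W" "\<And>X. maximal_independent V E X \<Longrightarrow> card W \<le> card X"
  shows "edge_depth TYPE('k::field) V E = enat (card W)"
    and "edge_indim TYPE('k) V E = enat (card W)"
proof -
  let ?R = "mpoly_ring V :: ('v, 'k) mpoly ring"
  let ?I = "SR V (independence_complex V E) :: ('v, 'k) mpoly set"
  have finV: "finite V" using G by (simp add: simple_graph_def)
  have I: "ideal_in (polys V) ?I" by (rule ideal_in_SR[OF subset_closed_independence_complex])
  show "edge_indim TYPE('k) V E = enat (card W)"
    unfolding edge_indim_eq[OF G(1)] using W by (intro antisym Inf_lower Inf_greatest) auto
  have N: "edge_module V E = quot_module ?R ?I"
    unfolding edge_module_def edge_ideal_eq_SR[OF G(1)] ..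
  define es where "es = (esyms V (card W) :: ('v, 'k) mpoly list)"
  have es: "set es \<subseteq> SR V {{}}"
    using esym_in_SR[OF finV] set_esyms[of _ V "card W"] unfolding es_def by blast
  \<comment> \<open>Properness: the edge ideal and all elements of \<open>es\<close> lie in the
    ideal of polynomials without constant term.\<close>
  have "foldl (adjoin (polys V)) ?I es \<subseteq> SR V {{}}"
  proof (rule polys.foldl_adjoin_least[OF ideal_in_SR _ es])
    have "{} \<in> independence_complex V E" by (simp add: independence_complex_def independent_def)
    then show "?I \<subseteq> SR V {{}}" by (auto simp: monomial_ideal_def)
  qed (simp add: subset_closed_def)
  then have "1 \<notin> foldl (adjoin (polys V)) ?I es" using one_notin_SR[of "{{}}" V] by blast
  moreover have "weakly_regular (polys V) ?I es"
    unfolding es_def by (rule weakly_regular_esyms_chordal[OF G order_refl W(2)])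
  ultimately have "regular_sequence ?R (quot_module ?R ?I) es"
    unfolding regular_sequence_quot_module_iff[OF I] using esyms_in_polys[OF finV] es_def by blast
  moreover have "length es = card W" by (simp add: es_def)
  ultimately have attained: "\<exists>fs. enat (card W) = enat (length fs) \<and> set fs \<subseteq> SR V {{}} \<and>
      regular_sequence ?R (quot_module ?R ?I) fs"
    using es by metis
  have bound: "length fs \<le> card W"
    if "set fs \<subseteq> SR V {{}}" "regular_sequence ?R (quot_module ?R ?I) fs" for fs
    using weakly_regular_length_le[OF G(1) W(1) that(1)] that(2)
    unfolding regular_sequence_quot_module_iff[OF I] by blast
  show "edge_depth TYPE('k) V E = enat (card W)"
    unfolding edge_depth_def depth_def N irrelevant_ideal_eq_SR
  proof (rule antisym)
    show "Sup {enat (length fs) | fs. set fs \<subseteq> SR V {{}} \<and> regular_sequence ?R (quot_module ?R ?I) fs}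
        \<le> enat (card W)"
      using bound by (intro Sup_least) fastforce
    show "enat (card W) \<le>
        Sup {enat (length fs) | fs. set fs \<subseteq> SR V {{}} \<and> regular_sequence ?R (quot_module ?R ?I) fs}"
      using attained by (intro Sup_upper) blast
  qed
qed

lemma chordal_initially_Cohen_Macaulay:
  assumes "simple_graph V E" "chordal V E"
  shows "initially_Cohen_Macaulay TYPE('k::field) V E"
proof -
  obtain W0 where "maximal_independent V E W0"
    using independent_extends[OF assms(1), of "{}"] by (auto simp: independent_def)
  then have "\<exists>W. maximal_independent V E W \<and> (\<forall>X. maximal_independent V E X \<longrightarrow> card W \<le> card X)"
    by (rule ex_has_least_nat)
  then obtain W where W: "maximal_independent V E W"
    "\<And>X. maximal_independent V E X \<Longrightarrow> card W \<le> card X"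
    by metis
  show ?thesis
    unfolding initially_Cohen_Macaulay_def
    using chordal_depth_indim[OF assms W, where 'k = 'k] by simp
qed


section \<open>Paths\<close>

lemma path_edges_iff:
  "{u, v} \<in> path_edges n \<longleftrightarrow>
     (v = Suc u \<and> 1 \<le> u \<and> u < n) \<or> (u = Suc v \<and> 1 \<le> v \<and> v < n)"
  unfolding path_edges_def by (auto simp: doubleton_eq_iff)

lemma simple_graph_path: "simple_graph {1..n} (path_edges n)"
  unfolding simple_graph_def
proof (intro conjI ballI)
  fix e assume "e \<in> path_edges n"
  then obtain i where i: "e = {i, Suc i}" "1 \<le> i" "i < n" by (auto simp: path_edges_def)
  show "\<exists>u v. u \<in> {1..n} \<and> v \<in> {1..n} \<and> u \<noteq> v \<and> e = {u, v}"
    by (rule exI[of _ i], rule exI[of _ "Suc i"]) (use i in auto)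
qed simp

text \<open>In an induced cycle the smallest vertex would have two neighbours, but on a path it has at
  most one larger neighbour.\<close>

lemma chordal_path: "chordal {1..n} (path_edges n)"
  unfolding chordal_def
proof (rule notI, elim exE conjE)
  fix k W
  assume k: "4 \<le> k" and W: "W \<subseteq> {1..n}"
    and "graph_isomorphic {..<k} (cycle_edges k) W (induced_edges (path_edges n) W)"
  then obtain f where f: "bij_betw f {..<k} W"
    and edge: "\<And>i j. i < k \<Longrightarrow> j < k \<Longrightarrow> {i, j} \<in> cycle_edges k \<Longrightarrow> {f i, f j} \<in> path_edges n"
    unfolding graph_isomorphic_def induced_edges_def by blast
  have inj: "inj_on f {..<k}" and img: "f ` {..<k} = W" using f by (simp_all add: bij_betw_def)
  have "f 0 \<in> f ` {..<k}" using k by simp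
  then have "Min (f ` {..<k}) \<in> f ` {..<k}" by (intro Min_in) blast+
  then obtain i where i: "i < k" "f i = Min (f ` {..<k})" by auto
  have min: "f i \<le> f j" if "j < k" for j using that i(2) by simp
  have larger: "f j = Suc (f i)" if "j < k" "{i, j} \<in> cycle_edges k" for j
    using edge[OF i(1) that] min[OF that(1)] by (auto simp: path_edges_iff)
  \<comment> \<open>\<open>a\<close> and \<open>b\<close> are the two cyclic neighbours of
    \<open>i\<close>, distinct since \<open>4 \<le> k\<close>. Both would have to be mapped to
    \<open>Suc (f i)\<close>.\<close>
  define a where "a = Suc i mod k"
  define b where "b = (if i = 0 then k - 1 else i - 1)"
  have ab: "a < k" "b < k" "a \<noteq> b" using i(1) k by (auto simp: a_def b_def mod_if)
  have "i = Suc b mod k" using i(1) k by (simp add: b_def)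
  then have "{i, a} \<in> cycle_edges k" "{i, b} \<in> cycle_edges k"
    using i(1) ab a_def by (simp_all add: cycle_edges_iff)
  then have "f a = f b" using larger ab by simp
  then show False using inj ab by (auto simp: inj_on_def)
qed

text \<open>A maximal independent set is dominating, and a closed neighbourhood in a path has at
  most three vertices.\<close>

lemma path_maximal_independent_card_ge:
  assumes "maximal_independent {1..n} (path_edges n) W"
  shows "n \<le> 3 * card W"
proof -
  have W: "W \<subseteq> {1..n}" and dom: "\<And>u. u \<in> {1..n} - W \<Longrightarrow> \<exists>w\<in>W. {u, w} \<in> path_edges n"
    using assms unfolding maximal_independent_def by blast+
  have finW: "finite W" using W finite_subset by blast
  have "{1..n} \<subseteq> (\<Union>w\<in>W. {w - 1, w, Suc w})"
  proof
    fix u assume u: "u \<in> {1..n}"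
    show "u \<in> (\<Union>w\<in>W. {w - 1, w, Suc w})"
    proof (cases "u \<in> W")
      case False
      then obtain w where "w \<in> W" "{u, w} \<in> path_edges n" using dom[of u] u by blast
      then show ?thesis by (intro UN_I[of w]) (auto simp: path_edges_iff)
    qed blast
  qed
  then have "card {1..n} \<le> card (\<Union>w\<in>W. {w - 1, w, Suc w})"
    using finW by (intro card_mono) auto
  also have "\<dots> \<le> (\<Sum>w\<in>W. card {w - 1, w, Suc w})" using finW by (rule card_UN_le)
  also have "\<dots> \<le> (\<Sum>w\<in>W. 3)"
    by (rule sum_mono) (simp add: card_insert_if)
  finally show ?thesis by simp
qed

lemma path_maximal_independent_exists:
  assumes "2 \<le> n"
  shows "\<exists>W. maximal_independent {1..n} (path_edges n) W \<and> card W \<le> (n + 2) div 3"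
proof -
  \<comment> \<open>Every third vertex from 2 on dominates itself and both neighbours. If
    \<open>n mod 3 = 1\<close>, the last vertex is left over and is added.\<close>
  define W where "W = {i \<in> {1..n}. i mod 3 = 2 \<or> (i = n \<and> n mod 3 = 1)}"
  have "maximal_independent {1..n} (path_edges n) W"
    unfolding maximal_independent_def
  proof (intro conjI ballI)
    show "W \<subseteq> {1..n}" by (auto simp: W_def)
    have "Suc u \<notin> W" if "u \<in> W" for u
    proof
      assume "Suc u \<in> W"
      then have "u mod 3 = 2" "Suc u mod 3 \<noteq> 0" using that by (auto simp: W_def)
      then show False by presburger
    qed
    then show "independent (path_edges n) W" by (auto simp: independent_def path_edges_iff)
  next
    fix u assume "u \<in> {1..n} - W"
    then have u: "1 \<le> u" "u \<le> n" "u mod 3 \<noteq> 2" "u = n \<longrightarrow> n mod 3 \<noteq> 1"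
      by (auto simp: W_def)
    show "\<exists>w\<in>W. {u, w} \<in> path_edges n"
    proof (cases "u mod 3 = 0")
      case True
      obtain w where w: "u = Suc w" using u(1) by (cases u) simp_all
      then have w2: "w mod 3 = 2" using True by presburger
      then have "1 \<le> w" by (cases w) simp_all
      with w2 have "w \<in> W" using u(2) w by (simp add: W_def)
      moreover have "{u, w} \<in> path_edges n"
        using w2 u(2) w by (cases w) (simp_all add: path_edges_iff)
      ultimately have "\<exists>w\<in>W. {u, w} \<in> path_edges n" by (intro bexI)
      then show ?thesis .
    next
      case False
      then have mod: "u mod 3 = 1" using u(3) by presburger
      then have "Suc u mod 3 = 2" by presburger
      moreover have "u \<noteq> n" using u(4) mod by blast
      ultimately have "Suc u \<in> W" "{u, Suc u} \<in> path_edges n"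
        using u(1,2) by (simp_all add: W_def path_edges_iff)
      then show ?thesis by blast
    qed
  qed
  \<comment> \<open>Each block of three consecutive numbers \<open>3 * j\<close>,
    \<open>3 * j + 1\<close>, \<open>3 * j + 2\<close> contributes at most one vertex; the minimum
    with \<open>n\<close> accounts for the added last vertex, which has the form
    \<open>3 * j + 1\<close>.\<close>
  moreover have "W \<subseteq> (\<lambda>j. min (3 * j + 2) n) ` {..<(n + 2) div 3}"
  proof
    fix i assume i: "i \<in> W"
    show "i \<in> (\<lambda>j. min (3 * j + 2) n) ` {..<(n + 2) div 3}"
    proof (rule image_eqI[of _ _ "i div 3"])
      have i': "i \<le> n" "i mod 3 = 2 \<or> i = n \<and> n mod 3 = 1" using i by (auto simp: W_def)
      then have "i mod 3 \<noteq> 0" by auto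
      then have "i div 3 < (i + 2) div 3" by presburger
      also have "\<dots> \<le> (n + 2) div 3" using i'(1) by (intro div_le_mono) simp
      finally show "i div 3 \<in> {..<(n + 2) div 3}" by simp
      have "i = 3 * (i div 3) + i mod 3" by simp
      then have "i = 3 * (i div 3) + 2 \<or> i = n \<and> n = 3 * (i div 3) + 1" using i'(2) by metis
      then show "i = min (3 * (i div 3) + 2) n" using i'(1) by linarith
    qed
  qed
  then have "card W \<le> (n + 2) div 3"
    using card_image_le[of "{..<(n + 2) div 3}" "\<lambda>j. min (3 * j + 2) n"]
      card_mono[of "(\<lambda>j. min (3 * j + 2) n) ` {..<(n + 2) div 3}" W] by simp
  ultimately show ?thesis by blast
qed

lemma nat_ceiling_third: "nat \<lceil>real n / 3\<rceil> = (n + 2) div 3"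
proof -
  have "n \<le> 3 * ((n + 2) div 3)" "3 * ((n + 2) div 3) < n + 3" by presburger+
  then have "real n \<le> 3 * real ((n + 2) div 3)" "3 * real ((n + 2) div 3) < real n + 3"
    by linarith+
  then have "\<lceil>real n / 3\<rceil> = int ((n + 2) div 3)" by (intro ceiling_unique) simp_all
  then show ?thesis by simp
qed

lemma edge_depth_path:
  assumes "2 \<le> n"
  shows "edge_depth TYPE('k::field) {1..n} (path_edges n) = enat (nat \<lceil>real n / 3\<rceil>)"
proof -
  obtain W where W: "maximal_independent {1..n} (path_edges n) W" "card W \<le> (n + 2) div 3"
    using path_maximal_independent_exists[OF assms] by blast
  have lower: "(n + 2) div 3 \<le> card X" if "maximal_independent {1..n} (path_edges n) X" for X
    using path_maximal_independent_card_ge[OF that] by linarith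
  have "card W = (n + 2) div 3" using W lower by (simp add: antisym)
  then show ?thesis
    using chordal_depth_indim(1)[OF simple_graph_path chordal_path W(1)] lower
    by (simp add: nat_ceiling_third)
qed

theorem proposition5p2:
  shows "(\<forall>(V :: 'v set) E. simple_graph V E \<longrightarrow> chordal V E \<longrightarrow>
            initially_Cohen_Macaulay TYPE('k::field) V E)
       \<and> (\<forall>n\<ge>2. initially_Cohen_Macaulay TYPE('k) {1..n} (path_edges n)
            \<and> edge_depth TYPE('k) {1..n} (path_edges n) = enat (nat \<lceil>real n / 3\<rceil>))"
  by (intro conjI allI impI chordal_initially_Cohen_Macaulay simple_graph_path chordal_path
      edge_depth_path)

end
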